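(* Let $m\ge1$, let $\Omega\subset\mathbb{R}^{m+1}$ be a domain, and let $a^{ij}=a^{ij}(x,p)$ and $b=b(x,z,p)$ be $C^\infty$ on $\Omega\times\mathbb{R}^{m+1}$ and $\Omega\times\mathbb{R}\times\mathbb{R}^{m+1}$ respectively. Consider the following two comparison principles (summation over repeated indices). (A) For $Q\phi=a^{ij}(x,D\phi)D_{ij}\phi+b(x,\phi,D\phi)$: let $\phi,\psi\in C^\infty(\Omega)$ satisfy $Q\phi\ge Q\psi$ in $\Omega$, and put $\tilde a^{ij}(x):=a^{ij}(x,D\phi(x))$. Assume (1) $(a^{ij})$ is nonnegative and $a^{ij}=a^{ji}$; (2) $\frac{\partial b}{\partial z}\le0$; (3) there exist $C^\infty$ vector fields $X_1,\dots,X_r$ and $Y$ (depending on $D\phi(x)$) such that $\tilde a^{ij}(x)D_{ij}=\sum_{k=1}^rX_k^2+Y$. Let $\Gamma$ be an integral curve of a vector field $Z\in\mathcal{L}(X_1,\dots,X_r)$. Suppose $\phi-\psi$ achieves a nonnegative maximum in $\Omega$ at a point of $\Gamma$. Then the maximum is attained at all points of $\Gamma$. (A′) For independent $C^\infty$ vector fields $e_1,\dots,e_{m+1}$ on $\Omega$ and $Q'\phi=a^{ij}(x,e_1\phi,\dots,e_{m+1}\phi)e_ie_j\phi+b(x,\phi,e_1\phi,\dots,e_{m+1}\phi)$: the same assertion with $Q$ replaced by $Q'$, with $\tilde a^{ij}(x):=a^{ij}(x,e_1\phi(x),\dots,e_{m+1}\phi(x))$, and with condition (3) reading: there exist $C^\infty$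 vector fields $X_1,\dots,X_r$ and $Y$ (depending on $e_1\phi(x),\dots,e_{m+1}\phi(x)$) such that $\tilde a^{ij}(x)e_ie_j=\sum_{k=1}^rX_k^2+Y$. Then (A) (respectively (A′)) holds if condition (3) is replaced by the constant rank condition $$\operatorname{rank}(\tilde a^{ij}(x))=\text{constant }\tilde r .$$
   Context: $D\phi$ is the gradient and $D_{ij}\phi$ the second partial derivatives of $\phi$. For $C^\infty$ vector fields $X_1,\dots,X_r$ on $\Omega$, $\mathcal{L}(X_1,\dots,X_r)$ denotes the smallest $C^\infty$-module of vector fields which contains $X_1,\dots,X_r$ and is closed under the Lie bracket; its elements are finite sums of terms $\lambda[X_{i_1},[X_{i_2},\dots,[X_{i_{l-1}},X_{i_l}]]]$ with $\lambda\in C^\infty(\Omega)$ and $i_k\in\{1,\dots,r\}$. The vector fields $X_1,\dots,X_r$ in the conclusion are those of a decomposition of the second order part as in (3). *)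

theory Defs
  imports "HOL-Analysis.Analysis"
begin

text \<open>Functions and vector fields on an open set are total functions; their values off the set
  never matter. Only open sets \<open>S\<close> are intended in the next two definitions.\<close>

fun C_k_on :: "nat \<Rightarrow> 'a::real_normed_vector set \<Rightarrow> ('a \<Rightarrow> 'b::real_normed_vector) \<Rightarrow> bool" where
  "C_k_on 0 S f \<longleftrightarrow> continuous_on S f"
| "C_k_on (Suc k) S f \<longleftrightarrow> (\<forall>x\<in>S. f differentiable (at x)) \<and>
     (\<forall>v. C_k_on k S (\<lambda>x. frechet_derivative f (at x) v))"

definition C_inf_on :: "'a::real_normed_vector set \<Rightarrow> ('a \<Rightarrow> 'b::real_normed_vector) \<Rightarrow> bool" where
  "C_inf_on S f \<longleftrightarrow> (\<forall>k. C_k_on k S f)"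

text \<open>A vector field acting on a function as a first order operator.\<close>

definition vf_apply :: "('a \<Rightarrow> 'a) \<Rightarrow> ('a::real_normed_vector \<Rightarrow> real) \<Rightarrow> 'a \<Rightarrow> real" where
  "vf_apply X f x = frechet_derivative f (at x) (X x)"

definition partial :: "'n \<Rightarrow> (real^'n \<Rightarrow> real) \<Rightarrow> real^'n \<Rightarrow> real" where
  "partial i f x = frechet_derivative f (at x) (axis i 1)"

definition grad :: "(real^'n \<Rightarrow> real) \<Rightarrow> real^'n \<Rightarrow> real^'n" where
  "grad f x = (\<chi> i. partial i f x)"

definition frame_grad :: "('n \<Rightarrow> real^'n \<Rightarrow> real^'n) \<Rightarrow> (real^'n \<Rightarrow> real) \<Rightarrow> real^'n \<Rightarrow> real^'n" where
  "frame_grad e f x = (\<chi> i. vf_apply (e i) f x)"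

definition second_order :: "(real^'n \<Rightarrow> real^'n^'n) \<Rightarrow> (real^'n \<Rightarrow> real) \<Rightarrow> real^'n \<Rightarrow> real" where
  "second_order A f x = (\<Sum>i\<in>UNIV. \<Sum>j\<in>UNIV. A x $ i $ j * partial i (partial j f) x)"

definition frame_second_order ::
    "('n \<Rightarrow> real^'n \<Rightarrow> real^'n) \<Rightarrow> (real^'n \<Rightarrow> real^'n^'n) \<Rightarrow> (real^'n \<Rightarrow> real) \<Rightarrow> real^'n \<Rightarrow> real" where
  "frame_second_order e A f x =
     (\<Sum>i\<in>UNIV. \<Sum>j\<in>UNIV. A x $ i $ j * vf_apply (e i) (vf_apply (e j) f) x)"

definition quasilinear_op ::
    "(real^'n \<Rightarrow> real^'n \<Rightarrow> real^'n^'n) \<Rightarrow> (real^'n \<Rightarrow> real \<Rightarrow> real^'n \<Rightarrow> real)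
     \<Rightarrow> (real^'n \<Rightarrow> real) \<Rightarrow> real^'n \<Rightarrow> real" where
  "quasilinear_op a b f x = second_order (\<lambda>y. a y (grad f y)) f x + b x (f x) (grad f x)"

definition frame_quasilinear_op ::
    "('n \<Rightarrow> real^'n \<Rightarrow> real^'n) \<Rightarrow> (real^'n \<Rightarrow> real^'n \<Rightarrow> real^'n^'n)
     \<Rightarrow> (real^'n \<Rightarrow> real \<Rightarrow> real^'n \<Rightarrow> real) \<Rightarrow> (real^'n \<Rightarrow> real) \<Rightarrow> real^'n \<Rightarrow> real" where
  "frame_quasilinear_op e a b f x =
     frame_second_order e (\<lambda>y. a y (frame_grad e f y)) f x + b x (f x) (frame_grad e f x)"

text \<open>Independence is pointwise. Injectivity is required because \<open>independent\<close> speaks of the set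
  of values, in which repeated vectors would be identified.\<close>

definition independent_fields :: "(real^'n) set \<Rightarrow> ('n \<Rightarrow> real^'n \<Rightarrow> real^'n) \<Rightarrow> bool" where
  "independent_fields \<Omega> e \<longleftrightarrow> (\<forall>i. C_inf_on \<Omega> (e i)) \<and>
     (\<forall>x\<in>\<Omega>. inj (\<lambda>i. e i x) \<and> independent (range (\<lambda>i. e i x)))"

text \<open>\<open>P = X\<^sub>1\<^sup>2 + \<dots> + X\<^sub>r\<^sup>2 + Y\<close> as operators on smooth functions.\<close>

definition sum_of_squares_decomp ::
    "'a::real_normed_vector set \<Rightarrow> (('a \<Rightarrow> real) \<Rightarrow> 'a \<Rightarrow> real) \<Rightarrow> nat \<Rightarrow> (nat \<Rightarrow> 'a \<Rightarrow> 'a) \<Rightarrow> ('a \<Rightarrow> 'a) \<Rightarrow> bool" where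
  "sum_of_squares_decomp \<Omega> P r X Y \<longleftrightarrow>
     (\<forall>k\<in>{1..r}. C_inf_on \<Omega> (X k)) \<and> C_inf_on \<Omega> Y \<and>
     (\<forall>f. C_inf_on \<Omega> f \<longrightarrow>
        (\<forall>x\<in>\<Omega>. P f x = (\<Sum>k=1..r. vf_apply (X k) (vf_apply (X k) f) x) + vf_apply Y f x))"

definition lie_bracket :: "('a \<Rightarrow> 'a) \<Rightarrow> ('a \<Rightarrow> 'a) \<Rightarrow> 'a \<Rightarrow> 'a::real_normed_vector" where
  "lie_bracket V W x = frechet_derivative W (at x) (V x) - frechet_derivative V (at x) (W x)"

text \<open>The rule \<open>restrict\<close> identifies total functions that represent the same vector field
  on \<open>\<Omega>\<close>. For smooth generators all members are smooth on \<open>\<Omega>\<close>.\<close>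

inductive_set lie_module ::
    "'a::real_normed_vector set \<Rightarrow> nat \<Rightarrow> (nat \<Rightarrow> 'a \<Rightarrow> 'a) \<Rightarrow> ('a \<Rightarrow> 'a) set"
  for \<Omega> :: "'a set" and r :: nat and X :: "nat \<Rightarrow> 'a \<Rightarrow> 'a" where
  gen: "k \<in> {1..r} \<Longrightarrow> X k \<in> lie_module \<Omega> r X"
| zero: "(\<lambda>x. 0) \<in> lie_module \<Omega> r X"
| add: "V \<in> lie_module \<Omega> r X \<Longrightarrow> W \<in> lie_module \<Omega> r X \<Longrightarrow> (\<lambda>x. V x + W x) \<in> lie_module \<Omega> r X"
| scale: "C_inf_on \<Omega> c \<Longrightarrow> V \<in> lie_module \<Omega> r X \<Longrightarrow> (\<lambda>x. c x *\<^sub>R V x) \<in> lie_module \<Omega> r X"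
| bracket: "V \<in> lie_module \<Omega> r X \<Longrightarrow> W \<in> lie_module \<Omega> r X \<Longrightarrow> lie_bracket V W \<in> lie_module \<Omega> r X"
| restrict: "V \<in> lie_module \<Omega> r X \<Longrightarrow> (\<And>x. x \<in> \<Omega> \<Longrightarrow> W x = V x) \<Longrightarrow> W \<in> lie_module \<Omega> r X"

text \<open>The time interval \<open>I\<close> may be open, closed or half-open, bounded or not.\<close>

definition integral_curve ::
    "'a::real_normed_vector set \<Rightarrow> ('a \<Rightarrow> 'a) \<Rightarrow> (real \<Rightarrow> 'a) \<Rightarrow> real set \<Rightarrow> bool" where
  "integral_curve \<Omega> Z \<gamma> I \<longleftrightarrow> is_interval I \<and> \<gamma> ` I \<subseteq> \<Omega> \<and>
     (\<forall>t\<in>I. (\<gamma> has_vector_derivative Z (\<gamma> t)) (at t within I))"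

definition max_propagates_along :: "'a set \<Rightarrow> ('a \<Rightarrow> real) \<Rightarrow> 'a set \<Rightarrow> bool" where
  "max_propagates_along \<Omega> u \<Gamma> \<longleftrightarrow>
     (\<exists>q\<in>\<Gamma>. is_arg_max u (\<lambda>x. x \<in> \<Omega>) q \<and> 0 \<le> u q) \<longrightarrow>
     (\<forall>y\<in>\<Gamma>. is_arg_max u (\<lambda>x. x \<in> \<Omega>) y)"

end

theory Submission
  imports Defs
begin

text \<open>
  Subtracting the two inequalities, \<open>v = \<phi> - \<psi> - M\<close> with \<open>M\<close> the maximum satisfies
  \<open>\<Sum> X\<^sub>k\<^sup>2 v + Y v + K |Dv| + C |v| \<ge> 0\<close> locally, and \<open>v \<le> 0\<close>. By Hopf's barrier argument every
  \<open>X\<^sub>k\<close> is orthogonal to every exterior normal of \<open>F = {v = 0}\<close> (Bony). A Lipschitz field with this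
  property leaves \<open>F\<close> invariant, because the squared distance of a curve to \<open>F\<close> satisfies a
  Gronwall inequality; the same estimate for approximate integral curves shows that the property
  passes to Lie brackets, without constructing any flow. For the existence of \<open>X\<^sub>k\<close> under the rank
  condition, the orthogonal projector \<open>P\<close> onto the range of the coefficient matrix \<open>A\<close> is smooth,
  \<open>H = A + 1 - P\<close> is positive definite with \<open>A = P H P\<close>, and the smooth Cholesky factorisation
  of \<open>H\<close> is compressed by \<open>P\<close>. Statement (A) is the case of (A') with the constant standard frame.
\<close>

section \<open>Smooth functions\<close>

text \<open>A smooth nonnegative matrix need not have a smooth square root; where eigenvalues reach
  zero, a root is in general only Lipschitz, and iterated brackets of such fields make no sense.
  Constant rank keeps the range moving smoothly. The range may still be a nontrivial bundle over
  \<Omega>, so a global basis of \<open>rt\<close> smooth sections cannot be expected. The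
  factorisation therefore uses as many fields as the dimension, found without any choice of basis:
  the projector is glued from local ones by uniqueness, and the elimination has positive pivots
  everywhere. In the linearisation the coefficients stay frozen at \<phi> and their change falls on
  the second derivatives of \<psi>. The resulting lower order terms are only estimated, never
  smooth; the barrier argument tolerates this, since at the maximum of
  \<open>v + \<epsilon> w\<close> the gradient of \<open>v\<close> is explicit and
  \<open>|v|\<close> is at most \<open>\<epsilon> w\<close>. Tangency is an equation, not an
  inequality, so that it survives time reversal, multiplication by functions of any sign and
  exchange of the arguments of a bracket.\<close>

declare C_k_on.simps(2) [simp del]

lemma frechet_derivative_cong_open:
  assumes "open S" "x \<in> S" "\<And>y. y \<in> S \<Longrightarrow> f y = g y"
  shows "frechet_derivative f (at x) = frechet_derivative g (at x)"
proof -
  have "(f has_derivative D) (at x) \<longleftrightarrow> (g has_derivative D) (at x)" for D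
    using assms by (metis has_derivative_transform_within_open)
  then show ?thesis by (simp add: frechet_derivative_def)
qed

lemma differentiable_cong_open:
  assumes "open S" "x \<in> S" "\<And>y. y \<in> S \<Longrightarrow> f y = g y"
  shows "f differentiable (at x) \<longleftrightarrow> g differentiable (at x)"
  using assms unfolding differentiable_def by (metis has_derivative_transform_within_open)

lemma frechet_derivative_eqI:
  "(f has_derivative D) (at x) \<Longrightarrow> frechet_derivative f (at x) = D"
  using frechet_derivative_at by metis

lemma C_k_on_cong:
  assumes "open S" "\<And>x. x \<in> S \<Longrightarrow> f x = g x"
  shows "C_k_on k S f \<longleftrightarrow> C_k_on k S g"
  using assms(2)
proof (induction k arbitrary: f g)
  case 0
  then show ?case by (simp cong: continuous_on_cong)
next
  case (Suc k)
  have "frechet_derivative f (at x) = frechet_derivative g (at x)" if "x \<in> S" for x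
    using frechet_derivative_cong_open[OF assms(1) that] Suc.prems by blast
  then have "C_k_on k S (\<lambda>x. frechet_derivative f (at x) v) \<longleftrightarrow> C_k_on k S (\<lambda>x. frechet_derivative g (at x) v)" for v
    by (intro Suc.IH) simp
  moreover have "f differentiable (at x) \<longleftrightarrow> g differentiable (at x)" if "x \<in> S" for x
    using differentiable_cong_open[OF assms(1) that] Suc.prems by blast
  ultimately show ?case by (simp add: C_k_on.simps(2))
qed

lemma C_k_on_SucD: "C_k_on (Suc k) S f \<Longrightarrow> C_k_on k S f"
proof (induction k arbitrary: f)
  case 0
  then show ?case
    unfolding C_k_on.simps(2) using differentiable_imp_continuous_on[of f S]
    by (simp add: differentiable_on_def differentiable_at_withinI)
next
  case (Suc k)
  have "\<forall>x\<in>S. f differentiable (at x)" and D: "\<And>v. C_k_on (Suc k) S (\<lambda>x. frechet_derivative f (at x) v)"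
    using Suc.prems by (simp_all add: C_k_on.simps(2)[of "Suc k"])
  then show ?case using Suc.IH[OF D] by (simp add: C_k_on.simps(2)[of k])
qed

lemma C_k_on_subset: "C_k_on k S f \<Longrightarrow> T \<subseteq> S \<Longrightarrow> C_k_on k T f"
proof (induction k arbitrary: f)
  case 0 then show ?case by (auto intro: continuous_on_subset)
next
  case (Suc k) then show ?case by (auto simp: C_k_on.simps(2))
qed

lemma C_k_on_const: "C_k_on k S (\<lambda>x. c)"
proof (induction k arbitrary: c)
  case (Suc k)
  have "frechet_derivative (\<lambda>x. c) (at x) = (\<lambda>v. 0)" for x :: 'a
    by (intro frechet_derivative_eqI) simp
  then show ?case using Suc by (simp add: C_k_on.simps(2))
qed simp

text \<open>Openness of \<open>S\<close> lets a derivative given by a formula on \<open>S\<close>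
  replace \<open>frechet_derivative\<close>. Each closure property below then reduces to a
  derivative rule and the induction hypothesis.\<close>

lemma C_k_on_SucI:
  assumes "open S" "\<And>x. x \<in> S \<Longrightarrow> (f has_derivative D x) (at x)"
    and "\<And>v. C_k_on k S (\<lambda>x. D x v)"
  shows "C_k_on (Suc k) S f"
proof -
  have D: "frechet_derivative f (at x) = D x" if "x \<in> S" for x
    using assms(2)[OF that] by (rule frechet_derivative_eqI)
  have "C_k_on k S (\<lambda>x. frechet_derivative f (at x) v)" for v
    using assms(3)[of v] C_k_on_cong[OF assms(1), of "\<lambda>x. D x v" "\<lambda>x. frechet_derivative f (at x) v" k] D
    by simp
  then show ?thesis using assms(2) by (auto simp: differentiable_def C_k_on.simps(2))
qed

lemma C_k_on_Suc_has_derivative: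
  "C_k_on (Suc k) S f \<Longrightarrow> x \<in> S \<Longrightarrow> (f has_derivative frechet_derivative f (at x)) (at x)"
  by (simp add: C_k_on.simps(2) frechet_derivative_works)

lemma C_k_on_Suc_derivative:
  "C_k_on (Suc k) S f \<Longrightarrow> C_k_on k S (\<lambda>x. frechet_derivative f (at x) v)"
  by (simp add: C_k_on.simps(2))

section \<open>Closure of smoothness under algebra, composition and differentiation\<close>

lemma C_k_on_add:
  assumes "open S" "C_k_on k S f" "C_k_on k S g"
  shows "C_k_on k S (\<lambda>x. f x + g x)"
  using assms(2,3)
proof (induction k arbitrary: f g)
  case 0 then show ?case by (auto intro: continuous_intros)
next
  case (Suc k)
  show ?case
    by (rule C_k_on_SucI[OF assms(1) has_derivative_add[OF C_k_on_Suc_has_derivative[OF Suc.prems(1)]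
          C_k_on_Suc_has_derivative[OF Suc.prems(2)]]])
      (assumption | rule Suc.IH[OF C_k_on_Suc_derivative[OF Suc.prems(1)] C_k_on_Suc_derivative[OF Suc.prems(2)]])+
qed

lemma C_k_on_linear:
  assumes "open S" "bounded_linear h" "C_k_on k S f"
  shows "C_k_on k S (\<lambda>x. h (f x))"
  using assms(3)
proof (induction k arbitrary: f)
  case 0 then show ?case using assms(2) by (auto intro: bounded_linear.continuous_on)
next
  case (Suc k)
  show ?case
    by (rule C_k_on_SucI[OF assms(1) bounded_linear.has_derivative[OF assms(2)
          C_k_on_Suc_has_derivative[OF Suc.prems]]])
      (assumption | rule Suc.IH[OF C_k_on_Suc_derivative[OF Suc.prems]])+
qed

text \<open>One product rule serves scalar multiples, products and inner products. Each term of the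
  derivative keeps one factor undifferentiated, so the factors are also needed at order
  \<open>k\<close>.\<close>

lemma C_k_on_bilinear:
  assumes "open S" "bounded_bilinear p" "C_k_on k S f" "C_k_on k S g"
  shows "C_k_on k S (\<lambda>x. p (f x) (g x))"
  using assms(3,4)
proof (induction k arbitrary: f g)
  case 0 then show ?case using assms(2) by (auto intro: bounded_bilinear.continuous_on)
next
  case (Suc k)
  have *: "C_k_on k S f" "C_k_on k S g" using Suc.prems C_k_on_SucD by blast+
  show ?case
    by (rule C_k_on_SucI[OF assms(1) bounded_bilinear.FDERIV[OF assms(2)
          C_k_on_Suc_has_derivative[OF Suc.prems(1)] C_k_on_Suc_has_derivative[OF Suc.prems(2)]]])
      (assumption | rule C_k_on_add[OF assms(1) Suc.IH[OF *(1) C_k_on_Suc_derivative[OF Suc.prems(2)]]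
          Suc.IH[OF C_k_on_Suc_derivative[OF Suc.prems(1)] *(2)]])+
qed

lemma C_k_on_sum:
  assumes "open S" "\<And>i. i \<in> I \<Longrightarrow> C_k_on k S (f i)"
  shows "C_k_on k S (\<lambda>x. \<Sum>i\<in>I. f i x)"
  using assms(2)
  by (induction I rule: infinite_finite_induct) (auto intro: C_k_on_const C_k_on_add[OF assms(1)])

lemma linear_euclidean_expand:
  fixes L :: "'a::euclidean_space \<Rightarrow> 'b::real_normed_vector"
  assumes "linear L"
  shows "L v = (\<Sum>b\<in>Basis. (v \<bullet> b) *\<^sub>R L b)"
proof -
  have "L (\<Sum>b\<in>Basis. (v \<bullet> b) *\<^sub>R b) = (\<Sum>b\<in>Basis. (v \<bullet> b) *\<^sub>R L b)"
    by (simp add: linear_sum[OF assms] linear_cmul[OF assms])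
  then show ?thesis by (simp only: euclidean_representation)
qed

text \<open>\<open>C_k_on\<close> speaks of derivatives in constant directions only, whereas the
  chain rule differentiates \<open>f\<close> in a moving direction. Expansion in a basis turns this
  into finitely many constant directions with varying coefficients; hence the Euclidean domain of
  \<open>f\<close>.\<close>

lemma C_k_on_compose:
  fixes f :: "'b::euclidean_space \<Rightarrow> 'c::real_normed_vector"
  assumes "open S" "open T" "C_k_on k T f" "C_k_on k S g" "g ` S \<subseteq> T"
  shows "C_k_on k S (\<lambda>x. f (g x))"
  using assms(3,4)
proof (induction k arbitrary: f)
  case 0 then show ?case using assms(5) by (auto intro: continuous_on_compose2)
next
  case (Suc k)
  have g: "C_k_on k S g" using Suc.prems C_k_on_SucD by blast
  let ?D = "\<lambda>x v. \<Sum>b\<in>Basis. (frechet_derivative g (at x) v \<bullet> b) *\<^sub>R frechet_derivative f (at (g x)) b"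
  show ?case
  proof (rule C_k_on_SucI[OF assms(1), of _ ?D])
    fix x assume x: "x \<in> S"
    then have "g x \<in> T" using assms(5) by auto
    then have f': "(f has_derivative frechet_derivative f (at (g x))) (at (g x))"
      using C_k_on_Suc_has_derivative Suc.prems by blast
    have "((\<lambda>x. f (g x)) has_derivative (\<lambda>v. frechet_derivative f (at (g x)) (frechet_derivative g (at x) v))) (at x)"
      using diff_chain_at[OF C_k_on_Suc_has_derivative[OF Suc.prems(2) x] f'] by (simp add: o_def)
    moreover have "(\<lambda>v. frechet_derivative f (at (g x)) (frechet_derivative g (at x) v)) = ?D x"
      by (intro ext linear_euclidean_expand has_derivative_linear[OF f'])
    ultimately show "((\<lambda>x. f (g x)) has_derivative ?D x) (at x)" by simp
  next
    fix v
    show "C_k_on k S (\<lambda>x. ?D x v)"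
      by (rule C_k_on_sum C_k_on_bilinear[OF _ bounded_bilinear_scaleR]
       C_k_on_linear[OF _ bounded_linear_inner_left] assms(1)
       Suc.IH[OF C_k_on_Suc_derivative[OF Suc.prems(1)] g] C_k_on_Suc_derivative[OF Suc.prems(2)])+
  qed
qed

lemma C_inf_onI: "(\<And>k. C_k_on k S f) \<Longrightarrow> C_inf_on S f"
  by (simp add: C_inf_on_def)

lemma C_inf_onD: "C_inf_on S f \<Longrightarrow> C_k_on k S f"
  by (simp add: C_inf_on_def)

lemma C_inf_on_cong:
  assumes "open S" "\<And>x. x \<in> S \<Longrightarrow> f x = g x"
  shows "C_inf_on S f \<longleftrightarrow> C_inf_on S g"
proof -
  have "C_k_on k S f \<longleftrightarrow> C_k_on k S g" for k using assms by (rule C_k_on_cong)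
  then show ?thesis by (simp add: C_inf_on_def)
qed

lemma C_inf_on_subset: "C_inf_on S f \<Longrightarrow> T \<subseteq> S \<Longrightarrow> C_inf_on T f"
  by (rule C_inf_onI, rule C_k_on_subset[OF C_inf_onD])

lemma C_inf_on_const: "C_inf_on S (\<lambda>x. c)"
  by (rule C_inf_onI, rule C_k_on_const)

lemma C_inf_on_add:
  "open S \<Longrightarrow> C_inf_on S f \<Longrightarrow> C_inf_on S g \<Longrightarrow> C_inf_on S (\<lambda>x. f x + g x)"
  by (rule C_inf_onI, rule C_k_on_add[OF _ C_inf_onD C_inf_onD])

lemma C_inf_on_linear:
  "open S \<Longrightarrow> bounded_linear h \<Longrightarrow> C_inf_on S f \<Longrightarrow> C_inf_on S (\<lambda>x. h (f x))"
  by (rule C_inf_onI, rule C_k_on_linear[OF _ _ C_inf_onD])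

lemma C_inf_on_bilinear:
  "open S \<Longrightarrow> bounded_bilinear p \<Longrightarrow> C_inf_on S f \<Longrightarrow> C_inf_on S g \<Longrightarrow> C_inf_on S (\<lambda>x. p (f x) (g x))"
  by (rule C_inf_onI, rule C_k_on_bilinear[OF _ _ C_inf_onD C_inf_onD])

lemmas C_inf_on_scaleR = C_inf_on_bilinear[OF _ bounded_bilinear_scaleR]
lemmas C_inf_on_mult = C_inf_on_bilinear[OF _ bounded_bilinear_mult]
lemmas C_inf_on_inner = C_inf_on_bilinear[OF _ bounded_bilinear_inner]

lemma C_inf_on_sum:
  "open S \<Longrightarrow> (\<And>i. i \<in> I \<Longrightarrow> C_inf_on S (f i)) \<Longrightarrow> C_inf_on S (\<lambda>x. \<Sum>i\<in>I. f i x)"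
  by (rule C_inf_onI, rule C_k_on_sum[OF _ C_inf_onD])

lemma C_inf_on_minus: "open S \<Longrightarrow> C_inf_on S f \<Longrightarrow> C_inf_on S (\<lambda>x. - f x)"
  by (rule C_inf_on_linear[OF _ bounded_linear_minus[OF bounded_linear_ident]])

lemma C_inf_on_diff:
  "open S \<Longrightarrow> C_inf_on S f \<Longrightarrow> C_inf_on S g \<Longrightarrow> C_inf_on S (\<lambda>x. f x - g x)"
  using C_inf_on_add[of S f "\<lambda>x. - g x"] C_inf_on_minus[of S g] by simp

lemma C_inf_on_ident: "open S \<Longrightarrow> C_inf_on S (\<lambda>x. x)"
proof -
  assume "open S"
  have "C_k_on k S (\<lambda>x. x)" for k
  proof (cases k)
    case 0 then show ?thesis by simp
  next
    case (Suc j)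
    show ?thesis unfolding Suc
      by (rule C_k_on_SucI[OF \<open>open S\<close> has_derivative_ident]) (rule C_k_on_const)
  qed
  then show ?thesis by (simp add: C_inf_on_def)
qed

lemma C_inf_on_compose:
  fixes f :: "'b::euclidean_space \<Rightarrow> 'c::real_normed_vector"
  shows "open S \<Longrightarrow> open T \<Longrightarrow> C_inf_on T f \<Longrightarrow> C_inf_on S g \<Longrightarrow> g ` S \<subseteq> T \<Longrightarrow> C_inf_on S (\<lambda>x. f (g x))"
  by (rule C_inf_onI, rule C_k_on_compose[of _ _ _ f g, OF _ _ C_inf_onD C_inf_onD])

lemma C_inf_on_Pair:
  assumes "open S" "C_inf_on S f" "C_inf_on S g"
  shows "C_inf_on S (\<lambda>x. (f x, g x))"
proof -
  have "bounded_linear (\<lambda>u. (u, 0))" "bounded_linear (\<lambda>u. (0, u))"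
    by (intro bounded_linear_Pair bounded_linear_ident bounded_linear_zero)+
  from C_inf_on_add[OF assms(1) C_inf_on_linear[OF assms(1) this(1) assms(2)] C_inf_on_linear[OF assms(1) this(2) assms(3)]]
  show ?thesis by simp
qed

lemma C_inf_on_has_derivative:
  "C_inf_on S f \<Longrightarrow> x \<in> S \<Longrightarrow> (f has_derivative frechet_derivative f (at x)) (at x)"
  by (rule C_k_on_Suc_has_derivative[OF C_inf_onD[of S f "Suc 0"]])

lemma C_inf_on_continuous: "C_inf_on S f \<Longrightarrow> continuous_on S f"
  using C_inf_onD[of S f 0] by simp

lemma C_inf_on_derivative_const: "C_inf_on S f \<Longrightarrow> C_inf_on S (\<lambda>x. frechet_derivative f (at x) v)"
  by (rule C_inf_onI, rule C_k_on_Suc_derivative[OF C_inf_onD])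

lemma C_inf_on_derivative:
  fixes f :: "'a::euclidean_space \<Rightarrow> 'b::real_normed_vector"
  assumes "open S" "C_inf_on S f" "C_inf_on S X"
  shows "C_inf_on S (\<lambda>x. frechet_derivative f (at x) (X x))"
proof -
  have "C_inf_on S (\<lambda>x. \<Sum>b\<in>Basis. (X x \<bullet> b) *\<^sub>R frechet_derivative f (at x) b)"
    using assms by (intro C_inf_on_sum C_inf_on_scaleR C_inf_on_inner C_inf_on_const C_inf_on_derivative_const)
  moreover have "frechet_derivative f (at x) (X x) = (\<Sum>b\<in>Basis. (X x \<bullet> b) *\<^sub>R frechet_derivative f (at x) b)"
    if "x \<in> S" for x
    by (rule linear_euclidean_expand[OF has_derivative_linear[OF C_inf_on_has_derivative[OF assms(2) that]]])
  ultimately show ?thesis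
    by (subst C_inf_on_cong[OF assms(1)])
qed

lemma C_inf_on_vf_apply:
  fixes f :: "'a::euclidean_space \<Rightarrow> real"
  shows "open S \<Longrightarrow> C_inf_on S f \<Longrightarrow> C_inf_on S X \<Longrightarrow> C_inf_on S (vf_apply X f)"
  unfolding vf_apply_def[abs_def] by (rule C_inf_on_derivative)

lemma C_inf_on_lie_bracket:
  fixes V :: "'a::euclidean_space \<Rightarrow> 'a"
  assumes "open S" "C_inf_on S V" "C_inf_on S W"
  shows "C_inf_on S (lie_bracket V W)"
  unfolding lie_bracket_def[abs_def] using assms by (intro C_inf_on_diff C_inf_on_derivative)

text \<open>The derivative is a multiple of another power, so the induction closes once
  \<open>a\<close> is generalised. The exponents -1 and -1/2 later supply reciprocals and inverse
  square roots.\<close>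

lemma C_inf_on_powr: "C_inf_on {0<..} (\<lambda>x::real. x powr a)"
proof -
  have "C_k_on k {0<..} (\<lambda>x::real. x powr a)" for k
  proof (induction k arbitrary: a)
    case 0 then show ?case by (auto intro!: continuous_intros)
  next
    case (Suc k)
    show ?case
    proof (rule C_k_on_SucI[of _ _ "\<lambda>x v. v * (a * x powr (a - 1))"])
      fix x :: real assume "x \<in> {0<..}"
      then show "((\<lambda>x. x powr a) has_derivative (\<lambda>v. v * (a * x powr (a - 1)))) (at x)"
        using has_real_derivative_powr[of x a] by (simp add: has_field_derivative_def mult_commute_abs)
    next
      fix v :: real
      show "C_k_on k {0<..} (\<lambda>x. v * (a * x powr (a - 1)))"
        by (intro C_k_on_bilinear[OF _ bounded_bilinear_mult] C_k_on_const Suc) auto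
    qed auto
  qed
  then show ?thesis by (simp add: C_inf_on_def)
qed

lemma C_inf_on_powr_comp:
  fixes f :: "'a::real_normed_vector \<Rightarrow> real"
  shows "open S \<Longrightarrow> C_inf_on S f \<Longrightarrow> (\<And>x. x \<in> S \<Longrightarrow> 0 < f x) \<Longrightarrow> C_inf_on S (\<lambda>x. f x powr a)"
  by (rule C_inf_on_compose[where f = "\<lambda>x. x powr a" and g = f, OF _ _ C_inf_on_powr]) auto

lemma C_inf_on_vec_nth:
  fixes f :: "'a::real_normed_vector \<Rightarrow> 'b::real_normed_vector^'n"
  shows "open S \<Longrightarrow> C_inf_on S f \<Longrightarrow> C_inf_on S (\<lambda>x. f x $ i)"
  by (rule C_inf_on_linear[OF _ bounded_linear_vec_nth])

lemma C_inf_on_vecI: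
  fixes f :: "'a::real_normed_vector \<Rightarrow> real^'n"
  assumes "open S" "\<And>i. C_inf_on S (\<lambda>x. f x $ i)"
  shows "C_inf_on S f"
proof -
  have "C_inf_on S (\<lambda>x. \<Sum>i\<in>UNIV. (f x $ i) *\<^sub>R (axis i 1 :: real^'n))"
    using assms by (intro C_inf_on_sum C_inf_on_scaleR C_inf_on_const)
  moreover have "(\<Sum>i\<in>UNIV. (f x $ i) *\<^sub>R (axis i 1 :: real^'n)) = f x" for x
    using basis_expansion[of "f x"] by (simp add: scalar_mult_eq_scaleR)
  ultimately show ?thesis by simp
qed

section \<open>Lipschitz bounds on compact convex sets, and locality of smoothness\<close>

lemma C_inf_on_locally_lipschitz:
  fixes f :: "'a::euclidean_space \<Rightarrow> 'b::real_normed_vector"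
  assumes "C_inf_on S f" "compact K" "convex K" "K \<subseteq> S"
  obtains L where "0 \<le> L" "\<And>x y. x \<in> K \<Longrightarrow> y \<in> K \<Longrightarrow> norm (f x - f y) \<le> L * norm (x - y)"
proof -
  \<comment> \<open>\<open>B\<close> dominates the operator norm of the derivative, and it is
    continuous because only derivatives in fixed directions enter.\<close>
  define B where "B x = (\<Sum>b\<in>Basis. norm (frechet_derivative f (at x) b))" for x
  have "continuous_on K B" unfolding B_def
    by (intro continuous_on_sum continuous_on_norm continuous_on_subset[OF C_inf_on_continuous assms(4)]
       C_inf_on_derivative_const assms)
  then have "bounded (B ` K)" using assms(2) compact_continuous_image compact_imp_bounded by blast
  then obtain L where L: "0 < L" "\<And>x. x \<in> K \<Longrightarrow> norm (B x) \<le> L"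
    unfolding bounded_pos by auto
  have "onorm (frechet_derivative f (at x)) \<le> L" if "x \<in> K" for x
  proof (rule onorm_le)
    have D: "(f has_derivative frechet_derivative f (at x)) (at x)"
      using that assms C_inf_on_has_derivative by blast
    fix v
    have "norm (frechet_derivative f (at x) v) \<le> (\<Sum>b\<in>Basis. norm ((v \<bullet> b) *\<^sub>R frechet_derivative f (at x) b))"
      by (subst linear_euclidean_expand[OF has_derivative_linear[OF D], of v]) (rule norm_sum)
    also have "\<dots> \<le> (\<Sum>b\<in>Basis. norm v * norm (frechet_derivative f (at x) b))"
      by (intro sum_mono) (simp add: Basis_le_norm mult_right_mono)
    also have "\<dots> = norm v * B x" by (simp add: B_def sum_distrib_left)
    also have "\<dots> \<le> L * norm v" using L(2)[OF that]
      by (metis abs_le_iff mult.commute mult_left_mono norm_ge_zero real_norm_def)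
    finally show "norm (frechet_derivative f (at x) v) \<le> L * norm v" .
  qed
  moreover have "(f has_derivative frechet_derivative f (at x)) (at x within K)" if "x \<in> K" for x
    using that assms C_inf_on_has_derivative has_derivative_at_withinI by blast
  ultimately have "norm (f x - f y) \<le> L * norm (x - y)" if "x \<in> K" "y \<in> K" for x y
    using differentiable_bound[OF assms(3), of f "\<lambda>x. frechet_derivative f (at x)" L x y] that by simp
  then show ?thesis using L(1) that[of L] by auto
qed

lemma C_k_on_local:
  assumes "\<And>x. x \<in> S \<Longrightarrow> \<exists>U. open U \<and> x \<in> U \<and> C_k_on k U f"
  shows "C_k_on k S f"
  using assms
proof (induction k arbitrary: f)
  case 0
  have "isCont f x" if "x \<in> S" for x
    using 0[OF that] continuous_on_eq_continuous_at by auto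
  then show ?case by (simp add: continuous_at_imp_continuous_on)
next
  case (Suc k)
  have "f differentiable (at x)" if "x \<in> S" for x
    using Suc.prems[OF that] by (auto simp: C_k_on.simps(2))
  moreover have "C_k_on k S (\<lambda>x. frechet_derivative f (at x) v)" for v
  proof (rule Suc.IH)
    fix x assume "x \<in> S"
    from Suc.prems[OF this] obtain U where U: "open U" "x \<in> U" "C_k_on (Suc k) U f" by blast
    show "\<exists>U. open U \<and> x \<in> U \<and> C_k_on k U (\<lambda>x. frechet_derivative f (at x) v)"
      using U(1,2) C_k_on_Suc_derivative[OF U(3)] by (intro exI[of _ U] conjI)
  qed
  ultimately show ?case by (simp add: C_k_on.simps(2))
qed

text \<open>Allows a function defined by pointwise choice to be recognised as smooth from unrelated
  local descriptions, as happens for the range projector.\<close>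

lemma C_inf_on_local:
  assumes "\<And>x. x \<in> S \<Longrightarrow> \<exists>U. open U \<and> x \<in> U \<and> C_inf_on U f"
  shows "C_inf_on S f"
proof (rule C_inf_onI, rule C_k_on_local)
  fix k x assume "x \<in> S"
  from assms[OF this] obtain U where U: "open U" "x \<in> U" "C_inf_on U f" by blast
  show "\<exists>U. open U \<and> x \<in> U \<and> C_k_on k U f"
    using U(1,2) C_inf_onD[OF U(3)] by (intro exI[of _ U] conjI)
qed

lemma C_inf_on_entry:
  fixes A :: "'a::real_normed_vector \<Rightarrow> real^'n^'m"
  shows "open S \<Longrightarrow> C_inf_on S A \<Longrightarrow> C_inf_on S (\<lambda>x. A x $ i $ j)"
  by (intro C_inf_on_vec_nth)

lemma C_inf_on_matrix_vector_mult:
  fixes A :: "'a::real_normed_vector \<Rightarrow> real^'n^'m"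
  assumes "open S" "\<And>i j. C_inf_on S (\<lambda>x. A x $ i $ j)" "C_inf_on S v"
  shows "C_inf_on S (\<lambda>x. A x *v v x)"
proof (rule C_inf_on_vecI[OF assms(1)])
  fix i
  show "C_inf_on S (\<lambda>x. (A x *v v x) $ i)" unfolding matrix_vector_mult_def vec_lambda_beta
    by (intro C_inf_on_sum C_inf_on_mult C_inf_on_vec_nth assms)
qed

lemma C_inf_on_exp: "C_inf_on UNIV (exp :: real \<Rightarrow> real)"
proof -
  have "C_k_on k UNIV (exp :: real \<Rightarrow> real)" for k
  proof (induction k)
    case 0 show ?case by (simp add: continuous_on_exp)
  next
    case (Suc k)
    show ?case
    proof (rule C_k_on_SucI[of _ _ "\<lambda>x v. v * exp x"])
      show "(exp has_derivative (\<lambda>v. v * exp x)) (at x)" for x :: real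
        using DERIV_exp[of x] by (simp add: has_field_derivative_def mult_commute_abs)
      show "C_k_on k UNIV (\<lambda>x :: real. v * exp x)" for v :: real
        by (rule C_k_on_bilinear[OF open_UNIV bounded_bilinear_mult C_k_on_const Suc])
    qed simp
  qed
  then show ?thesis by (simp add: C_inf_on_def)
qed

lemma C_inf_on_exp_comp:
  fixes f :: "'a::real_normed_vector \<Rightarrow> real"
  shows "open S \<Longrightarrow> C_inf_on S f \<Longrightarrow> C_inf_on S (\<lambda>x. exp (f x))"
  by (rule C_inf_on_compose[OF _ open_UNIV C_inf_on_exp]) auto

section \<open>Exterior normals and invariant sets\<close>

definition exterior_normal :: "'a::real_normed_vector set \<Rightarrow> 'a \<Rightarrow> 'a \<Rightarrow> bool" where
  "exterior_normal F z \<nu> \<longleftrightarrow> ball (z + \<nu>) (norm \<nu>) \<inter> F = {}"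

definition tangent_to :: "'a::real_inner set \<Rightarrow> ('a \<Rightarrow> 'a) \<Rightarrow> bool" where
  "tangent_to F V \<longleftrightarrow> (\<forall>z\<in>F. \<forall>\<nu>. exterior_normal F z \<nu> \<longrightarrow> V z \<bullet> \<nu> = 0)"

lemma tangent_to_add: "tangent_to F V \<Longrightarrow> tangent_to F W \<Longrightarrow> tangent_to F (\<lambda>x. V x + W x)"
  by (simp add: tangent_to_def inner_add_left)

lemma tangent_to_scale: "tangent_to F V \<Longrightarrow> tangent_to F (\<lambda>x. c x *\<^sub>R V x)"
  by (simp add: tangent_to_def)

section \<open>Gronwall estimate for the distance of a curve to a closed set\<close>

text \<open>At a nearest point \<open>z\<close> the vector \<open>c t - z\<close> is an exterior
  normal, so \<open>U t z\<close> does not contribute to the growth of the squared distance; only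
  the Lipschitz difference \<open>U t (c t) - U t z\<close> and the defect \<open>\<epsilon>\<close>
  do. The defect admits curves that solve the equation only approximately;
  \<open>\<epsilon> = 0\<close> gives exact invariance.\<close>

lemma approx_invariance:
  fixes F :: "'a::euclidean_space set" and c :: "real \<Rightarrow> 'a"
  assumes cpt: "compact (F \<inter> cball y \<rho>)" and y: "y \<in> F" and pos: "0 \<le> T" "0 \<le> \<epsilon>" "0 \<le> L"
    and c0: "c 0 = y" and near: "\<And>t. t \<in> {0..T} \<Longrightarrow> norm (c t - y) \<le> \<rho> / 3"
    and der: "\<And>t. t \<in> {0..T} \<Longrightarrow> (c has_vector_derivative c' t) (at t within {0..T})"
    and lip: "\<And>t x z. t \<in> {0..T} \<Longrightarrow> x \<in> cball y \<rho> \<Longrightarrow> z \<in> cball y \<rho> \<Longrightarrow>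
        norm (U t x - U t z) \<le> L * norm (x - z)"
    and tan: "\<And>t. t \<in> {0..T} \<Longrightarrow> tangent_to F (U t)"
    and err: "\<And>t. t \<in> {0..T} \<Longrightarrow> norm (c' t - U t (c t)) \<le> \<epsilon>"
  shows "\<exists>z\<in>F. norm (c T - z) \<le> \<epsilon> * exp ((L + 1) * T)"
proof -
  \<comment> \<open>Nearest points exist in the compact piece \<open>K\<close>. As \<open>c\<close>
    stays within \<open>\<rho> / 3\<close> of \<open>y\<close>, any point of \<open>F\<close> closer
    to \<open>c t\<close> would be within \<open>2 \<rho> / 3\<close> of \<open>y\<close>, hence in
    \<open>K\<close>; so a nearest point of \<open>K\<close> is one of \<open>F\<close>.\<close>
  define K where "K = F \<inter> cball y \<rho>"
  define f where "f t = (infdist (c t) K)\<^sup>2" for t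
  have \<rho>: "0 \<le> \<rho>" using near[of 0] pos c0 by auto
  then have yK: "y \<in> K" using y by (simp add: K_def)
  have clK: "closed K" using cpt by (simp add: K_def compact_imp_closed)
  have ex: "\<exists>z\<in>K. infdist (c t) K = norm (c t - z)" for t
    using infdist_attains_inf[OF clK, of "c t"] yK by (metis dist_norm empty_iff)
  have ccont: "continuous_on {0..T} c"
    unfolding continuous_on_eq_continuous_within using der has_vector_derivative_continuous by blast
  \<comment> \<open>The squared distance need not be differentiable. It is compared with a strict
    supersolution: \<open>G' = (2 L + 2) G\<close> exceeds \<open>\<epsilon>^2 + (2 L + 1) G\<close>
    because \<open>\<epsilon>^2 < \<delta> \<le> G\<close>. The contradiction arises at the last
    time \<open>t\<close> with \<open>f t \<le> G t\<close>.\<close>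
  have key: "f T \<le> \<delta> * exp ((2 * L + 2) * T)" if \<delta>: "\<epsilon>\<^sup>2 < \<delta>" for \<delta>
  proof (rule ccontr)
    define G where "G t = \<delta> * exp ((2 * L + 2) * t)" for t
    assume "\<not> f T \<le> \<delta> * exp ((2 * L + 2) * T)"
    then have fT: "G T < f T" by (simp add: G_def)
    have \<delta>0: "0 < \<delta>" using \<delta> by (smt (verit) zero_le_power2)
    define S where "S = {t \<in> {0..T}. f t - G t \<le> 0}"
    have "continuous_on {0..T} (\<lambda>t. f t - G t)" unfolding f_def G_def
      by (intro continuous_intros continuous_on_infdist ccont)
    then have "closed S" unfolding S_def by (rule continuous_on_closed_Collect_le) auto
    then have "compact S" unfolding compact_eq_bounded_closed
      by (auto simp: S_def intro: bounded_subset[of "{0..T}"])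
    moreover have "0 \<in> S" using pos c0 yK \<delta>0 by (simp add: S_def f_def G_def)
    ultimately obtain t where t: "t \<in> S" "\<And>s. s \<in> S \<Longrightarrow> s \<le> t"
      using compact_attains_sup[of S] by blast
    then have tT: "t \<in> {0..T}" and ft: "f t \<le> G t" by (auto simp: S_def)
    have "t < T" using fT tT ft by (cases "t = T") auto
    obtain z where z: "z \<in> K" "infdist (c t) K = norm (c t - z)" using ex by blast
    define d where "d = norm (c t - z)"
    have "d \<le> norm (c t - y)" using infdist_le[OF yK, of "c t"] z by (simp add: d_def dist_norm)
    then have d3: "d \<le> \<rho> / 3" using near[OF tT] by simp
    have "exterior_normal F z (c t - z)"
    proof -
      have False if x: "x \<in> F" "norm (c t - x) < d" for x
      proof -
        have "norm (y - x) \<le> norm (c t - y) + norm (c t - x)"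
          using norm_triangle_ineq[of "y - c t" "c t - x"] by (simp add: norm_minus_commute)
        then have "x \<in> K" using x d3 near[OF tT] \<rho> by (simp add: K_def dist_norm)
        then show False using infdist_le[of x K "c t"] x z by (simp add: d_def dist_norm)
      qed
      then show ?thesis by (force simp: exterior_normal_def dist_norm d_def)
    qed
    then have tan0: "U t z \<bullet> (c t - z) = 0" using tan[OF tT] z by (simp add: tangent_to_def K_def)
    have cin: "c t \<in> cball y \<rho>" using near[OF tT] \<rho> by (simp add: dist_norm norm_minus_commute)
    have "c' t \<bullet> (c t - z) = (c' t - U t (c t)) \<bullet> (c t - z) + (U t (c t) - U t z) \<bullet> (c t - z)"
      using tan0 by (simp add: inner_diff_left)
    also have "\<dots> \<le> \<epsilon> * d + (L * d) * d"
    proof (intro add_mono)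
      show "(c' t - U t (c t)) \<bullet> (c t - z) \<le> \<epsilon> * d"
        using norm_cauchy_schwarz[of "c' t - U t (c t)" "c t - z"] err[OF tT]
        by (smt (verit) d_def mult_right_mono norm_ge_zero)
      show "(U t (c t) - U t z) \<bullet> (c t - z) \<le> (L * d) * d"
        using norm_cauchy_schwarz[of "U t (c t) - U t z" "c t - z"] lip[OF tT cin, of z] z
        by (smt (verit) d_def K_def IntD2 mult_right_mono norm_ge_zero)
    qed
    finally have "2 * (c' t \<bullet> (c t - z)) \<le> 2 * \<epsilon> * d + 2 * L * d\<^sup>2"
      by (simp add: power2_eq_square algebra_simps)
    also have "\<dots> \<le> \<epsilon>\<^sup>2 + (2 * L + 1) * d\<^sup>2"
      using zero_le_power2[of "\<epsilon> - d"] by (simp add: power2_eq_square algebra_simps)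
    also have "\<dots> \<le> \<epsilon>\<^sup>2 + (2 * L + 1) * G t"
      using ft pos z by (intro add_left_mono mult_left_mono) (auto simp: f_def d_def)
    also have "\<dots> < G t + (2 * L + 1) * G t"
    proof -
      have "1 \<le> exp ((2 * L + 2) * t)" using tT pos by simp
      then have "\<delta> \<le> G t" using \<delta>0 by (simp add: G_def)
      then show ?thesis using \<delta> by simp
    qed
    finally have slope: "0 < (2 * L + 2) * G t - 2 * (c' t \<bullet> (c t - z))" by (simp add: algebra_simps)
    have cd: "(c has_derivative (\<lambda>h. h *\<^sub>R c' t)) (at t within {0..T})"
      using der[OF tT] by (simp add: has_vector_derivative_def)
    \<comment> \<open>With \<open>z\<close> frozen, the squared distance of \<open>c s\<close> to
      \<open>z\<close> is differentiable, dominates \<open>f\<close> and agrees with it at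
      \<open>t\<close>; it is enough that it stays below \<open>G\<close> just after
      \<open>t\<close>.\<close>
    have "((\<lambda>s. G s - (c s - z) \<bullet> (c s - z)) has_real_derivative
        (2 * L + 2) * G t - 2 * (c' t \<bullet> (c t - z))) (at t within {0..T})"
      unfolding has_field_derivative_def G_def
      by (rule has_derivative_eq_rhs, (rule derivative_eq_intros cd | simp)+)
        (auto simp: fun_eq_iff algebra_simps inner_commute)
    from has_real_derivative_pos_inc_right[OF this slope]
    obtain h where h: "0 < h" "\<And>s. 0 < s \<Longrightarrow> t + s \<in> {0..T} \<Longrightarrow> s < h \<Longrightarrow>
       G t - (c t - z) \<bullet> (c t - z) < G (t + s) - (c (t + s) - z) \<bullet> (c (t + s) - z)" by blast
    define s where "s = min (h / 2) (T - t)"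
    have s: "0 < s" "s < h" "t + s \<in> {0..T}" using h(1) \<open>t < T\<close> tT by (auto simp: s_def)
    have "G t - (c t - z) \<bullet> (c t - z) \<ge> 0" using ft z by (simp add: f_def dot_square_norm)
    then have "(norm (c (t + s) - z))\<^sup>2 \<le> G (t + s)" using h(2)[OF s(1,3,2)] by (simp add: dot_square_norm)
    moreover have "f (t + s) \<le> (norm (c (t + s) - z))\<^sup>2"
      unfolding f_def using infdist_le[OF z(1), of "c (t + s)"] by (simp add: dist_norm infdist_nonneg)
    ultimately have "t + s \<in> S" using s by (simp add: S_def)
    then show False using t(2) s(1) by force
  qed
  have "f T \<le> \<epsilon>\<^sup>2 * exp ((2 * L + 2) * T)"
  proof (rule dense_ge)
    fix w assume "\<epsilon>\<^sup>2 * exp ((2 * L + 2) * T) < w"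
    then have "\<epsilon>\<^sup>2 < w / exp ((2 * L + 2) * T)" by (simp add: pos_less_divide_eq)
    from key[OF this] show "f T \<le> w" by simp
  qed
  also have "\<dots> = (\<epsilon> * exp ((L + 1) * T))\<^sup>2"
    using exp_double[of "(L + 1) * T"] by (simp add: power_mult_distrib algebra_simps)
  finally have "(infdist (c T) K)\<^sup>2 \<le> (\<epsilon> * exp ((L + 1) * T))\<^sup>2"
    by (simp only: f_def)
  then have "infdist (c T) K \<le> \<epsilon> * exp ((L + 1) * T)"
    by (rule power2_le_imp_le) (use pos in simp)
  then show ?thesis using ex[of T] by (auto simp: K_def)
qed

text \<open>\<open>F\<close> is closed only relative to \<Omega>; nearest points require pieces of
  it that are compact in the whole space.\<close>

lemma compact_Int_closedin:
  assumes "closedin (top_of_set \<Omega>) F" "compact K" "K \<subseteq> \<Omega>"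
  shows "compact (F \<inter> K)"
  using assms by (metis closedin_closed compact_Int_closed inf.absorb_iff2 inf.assoc inf.commute)

text \<open>The times spent in \<open>F\<close> form a relatively closed subset of the interval,
  which is relatively open by \<open>approx_invariance\<close> with zero defect. Times before
  \<open>t\<close> are reached by running the curve backwards with \<open>\<sigma> = - 1\<close>;
  tangency is insensitive to that sign.\<close>

lemma integral_curve_invariance:
  fixes F :: "'a::euclidean_space set"
  assumes "open \<Omega>" and F: "closedin (top_of_set \<Omega>) F" and Z: "C_inf_on \<Omega> Z" "tangent_to F Z"
    and \<gamma>: "integral_curve \<Omega> Z \<gamma> I" and t0: "t0 \<in> I" "\<gamma> t0 \<in> F"
  shows "\<gamma> ` I \<subseteq> F"
proof -
  have I: "is_interval I" and sub: "\<gamma> ` I \<subseteq> \<Omega>"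
    and der: "\<And>t. t \<in> I \<Longrightarrow> (\<gamma> has_vector_derivative Z (\<gamma> t)) (at t within I)"
    using \<gamma> by (auto simp: integral_curve_def)
  have cont: "continuous_on I \<gamma>"
    using der by (auto simp: continuous_on_eq_continuous_within intro: has_vector_derivative_continuous)
  have local: "\<exists>d>0. \<forall>s\<in>I. \<bar>s - t\<bar> < d \<longrightarrow> \<gamma> s \<in> F" if t: "t \<in> I" "\<gamma> t \<in> F" for t
  proof -
    let ?y = "\<gamma> t"
    have "?y \<in> \<Omega>" using sub t by auto
    then obtain \<rho> where \<rho>: "0 < \<rho>" "cball ?y \<rho> \<subseteq> \<Omega>"
      using \<open>open \<Omega>\<close> open_contains_cball by blast
    obtain L where L: "0 \<le> L" "\<And>x z. x \<in> cball ?y \<rho> \<Longrightarrow> z \<in> cball ?y \<rho> \<Longrightarrow> norm (Z x - Z z) \<le> L * norm (x - z)"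
      using C_inf_on_locally_lipschitz[OF Z(1) compact_cball convex_cball \<rho>(2)] by blast
    obtain d where d: "0 < d" "\<And>s. s \<in> I \<Longrightarrow> dist s t < d \<Longrightarrow> dist (\<gamma> s) ?y < \<rho> / 3"
      using cont t \<rho>(1) unfolding continuous_on_iff by (metis divide_pos_pos zero_less_numeral)
    have "\<gamma> s \<in> F" if s: "s \<in> I" "\<bar>s - t\<bar> < d" for s
    proof -
      define \<sigma> where "\<sigma> = (if t \<le> s then 1 else - 1 :: real)"
      define T where "T = \<bar>s - t\<bar>"
      have \<sigma>T: "t + \<sigma> * T = s" "\<bar>\<sigma>\<bar> = 1" by (auto simp: \<sigma>_def T_def)
      have inI: "t + \<sigma> * \<tau> \<in> I" if "\<tau> \<in> {0..T}" for \<tau>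
        using mem_is_interval_1_I[OF I t(1) s(1), of "t + \<sigma> * \<tau>"] mem_is_interval_1_I[OF I s(1) t(1), of "t + \<sigma> * \<tau>"] that
        by (auto simp: \<sigma>_def T_def split: if_splits)
      have "\<exists>z\<in>F. norm (\<gamma> (t + \<sigma> * T) - z) \<le> 0 * exp ((L + 1) * T)"
      proof (rule approx_invariance[where \<rho> = \<rho> and y = ?y and U = "\<lambda>_ x. \<sigma> *\<^sub>R Z x"
            and c' = "\<lambda>\<tau>. \<sigma> *\<^sub>R Z (\<gamma> (t + \<sigma> * \<tau>))"])
        show "compact (F \<inter> cball ?y \<rho>)" using compact_Int_closedin[OF F compact_cball \<rho>(2)] .
        show "norm (\<gamma> (t + \<sigma> * \<tau>) - ?y) \<le> \<rho> / 3" if "\<tau> \<in> {0..T}" for \<tau>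
        proof -
          have "dist (t + \<sigma> * \<tau>) t < d" using that s(2) \<sigma>T by (auto simp: dist_norm abs_mult T_def)
          then show ?thesis using d(2)[OF inI[OF that]] by (simp add: dist_norm)
        qed
        show "((\<lambda>\<tau>. \<gamma> (t + \<sigma> * \<tau>)) has_vector_derivative \<sigma> *\<^sub>R Z (\<gamma> (t + \<sigma> * \<tau>))) (at \<tau> within {0..T})"
          if "\<tau> \<in> {0..T}" for \<tau>
        proof -
          have "((\<lambda>\<tau>. t + \<sigma> * \<tau>) has_vector_derivative \<sigma>) (at \<tau> within {0..T})"
            by (auto intro!: derivative_eq_intros simp: has_vector_derivative_def)
          moreover have "(\<gamma> has_vector_derivative Z (\<gamma> (t + \<sigma> * \<tau>))) (at (t + \<sigma> * \<tau>) within (\<lambda>\<tau>. t + \<sigma> * \<tau>) ` {0..T})"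
            using der[OF inI[OF that]] inI by (auto intro: has_vector_derivative_within_subset)
          ultimately show ?thesis using vector_diff_chain_within by (fastforce simp: o_def)
        qed
        show "norm (\<sigma> *\<^sub>R Z x - \<sigma> *\<^sub>R Z z) \<le> L * norm (x - z)"
          if "x \<in> cball ?y \<rho>" "z \<in> cball ?y \<rho>" for x z
          using L(2)[OF that] \<sigma>T by (simp flip: scaleR_diff_right)
        show "tangent_to F (\<lambda>x. \<sigma> *\<^sub>R Z x)" using Z(2) by (rule tangent_to_scale)
      qed (use t L in \<open>auto simp: T_def\<close>)
      then show ?thesis using \<sigma>T by simp
    qed
    then show ?thesis using d(1) by blast
  qed
  let ?J = "{t \<in> I. \<gamma> t \<in> F}"
  have "openin (top_of_set I) ?J"
    unfolding openin_euclidean_subtopology_iff using local by (auto simp: dist_norm)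
  moreover have "closedin (top_of_set I) ?J"
  proof -
    have "closedin (top_of_set I) (I \<inter> \<gamma> -` F)"
      using continuous_closedin_preimage_gen[OF cont _ F] sub by blast
    moreover have "?J = I \<inter> \<gamma> -` F" by auto
    ultimately show ?thesis by simp
  qed
  moreover have "connected I" using I by (simp add: is_interval_connected_1)
  ultimately have "?J = {} \<or> ?J = I" unfolding connected_clopen by blast
  then show ?thesis using t0 by auto
qed


section \<open>Tangency passes to Lie brackets\<close>

lemma has_derivative_remainder_bound:
  fixes f :: "'a::real_normed_vector \<Rightarrow> 'b::real_normed_vector"
  assumes "(f has_derivative D) (at y)" "0 < \<eta>"
  shows "\<exists>d>0. \<forall>x. norm (x - y) < d \<longrightarrow> norm (f x - f y - D (x - y)) \<le> \<eta> * norm (x - y)"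
  using assms unfolding has_derivative_at_alt by blast

text \<open>The curve \<open>c\<close> below is the second order Taylor polynomial in \<open>s\<close> of a solution of
  \<open>c' = s (cos \<theta> V(c) + sin \<theta> W(c))\<close>; after a full turn its first order part vanishes and its
  second order part is \<open>\<pi> [V, W]\<close>. So \<open>F\<close> contains points \<open>y + \<pi> s\<^sup>2 [V, W](y) + o(s\<^sup>2)\<close>.\<close>

lemma lie_bracket_approx:
  fixes F :: "'a::euclidean_space set"
  assumes "open \<Omega>" and F: "closedin (top_of_set \<Omega>) F"
    and V: "C_inf_on \<Omega> V" "tangent_to F V" and W: "C_inf_on \<Omega> W" "tangent_to F W" and y: "y \<in> F"
  obtains C where "0 \<le> C" "\<And>\<eta>. 0 < \<eta> \<Longrightarrow> \<exists>s0>0. \<forall>s. 0 < s \<longrightarrow> s < s0 \<longrightarrow>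
      (\<exists>z\<in>F. norm (z - (y + (pi * s\<^sup>2) *\<^sub>R lie_bracket V W y)) \<le> C * \<eta> * s\<^sup>2)"
proof -
  have "y \<in> \<Omega>" using F y closedin_imp_subset by blast
  then obtain \<rho> where \<rho>: "0 < \<rho>" "cball y \<rho> \<subseteq> \<Omega>"
    using \<open>open \<Omega>\<close> open_contains_cball by blast
  obtain LV where LV: "0 \<le> LV" "\<And>x z. x \<in> cball y \<rho> \<Longrightarrow> z \<in> cball y \<rho> \<Longrightarrow> norm (V x - V z) \<le> LV * norm (x - z)"
    using C_inf_on_locally_lipschitz[OF V(1) compact_cball convex_cball \<rho>(2)] by blast
  obtain LW where LW: "0 \<le> LW" "\<And>x z. x \<in> cball y \<rho> \<Longrightarrow> z \<in> cball y \<rho> \<Longrightarrow> norm (W x - W z) \<le> LW * norm (x - z)"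
    using C_inf_on_locally_lipschitz[OF W(1) compact_cball convex_cball \<rho>(2)] by blast
  define L where "L = LV + LW"
  define DV where "DV = frechet_derivative V (at y)"
  define DW where "DW = frechet_derivative W (at y)"
  have dV: "(V has_derivative DV) (at y)" and dW: "(W has_derivative DW) (at y)"
    using C_inf_on_has_derivative[OF V(1) \<open>y \<in> \<Omega>\<close>] C_inf_on_has_derivative[OF W(1) \<open>y \<in> \<Omega>\<close>]
    by (auto simp: DV_def DW_def)
  then have blV: "bounded_linear DV" and blW: "bounded_linear DW"
    using has_derivative_bounded_linear by blast+
  note linV = bounded_linear.linear[OF blV] and linW = bounded_linear.linear[OF blW]
  obtain NV where NV: "0 < NV" "\<And>x. norm (DV x) \<le> norm x * NV" using bounded_linear.pos_bounded[OF blV] by blast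
  obtain NW where NW: "0 < NW" "\<And>x. norm (DW x) \<le> norm x * NW" using bounded_linear.pos_bounded[OF blW] by blast
  define N where "N = NV + NW"
  have N: "norm (DV x) \<le> N * norm x" "norm (DW x) \<le> N * norm x" for x
    using NV(2)[of x] NW(2)[of x] NV(1) NW(1)
    by (auto simp: N_def algebra_simps intro: order_trans[OF NV(2)] order_trans[OF NW(2)])
  have Npos: "0 < N" using NV NW by (simp add: N_def)
  \<comment> \<open>\<open>k\<close> and \<open>m\<close> are the coefficients of \<open>s\<close>
    and \<open>s^2\<close>: \<open>k\<close> integrates \<open>cos V + sin W\<close> frozen at
    \<open>y\<close>, and \<open>m\<close> integrates \<open>cos DV k + sin DW k\<close>. At
    \<open>2 * pi\<close> only the terms linear in \<theta> survive, namely \<open>- pi\<close>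
    times \<open>DV (W y)\<close> and \<open>pi\<close> times \<open>DW (V y)\<close>.\<close>
  define k where "k \<theta> = sin \<theta> *\<^sub>R V y + (1 - cos \<theta>) *\<^sub>R W y" for \<theta> :: real
  define m where "m \<theta> = ((sin \<theta>)\<^sup>2 / 2) *\<^sub>R DV (V y) + ((1 - cos \<theta>)\<^sup>2 / 2) *\<^sub>R DW (W y)
      + (sin \<theta> - \<theta> / 2 - sin (2 * \<theta>) / 4) *\<^sub>R DV (W y) + (\<theta> / 2 - sin (2 * \<theta>) / 4) *\<^sub>R DW (V y)" for \<theta> :: real
  have k': "(k has_vector_derivative cos \<theta> *\<^sub>R V y + sin \<theta> *\<^sub>R W y) (at \<theta> within S)" for \<theta> S
    unfolding k_def has_vector_derivative_def
    by (rule has_derivative_eq_rhs, (rule derivative_eq_intros | simp)+) (auto simp: fun_eq_iff algebra_simps)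
  have m': "(m has_vector_derivative cos \<theta> *\<^sub>R DV (k \<theta>) + sin \<theta> *\<^sub>R DW (k \<theta>)) (at \<theta> within S)" for \<theta> S
  proof -
    have d1: "((\<lambda>\<theta>. (sin \<theta>)\<^sup>2 / 2) has_real_derivative cos \<theta> * sin \<theta>) (at \<theta> within S)"
      by (auto intro!: derivative_eq_intros)
    have d2: "((\<lambda>\<theta>. (1 - cos \<theta>)\<^sup>2 / 2) has_real_derivative sin \<theta> * (1 - cos \<theta>)) (at \<theta> within S)"
      by (auto intro!: derivative_eq_intros)
    have d3: "((\<lambda>\<theta>. sin \<theta> - \<theta> / 2 - sin (2 * \<theta>) / 4) has_real_derivative cos \<theta> * (1 - cos \<theta>)) (at \<theta> within S)"
      by (auto intro!: derivative_eq_intros simp: cos_double_cos power2_eq_square right_diff_distrib diff_divide_distrib)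
    have d4: "((\<lambda>\<theta>. \<theta> / 2 - sin (2 * \<theta>) / 4) has_real_derivative sin \<theta> * sin \<theta>) (at \<theta> within S)"
      by (auto intro!: derivative_eq_intros simp: cos_double_sin power2_eq_square diff_divide_distrib)
    have Dk: "DV (k \<theta>) = sin \<theta> *\<^sub>R DV (V y) + (1 - cos \<theta>) *\<^sub>R DV (W y)"
      "DW (k \<theta>) = sin \<theta> *\<^sub>R DW (V y) + (1 - cos \<theta>) *\<^sub>R DW (W y)"
      by (simp_all add: k_def linear_add[OF linV] linear_add[OF linW] linear_cmul[OF linV] linear_cmul[OF linW])
    note vd = has_vector_derivative_scaleR[OF _ has_vector_derivative_const]
    show ?thesis unfolding m_def
      by (rule has_vector_derivative_eq_rhs, rule has_vector_derivative_add[OF has_vector_derivative_add[OF has_vector_derivative_add[OF vd[OF d1] vd[OF d2]] vd[OF d3]] vd[OF d4]])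
        (simp add: Dk algebra_simps)
  qed
  have "continuous_on {0..2 * pi} k" "continuous_on {0..2 * pi} m"
    using k' m' unfolding continuous_on_eq_continuous_within by (blast intro: has_vector_derivative_continuous)+
  then have "bounded (k ` {0..2 * pi})" "bounded (m ` {0..2 * pi})"
    using compact_continuous_image compact_imp_bounded compact_Icc by blast+
  then obtain M1 M2 where M: "0 < M1" "\<And>\<theta>. \<theta> \<in> {0..2 * pi} \<Longrightarrow> norm (k \<theta>) \<le> M1"
     "0 < M2" "\<And>\<theta>. \<theta> \<in> {0..2 * pi} \<Longrightarrow> norm (m \<theta>) \<le> M2"
    unfolding bounded_pos by auto
  define M where "M = M1 + M2"
  have kM: "norm (k \<theta>) \<le> M" and mM: "norm (m \<theta>) \<le> M" if "\<theta> \<in> {0..2 * pi}" for \<theta>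
    using M(1,3) M(2)[OF that] M(4)[OF that] by (auto simp: M_def)
  have M0: "0 < M" using M by (simp add: M_def)
  define E where "E = exp ((L + 1) * (2 * pi))"
  show ?thesis
  proof (rule that[of "6 * M * E"])
    show "0 \<le> 6 * M * E" using M0 by (simp add: E_def)
    fix \<eta> :: real assume \<eta>: "0 < \<eta>"
    obtain dV where dV: "0 < dV" "\<And>x. norm (x - y) < dV \<Longrightarrow> norm (V x - V y - DV (x - y)) \<le> \<eta> * norm (x - y)"
      using has_derivative_remainder_bound[OF dV \<eta>] by blast
    obtain dW where dW: "0 < dW" "\<And>x. norm (x - y) < dW \<Longrightarrow> norm (W x - W y - DW (x - y)) \<le> \<eta> * norm (x - y)"
      using has_derivative_remainder_bound[OF dW \<eta>] by blast
    define r where "r = min (min dV dW) (\<rho> / 3)"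
    have r: "0 < r" "r \<le> dV" "r \<le> dW" "r \<le> \<rho> / 3" using dV dW \<rho> by (auto simp: r_def)
    \<comment> \<open>\<open>s < 1\<close> keeps \<open>L\<close> a Lipschitz constant independent
      of \<open>s\<close>; \<open>s * N \<le> \<eta>\<close> absorbs the second order term of the
      curve into the error; \<open>s * (2 * M) < r\<close> keeps the curve where both remainder
      estimates hold and within \<open>\<rho> / 3\<close> of \<open>y\<close>.\<close>
    define s0 where "s0 = min 1 (min (\<eta> / N) (r / (2 * M)))"
    have s0: "0 < s0" using \<eta> Npos r M0 by (simp add: s0_def)
    have "\<exists>z\<in>F. norm (z - (y + (pi * s\<^sup>2) *\<^sub>R lie_bracket V W y)) \<le> 6 * M * E * \<eta> * s\<^sup>2" if s: "0 < s" "s < s0" for s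
    proof -
      have s1: "s < 1" and sN: "s * N \<le> \<eta>" and sM: "s * (2 * M) < r"
        using s Npos M0 by (auto simp: s0_def pos_less_divide_eq)
      define c where "c \<theta> = y + s *\<^sub>R k \<theta> + s\<^sup>2 *\<^sub>R m \<theta>" for \<theta>
      have cy: "norm (c \<theta> - y) \<le> s * (2 * M)" if "\<theta> \<in> {0..2 * pi}" for \<theta>
      proof -
        have "norm (c \<theta> - y) \<le> s * norm (k \<theta>) + s\<^sup>2 * norm (m \<theta>)"
          unfolding c_def using norm_triangle_ineq[of "s *\<^sub>R k \<theta>" "s\<^sup>2 *\<^sub>R m \<theta>"] s by (simp add: algebra_simps)
        also have "\<dots> \<le> s * M + s * M"
          using kM[OF that] mM[OF that] s s1 M0
          by (intro add_mono mult_left_mono mult_mono) (auto simp: power2_eq_square mult_left_le)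
        finally show ?thesis by (simp add: algebra_simps)
      qed
      \<comment> \<open>Two of the three units come from the remainder, since \<open>c\<close> stays
        within \<open>2 M s\<close> of \<open>y\<close>, and one from \<open>m\<close>. Two fields,
        each multiplied by \<open>s\<close>, then give the defect
        \<open>6 M \<eta> s^2\<close>.\<close>
      have taylor: "norm (f (c \<theta>) - (f y + s *\<^sub>R D (k \<theta>))) \<le> 3 * M * \<eta> * s"
        if \<theta>: "\<theta> \<in> {0..2 * pi}" and D: "linear D" "\<And>x. norm (D x) \<le> N * norm x"
          and f: "\<And>x. norm (x - y) < r \<Longrightarrow> norm (f x - f y - D (x - y)) \<le> \<eta> * norm (x - y)"
        for f D \<theta>
      proof -
        have e: "D (c \<theta> - y) = s *\<^sub>R D (k \<theta>) + s\<^sup>2 *\<^sub>R D (m \<theta>)"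
          by (simp add: c_def linear_add[OF D(1)] linear_cmul[OF D(1)])
        have eq: "f (c \<theta>) - (f y + s *\<^sub>R D (k \<theta>)) = (f (c \<theta>) - f y - D (c \<theta> - y)) + s\<^sup>2 *\<^sub>R D (m \<theta>)"
          unfolding e by simp
        have "norm (f (c \<theta>) - (f y + s *\<^sub>R D (k \<theta>))) \<le> norm (f (c \<theta>) - f y - D (c \<theta> - y)) + s\<^sup>2 * norm (D (m \<theta>))"
          unfolding eq using norm_triangle_ineq[of "f (c \<theta>) - f y - D (c \<theta> - y)" "s\<^sup>2 *\<^sub>R D (m \<theta>)"] by simp
        also have "\<dots> \<le> \<eta> * (s * (2 * M)) + s\<^sup>2 * (N * M)"
        proof (intro add_mono mult_left_mono)
          show "norm (f (c \<theta>) - f y - D (c \<theta> - y)) \<le> \<eta> * (s * (2 * M))"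
            using f[of "c \<theta>"] cy[OF \<theta>] sM \<eta> by (smt (verit) mult_left_mono)
          show "norm (D (m \<theta>)) \<le> N * M" using D(2)[of "m \<theta>"] mM[OF \<theta>] Npos by (smt (verit) mult_left_mono)
        qed simp
        also have "s\<^sup>2 * (N * M) = (s * N) * (s * M)" by (simp add: power2_eq_square)
        also have "\<dots> \<le> \<eta> * (s * M)" using sN s M0 by (intro mult_right_mono) auto
        finally show ?thesis by (simp add: algebra_simps)
      qed
      have "\<exists>z\<in>F. norm (c (2 * pi) - z) \<le> (6 * M * \<eta> * s\<^sup>2) * exp ((L + 1) * (2 * pi))"
      proof (rule approx_invariance[where \<rho> = \<rho> and y = y and U = "\<lambda>\<theta> x. (s * cos \<theta>) *\<^sub>R V x + (s * sin \<theta>) *\<^sub>R W x"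
            and c' = "\<lambda>\<theta>. s *\<^sub>R (cos \<theta> *\<^sub>R V y + sin \<theta> *\<^sub>R W y) + s\<^sup>2 *\<^sub>R (cos \<theta> *\<^sub>R DV (k \<theta>) + sin \<theta> *\<^sub>R DW (k \<theta>))"])
        show "compact (F \<inter> cball y \<rho>)" using compact_Int_closedin[OF F compact_cball \<rho>(2)] .
        show "0 \<le> L" using LV LW by (simp add: L_def)
        show "c 0 = y" by (simp add: c_def k_def m_def)
        show "norm (c \<theta> - y) \<le> \<rho> / 3" if "\<theta> \<in> {0..2 * pi}" for \<theta> using cy[OF that] sM r by simp
        show "(c has_vector_derivative s *\<^sub>R (cos \<theta> *\<^sub>R V y + sin \<theta> *\<^sub>R W y) + s\<^sup>2 *\<^sub>R (cos \<theta> *\<^sub>R DV (k \<theta>) + sin \<theta> *\<^sub>R DW (k \<theta>)))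
             (at \<theta> within {0..2 * pi})" for \<theta>
          unfolding c_def
          by (rule has_vector_derivative_eq_rhs, rule has_vector_derivative_add[OF has_vector_derivative_add[OF has_vector_derivative_const
             bounded_linear.has_vector_derivative[OF bounded_linear_scaleR_right k']] bounded_linear.has_vector_derivative[OF bounded_linear_scaleR_right m']]) simp
        show "norm (((s * cos \<theta>) *\<^sub>R V x + (s * sin \<theta>) *\<^sub>R W x) - ((s * cos \<theta>) *\<^sub>R V z + (s * sin \<theta>) *\<^sub>R W z)) \<le> L * norm (x - z)"
          if "x \<in> cball y \<rho>" "z \<in> cball y \<rho>" for \<theta> x z
        proof -
          have "\<bar>s * cos \<theta>\<bar> \<le> 1" "\<bar>s * sin \<theta>\<bar> \<le> 1"
            using s s1 by (auto simp: abs_mult intro!: mult_le_one)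
          then have "norm ((s * cos \<theta>) *\<^sub>R (V x - V z)) \<le> LV * norm (x - z)"
            "norm ((s * sin \<theta>) *\<^sub>R (W x - W z)) \<le> LW * norm (x - z)"
            using LV(2)[OF that] LW(2)[OF that] by (auto intro: order_trans[OF mult_left_le_one_le])
          moreover have "((s * cos \<theta>) *\<^sub>R V x + (s * sin \<theta>) *\<^sub>R W x) - ((s * cos \<theta>) *\<^sub>R V z + (s * sin \<theta>) *\<^sub>R W z)
             = (s * cos \<theta>) *\<^sub>R (V x - V z) + (s * sin \<theta>) *\<^sub>R (W x - W z)" by (simp add: algebra_simps)
          ultimately show ?thesis
            using norm_triangle_ineq[of "(s * cos \<theta>) *\<^sub>R (V x - V z)" "(s * sin \<theta>) *\<^sub>R (W x - W z)"]
            by (simp add: L_def distrib_right)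
        qed
        show "tangent_to F (\<lambda>x. (s * cos \<theta>) *\<^sub>R V x + (s * sin \<theta>) *\<^sub>R W x)" for \<theta>
          using V(2) W(2) by (intro tangent_to_add tangent_to_scale)
        show "norm (s *\<^sub>R (cos \<theta> *\<^sub>R V y + sin \<theta> *\<^sub>R W y) + s\<^sup>2 *\<^sub>R (cos \<theta> *\<^sub>R DV (k \<theta>) + sin \<theta> *\<^sub>R DW (k \<theta>))
            - ((s * cos \<theta>) *\<^sub>R V (c \<theta>) + (s * sin \<theta>) *\<^sub>R W (c \<theta>))) \<le> 6 * M * \<eta> * s\<^sup>2"
          if \<theta>: "\<theta> \<in> {0..2 * pi}" for \<theta>
        proof -
          let ?a = "V (c \<theta>) - (V y + s *\<^sub>R DV (k \<theta>))" and ?b = "W (c \<theta>) - (W y + s *\<^sub>R DW (k \<theta>))"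
          have a: "norm ?a \<le> 3 * M * \<eta> * s" using r dV(2) by (intro taylor[OF \<theta> linV N(1)]) auto
          have b: "norm ?b \<le> 3 * M * \<eta> * s" using r dW(2) by (intro taylor[OF \<theta> linW N(2)]) auto
          have "s *\<^sub>R (cos \<theta> *\<^sub>R V y + sin \<theta> *\<^sub>R W y) + s\<^sup>2 *\<^sub>R (cos \<theta> *\<^sub>R DV (k \<theta>) + sin \<theta> *\<^sub>R DW (k \<theta>))
            - ((s * cos \<theta>) *\<^sub>R V (c \<theta>) + (s * sin \<theta>) *\<^sub>R W (c \<theta>)) = - (s *\<^sub>R (cos \<theta> *\<^sub>R ?a + sin \<theta> *\<^sub>R ?b))"
            by (simp add: algebra_simps power2_eq_square)
          also have "norm \<dots> = s * norm (cos \<theta> *\<^sub>R ?a + sin \<theta> *\<^sub>R ?b)" using s by simp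
          also have "\<dots> \<le> s * (3 * M * \<eta> * s + 3 * M * \<eta> * s)"
          proof (intro mult_left_mono order_trans[OF norm_triangle_ineq] add_mono)
            show "norm (cos \<theta> *\<^sub>R ?a) \<le> 3 * M * \<eta> * s"
              using a mult_left_le_one_le[of "norm ?a" "\<bar>cos \<theta>\<bar>"] by simp
            show "norm (sin \<theta> *\<^sub>R ?b) \<le> 3 * M * \<eta> * s"
              using b mult_left_le_one_le[of "norm ?b" "\<bar>sin \<theta>\<bar>"] by simp
          qed (use s in simp)
          finally show ?thesis by (simp add: power2_eq_square algebra_simps)
        qed
      qed (use y \<eta> M0 in auto)
      then obtain z where z: "z \<in> F" "norm (c (2 * pi) - z) \<le> (6 * M * \<eta> * s\<^sup>2) * E" by (auto simp: E_def)
      have "sin (2 * (2 * pi)) = 0" using sin_npi[of 4] by (simp add: mult.assoc)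
      then have "c (2 * pi) = y + (pi * s\<^sup>2) *\<^sub>R lie_bracket V W y"
        by (simp add: c_def k_def m_def lie_bracket_def DV_def DW_def algebra_simps)
      then have "norm (z - (y + (pi * s\<^sup>2) *\<^sub>R lie_bracket V W y)) \<le> 6 * M * E * \<eta> * s\<^sup>2"
        using z(2) by (simp add: norm_minus_commute algebra_simps)
      then show ?thesis using z(1) by blast
    qed
    then show "\<exists>s0>0. \<forall>s. 0 < s \<longrightarrow> s < s0 \<longrightarrow>
      (\<exists>z\<in>F. norm (z - (y + (pi * s\<^sup>2) *\<^sub>R lie_bracket V W y)) \<le> 6 * M * E * \<eta> * s\<^sup>2)"
      using s0 by blast
  qed
qed

text \<open>If the inner product were positive, the points of \<open>F\<close> near
  \<open>y + pi s^2 [V, W] y\<close> would enter the exterior ball: a point \<open>y + d\<close>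
  outside it satisfies \<open>2 (d \<bullet> \<nu>) \<le> |d|^2\<close>, where the right side is of
  order \<open>s^4\<close> and the left side of order \<open>s^2\<close>.\<close>

lemma lie_bracket_inner_exterior_normal_le:
  fixes F :: "'a::euclidean_space set"
  assumes "open \<Omega>" "closedin (top_of_set \<Omega>) F"
    and "C_inf_on \<Omega> V" "tangent_to F V" "C_inf_on \<Omega> W" "tangent_to F W"
    and y: "y \<in> F" and \<nu>: "exterior_normal F y \<nu>"
  shows "lie_bracket V W y \<bullet> \<nu> \<le> 0"
proof (rule ccontr)
  define B where "B = lie_bracket V W y"
  assume "\<not> lie_bracket V W y \<bullet> \<nu> \<le> 0"
  then have B: "0 < B \<bullet> \<nu>" by (simp add: B_def)
  obtain C where C: "0 \<le> C" "\<And>\<eta>. 0 < \<eta> \<Longrightarrow> \<exists>s0>0. \<forall>s. 0 < s \<longrightarrow> s < s0 \<longrightarrow>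
      (\<exists>z\<in>F. norm (z - (y + (pi * s\<^sup>2) *\<^sub>R B)) \<le> C * \<eta> * s\<^sup>2)"
    using lie_bracket_approx[OF assms(1-7)] unfolding B_def by blast
  \<comment> \<open>\<open>H s^4\<close> bounds \<open>|d|^2\<close>, and
    \<open>s * H \<le> \<eta>\<close> with \<open>s \<le> 1\<close> turns this into
    \<open>\<eta> s^2\<close>. The choice of \<open>\<eta>\<close> keeps all errors together below
    \<open>B \<bullet> \<nu>\<close>, which leaves the absurd \<open>2 * pi \<le> 1\<close>.\<close>
  define H where "H = (pi * norm B + C)\<^sup>2 + 1"
  have H: "1 \<le> H" by (simp add: H_def)
  define \<eta> where "\<eta> = min 1 (B \<bullet> \<nu> / (1 + 2 * C * norm \<nu>))"
  have den: "1 \<le> 1 + 2 * C * norm \<nu>" using C by simp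
  have \<eta>: "0 < \<eta>" "\<eta> \<le> 1" "\<eta> * (1 + 2 * C * norm \<nu>) \<le> B \<bullet> \<nu>"
    using B den by (auto simp: \<eta>_def pos_le_divide_eq[symmetric])
  obtain s0 where s0: "0 < s0" "\<And>s. 0 < s \<Longrightarrow> s < s0 \<Longrightarrow> \<exists>z\<in>F. norm (z - (y + (pi * s\<^sup>2) *\<^sub>R B)) \<le> C * \<eta> * s\<^sup>2"
    using C(2)[OF \<eta>(1)] by blast
  define s where "s = min (s0 / 2) (\<eta> / H)"
  have s: "0 < s" "s < s0" "s * H \<le> \<eta>" using s0(1) \<eta>(1) H by (auto simp: s_def pos_le_divide_eq[symmetric])
  have "s * 1 \<le> s * H" using s H by (intro mult_left_mono) auto
  then have s1: "s \<le> 1" using s(3) \<eta>(2) by linarith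
  obtain z where z: "z \<in> F" "norm (z - (y + (pi * s\<^sup>2) *\<^sub>R B)) \<le> C * \<eta> * s\<^sup>2" using s0(2)[OF s(1,2)] by blast
  define d where "d = z - y"
  define e where "e = d - (pi * s\<^sup>2) *\<^sub>R B"
  have e: "norm e \<le> C * \<eta> * s\<^sup>2" using z by (simp add: e_def d_def algebra_simps)
  also have "\<dots> \<le> C * s\<^sup>2" using C \<eta> by (simp add: mult_left_le mult_right_mono)
  finally have "norm d \<le> (pi * norm B + C) * s\<^sup>2"
    using norm_triangle_ineq[of e "(pi * s\<^sup>2) *\<^sub>R B"] by (simp add: e_def algebra_simps)
  then have "(norm d)\<^sup>2 \<le> ((pi * norm B + C) * s\<^sup>2)\<^sup>2" by (intro power_mono) auto
  also have "\<dots> \<le> H * (s\<^sup>2)\<^sup>2" by (simp add: H_def power_mult_distrib mult_right_mono)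
  also have "\<dots> = s\<^sup>2 * (s * (s * H))" by (simp add: power2_eq_square)
  also have "\<dots> \<le> s\<^sup>2 * (1 * \<eta>)" using s s1 H by (intro mult_left_mono mult_mono) auto
  finally have dd: "(norm d)\<^sup>2 \<le> s\<^sup>2 * \<eta>" by simp
  have "z \<notin> ball (y + \<nu>) (norm \<nu>)" using \<nu> z by (auto simp: exterior_normal_def)
  then have "norm \<nu> \<le> norm (d - \<nu>)" by (simp add: dist_norm d_def norm_minus_commute algebra_simps)
  then have "(norm \<nu>)\<^sup>2 \<le> (norm (d - \<nu>))\<^sup>2" by (intro power_mono) auto
  then have "2 * (d \<bullet> \<nu>) \<le> (norm d)\<^sup>2"
    by (simp add: power2_norm_eq_inner inner_diff_left inner_diff_right inner_commute)
  moreover have "d \<bullet> \<nu> = (pi * s\<^sup>2) * (B \<bullet> \<nu>) + e \<bullet> \<nu>" by (simp add: e_def inner_diff_left)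
  moreover have "- (e \<bullet> \<nu>) \<le> (C * \<eta> * s\<^sup>2) * norm \<nu>"
    using norm_cauchy_schwarz[of "- e" \<nu>] mult_right_mono[OF e, of "norm \<nu>"] by simp
  ultimately have "2 * ((pi * s\<^sup>2) * (B \<bullet> \<nu>)) \<le> s\<^sup>2 * \<eta> + 2 * ((C * \<eta> * s\<^sup>2) * norm \<nu>)" using dd by linarith
  then have "s\<^sup>2 * (2 * pi * (B \<bullet> \<nu>)) \<le> s\<^sup>2 * (\<eta> * (1 + 2 * C * norm \<nu>))" by (simp add: algebra_simps)
  then have "2 * pi * (B \<bullet> \<nu>) \<le> \<eta> * (1 + 2 * C * norm \<nu>)" using s(1) by simp
  then have "2 * pi * (B \<bullet> \<nu>) \<le> 1 * (B \<bullet> \<nu>)" using \<eta>(3) by simp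
  then have "2 * pi \<le> 1" using B by (simp only: mult_le_cancel_right_pos)
  then show False using pi_gt3 by simp
qed

text \<open>The one-sided estimate applies to both orders of the arguments, and exchanging them
  changes the sign.\<close>

lemma tangent_to_lie_bracket:
  fixes F :: "'a::euclidean_space set"
  assumes "open \<Omega>" "closedin (top_of_set \<Omega>) F"
    and "C_inf_on \<Omega> V" "tangent_to F V" "C_inf_on \<Omega> W" "tangent_to F W"
  shows "tangent_to F (lie_bracket V W)"
proof -
  have "lie_bracket W V y = - lie_bracket V W y" for y by (simp add: lie_bracket_def)
  then show ?thesis
    using lie_bracket_inner_exterior_normal_le[OF assms(1-6)] lie_bracket_inner_exterior_normal_le[OF assms(1,2,5,6,3,4)]
    unfolding tangent_to_def by (metis inner_minus_left neg_le_0_iff_le order_antisym)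
qed

text \<open>Smoothness is carried through the induction together with tangency, because the bracket
  case needs both for its arguments.\<close>

lemma lie_module_tangent:
  fixes F :: "'a::euclidean_space set"
  assumes "open \<Omega>" "closedin (top_of_set \<Omega>) F"
    and "\<And>k. k \<in> {1..r} \<Longrightarrow> C_inf_on \<Omega> (X k) \<and> tangent_to F (X k)"
    and "Z \<in> lie_module \<Omega> r X"
  shows "C_inf_on \<Omega> Z \<and> tangent_to F Z"
  using assms(4)
proof (induction rule: lie_module.induct)
  case (gen k)
  then show ?case using assms(3) by blast
next
  case zero
  show ?case by (simp add: C_inf_on_const tangent_to_def)
next
  case (add V W)
  then show ?case by (simp add: C_inf_on_add[OF assms(1)] tangent_to_add)
next
  case (scale c V)
  then show ?case by (simp add: C_inf_on_scaleR[OF assms(1)] tangent_to_scale)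
next
  case (bracket V W)
  then show ?case by (simp add: C_inf_on_lie_bracket[OF assms(1)] tangent_to_lie_bracket[OF assms(1,2)])
next
  case (restrict V W)
  moreover have "F \<subseteq> \<Omega>" using assms(2) closedin_imp_subset by blast
  ultimately show ?case using C_inf_on_cong[OF assms(1), of W V]
    by (auto simp: tangent_to_def subset_iff)
qed

section \<open>Propagation of maxima\<close>

lemma vf_apply_eqI: "(f has_derivative D) (at x) \<Longrightarrow> vf_apply X f x = D (X x)"
  by (simp add: vf_apply_def frechet_derivative_eqI)

lemma vf_apply_cong_open:
  "open S \<Longrightarrow> x \<in> S \<Longrightarrow> (\<And>y. y \<in> S \<Longrightarrow> f y = g y) \<Longrightarrow> vf_apply X f x = vf_apply X g x"
  unfolding vf_apply_def using frechet_derivative_cong_open by metis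

lemma vf_apply_add_mult:
  assumes "C_inf_on S f" "C_inf_on S g" "x \<in> S"
  shows "vf_apply X (\<lambda>x. f x + \<epsilon> * g x) x = vf_apply X f x + \<epsilon> * vf_apply X g x"
  using vf_apply_eqI[OF has_derivative_add[OF C_inf_on_has_derivative[OF assms(1,3)]
        has_derivative_mult_right[OF C_inf_on_has_derivative[OF assms(2,3)], of \<epsilon>]], of X]
  by (simp add: vf_apply_def)

lemma vf_apply_vf_apply_add_mult:
  fixes f g :: "'a::euclidean_space \<Rightarrow> real"
  assumes "open S" "C_inf_on S f" "C_inf_on S g" "C_inf_on S Z" "x \<in> S"
  shows "vf_apply X (vf_apply Z (\<lambda>x. f x + \<epsilon> * g x)) x
    = vf_apply X (vf_apply Z f) x + \<epsilon> * vf_apply X (vf_apply Z g) x"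
proof -
  have "vf_apply X (vf_apply Z (\<lambda>x. f x + \<epsilon> * g x)) x = vf_apply X (\<lambda>x. vf_apply Z f x + \<epsilon> * vf_apply Z g x) x"
    by (rule vf_apply_cong_open[OF assms(1,5)]) (rule vf_apply_add_mult[OF assms(2,3)])
  also have "\<dots> = vf_apply X (vf_apply Z f) x + \<epsilon> * vf_apply X (vf_apply Z g) x"
    by (rule vf_apply_add_mult[OF C_inf_on_vf_apply[OF assms(1,2,4)] C_inf_on_vf_apply[OF assms(1,3,4)] assms(5)])
  finally show ?thesis .
qed

text \<open>At a critical point \<open>X (X g)\<close> loses its first order part and becomes the
  second derivative of \<open>g\<close> along the fixed vector \<open>X x\<close>.\<close>

lemma second_derivative_at_max_le:
  fixes g :: "'a::euclidean_space \<Rightarrow> real"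
  assumes "open S" "C_inf_on S g" "C_inf_on S X" "x \<in> S" and max: "\<And>y. y \<in> S \<Longrightarrow> g y \<le> g x"
  shows "frechet_derivative g (at x) = (\<lambda>v. 0)" "vf_apply X (vf_apply X g) x \<le> 0"
proof -
  show crit: "frechet_derivative g (at x) = (\<lambda>v. 0)"
    using differential_zero_maxmin[OF assms(4,1) C_inf_on_has_derivative[OF assms(2,4)]] max by blast
  define \<xi> where "\<xi> = X x"
  define G where "G y = frechet_derivative g (at y) \<xi>" for y
  have G: "C_inf_on S G" unfolding G_def using assms(2) by (rule C_inf_on_derivative_const)
  define l where "l = frechet_derivative G (at x) \<xi>"
  have dG: "(G has_derivative frechet_derivative G (at x)) (at x)"
    using C_inf_on_has_derivative[OF G assms(4)] .
  \<comment> \<open>\<open>X g\<close> is split into \<open>G\<close>, with the direction frozen at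
    \<open>\<xi>\<close>, and \<open>?R\<close>. Both factors of every summand of \<open>?R\<close>
    vanish at \<open>x\<close>, so \<open>?R\<close> has zero derivative there.\<close>
  let ?R = "\<lambda>y. \<Sum>b\<in>Basis. ((X y - \<xi>) \<bullet> b) * frechet_derivative g (at y) b"
  have dX: "(X has_derivative frechet_derivative X (at x)) (at x)"
    using C_inf_on_has_derivative[OF assms(3,4)] .
  have "(?R has_derivative (\<lambda>v. \<Sum>b\<in>(Basis::'a set). 0)) (at x)"
  proof (rule has_derivative_sum)
    fix b :: 'a
    have db: "((\<lambda>y. frechet_derivative g (at y) b) has_derivative
        frechet_derivative (\<lambda>y. frechet_derivative g (at y) b) (at x)) (at x)"
      using C_inf_on_has_derivative[OF C_inf_on_derivative_const[OF assms(2)] assms(4)] .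
    have "((\<lambda>y. (X y - \<xi>) \<bullet> b) has_derivative (\<lambda>v. frechet_derivative X (at x) v \<bullet> b)) (at x)"
      by (rule has_derivative_eq_rhs, (rule derivative_eq_intros dX | simp)+)
    from has_derivative_mult[OF this db]
    show "((\<lambda>y. ((X y - \<xi>) \<bullet> b) * frechet_derivative g (at y) b) has_derivative (\<lambda>v. 0)) (at x)"
      by (simp add: crit \<xi>_def)
  qed
  from has_derivative_add[OF dG this]
  have "((\<lambda>y. G y + ?R y) has_derivative frechet_derivative G (at x)) (at x)" by simp
  moreover have "G y + ?R y = vf_apply X g y" if "y \<in> S" for y
  proof -
    have lin: "linear (frechet_derivative g (at y))"
      using has_derivative_linear[OF C_inf_on_has_derivative[OF assms(2) that]] .
    show ?thesis
      using linear_euclidean_expand[OF lin, of "X y - \<xi>"] by (simp add: vf_apply_def G_def linear_diff[OF lin])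
  qed
  ultimately have "(vf_apply X g has_derivative frechet_derivative G (at x)) (at x)"
    using has_derivative_transform_within_open[OF _ assms(1,4)] by blast
  from vf_apply_eqI[OF this, of X] have vv: "vf_apply X (vf_apply X g) x = l" by (simp add: l_def \<xi>_def)
  \<comment> \<open>For \<open>l > 0\<close> the slope \<open>G\<close> along the line through
    \<open>x\<close> would be positive just after 0, and by the mean value theorem \<open>g\<close>
    would exceed its maximum.\<close>
  have "l \<le> 0"
  proof (rule ccontr)
    assume "\<not> l \<le> 0"
    then have l: "0 < l" by simp
    have line: "((\<lambda>t. x + t *\<^sub>R \<xi>) has_derivative (\<lambda>t. t *\<^sub>R \<xi>)) (at t)" for t
      by (rule has_derivative_eq_rhs, (rule derivative_eq_intros | simp)+)
    obtain d where d: "0 < d" "\<And>t. \<bar>t\<bar> < d \<Longrightarrow> x + t *\<^sub>R \<xi> \<in> S"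
    proof -
      obtain e where e: "0 < e" "ball x e \<subseteq> S" using assms(1,4) open_contains_ball by blast
      have "x + t *\<^sub>R \<xi> \<in> S" if "\<bar>t\<bar> < e / (norm \<xi> + 1)" for t
      proof -
        have "\<bar>t\<bar> * norm \<xi> \<le> \<bar>t\<bar> * (norm \<xi> + 1)" by (intro mult_left_mono) auto
        also have "\<dots> < e" using that by (simp add: pos_less_divide_eq add_nonneg_pos)
        finally show ?thesis using e(2) by (auto simp: dist_norm subset_iff)
      qed
      then show ?thesis using that[of "e / (norm \<xi> + 1)"] e(1) by (simp add: add_nonneg_pos)
    qed
    have "((\<lambda>t. G (x + t *\<^sub>R \<xi>)) has_derivative (\<lambda>t. frechet_derivative G (at x) (t *\<^sub>R \<xi>))) (at 0)"
      using diff_chain_at[OF line[of 0], of G] dG by (simp add: o_def)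
    then have "((\<lambda>t. G (x + t *\<^sub>R \<xi>)) has_real_derivative l) (at 0)"
      unfolding has_field_derivative_def l_def
      by (simp add: linear_cmul[OF has_derivative_linear[OF dG]] mult_commute_abs)
    from has_real_derivative_pos_inc_right[OF this l]
    obtain h where h: "0 < h" "\<And>t. 0 < t \<Longrightarrow> t < h \<Longrightarrow> G x < G (x + t *\<^sub>R \<xi>)" by auto
    define s where "s = min d h / 2"
    have s: "0 < s" "s < d" "s < h" using d h by (auto simp: s_def)
    have "\<exists>z. 0 < z \<and> z < s \<and> g (x + s *\<^sub>R \<xi>) - g (x + 0 *\<^sub>R \<xi>) = (s - 0) * G (x + z *\<^sub>R \<xi>)"
    proof (rule MVT2[OF s(1)])
      fix t assume t: "0 \<le> t" "t \<le> s"
      then have "x + t *\<^sub>R \<xi> \<in> S" using d(2) s by auto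
      then have D: "(g has_derivative frechet_derivative g (at (x + t *\<^sub>R \<xi>))) (at (x + t *\<^sub>R \<xi>))"
        using C_inf_on_has_derivative[OF assms(2)] by blast
      show "((\<lambda>t. g (x + t *\<^sub>R \<xi>)) has_real_derivative G (x + t *\<^sub>R \<xi>)) (at t)"
        using diff_chain_at[OF line[of t] D] unfolding has_field_derivative_def G_def
        by (simp add: o_def linear_cmul[OF has_derivative_linear[OF D]] mult_commute_abs)
    qed
    then obtain z where z: "0 < z" "z < s" "g (x + s *\<^sub>R \<xi>) - g x = s * G (x + z *\<^sub>R \<xi>)" by auto
    have "G x = 0" by (simp add: G_def crit)
    then have "0 < s * G (x + z *\<^sub>R \<xi>)" using h(2)[of z] z s by simp
    moreover have "g (x + s *\<^sub>R \<xi>) \<le> g x" using max d(2) s by simp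
    ultimately show False using z(3) by simp
  qed
  then show "vf_apply X (vf_apply X g) x \<le> 0" using vv by simp
qed

section \<open>Hopf's barrier and propagation along the Lie module\<close>

definition sos_op :: "nat \<Rightarrow> (nat \<Rightarrow> 'a \<Rightarrow> 'a) \<Rightarrow> ('a \<Rightarrow> 'a) \<Rightarrow> ('a::real_normed_vector \<Rightarrow> real) \<Rightarrow> 'a \<Rightarrow> real" where
  "sos_op r X Y f x = (\<Sum>k=1..r. vf_apply (X k) (vf_apply (X k) f) x) + vf_apply Y f x"

text \<open>Hopf's barrier argument: if some \<open>X k y\<close> had a component along the exterior normal, the
  function \<open>exp (- \<alpha> |x - x0|\<^sup>2)\<close>, with \<open>x0\<close> the centre of the exterior ball of half size, would be
  a strict subsolution near \<open>y\<close> for large \<open>\<alpha>\<close>. Halving makes \<open>y\<close> the only contact point.\<close>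

lemma hopf_tangent:
  fixes v :: "'a::euclidean_space \<Rightarrow> real"
  assumes "open \<Omega>" and X: "\<And>k. k \<in> {1..r} \<Longrightarrow> C_inf_on \<Omega> (X k)" and Y: "C_inf_on \<Omega> Y" and v: "C_inf_on \<Omega> v"
    and v0: "\<And>x. x \<in> \<Omega> \<Longrightarrow> v x \<le> 0" and y: "y \<in> \<Omega>" "v y = 0"
    and \<nu>: "exterior_normal {x \<in> \<Omega>. v x = 0} y \<nu>"
    and \<rho>0: "0 < \<rho>0" "cball y \<rho>0 \<subseteq> \<Omega>" and KC: "0 \<le> K" "0 \<le> C"
    and ineq: "\<And>x. x \<in> cball y \<rho>0 \<Longrightarrow>
        0 \<le> sos_op r X Y v x + K * onorm (frechet_derivative v (at x)) + C * \<bar>v x\<bar>"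
    and k: "k \<in> {1..r}"
  shows "X k y \<bullet> \<nu> = 0"
proof (rule ccontr)
  assume nz: "X k y \<bullet> \<nu> \<noteq> 0"
  define x0 where "x0 = y + (1 / 2) *\<^sub>R \<nu>"
  define R where "R = norm \<nu> / 2"
  define q where "q x = (x - x0) \<bullet> (x - x0)" for x
  have qn: "q x = (norm (x - x0))\<^sup>2" for x by (simp add: q_def dot_square_norm)
  have qy: "q y = R\<^sup>2" by (simp add: qn x0_def R_def)
  have dq: "(q has_derivative (\<lambda>h. 2 * ((x - x0) \<bullet> h))) (at x)" for x
    unfolding q_def by (rule has_derivative_eq_rhs, (rule derivative_eq_intros | simp)+) (simp add: inner_commute)
  have Xq: "vf_apply Z q x = 2 * ((x - x0) \<bullet> Z x)" for Z x by (rule vf_apply_eqI[OF dq])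
  have q: "C_inf_on \<Omega> q" unfolding q_def using \<open>open \<Omega>\<close>
    by (intro C_inf_on_inner C_inf_on_diff C_inf_on_ident C_inf_on_const)
  \<comment> \<open>This is the factor of \<open>\<alpha>^2\<close> when the operator is applied to
    the barrier. The gradient of \<open>q\<close> at \<open>y\<close> is \<open>- \<nu>\<close>, so
    \<open>\<beta> y\<close> is at least the square of \<open>X k y \<bullet> \<nu>\<close>.\<close>
  define \<beta> where "\<beta> x = (\<Sum>k=1..r. (vf_apply (X k) q x)\<^sup>2)" for x
  have \<beta>cont: "continuous_on \<Omega> \<beta>" unfolding \<beta>_def
    by (intro continuous_on_sum continuous_on_power C_inf_on_continuous C_inf_on_vf_apply \<open>open \<Omega>\<close> q X)
  have "vf_apply (X k) q y = - (X k y \<bullet> \<nu>)" unfolding Xq by (simp add: x0_def inner_commute)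
  then have "(X k y \<bullet> \<nu>)\<^sup>2 \<le> \<beta> y" unfolding \<beta>_def using member_le_sum[OF k, of "\<lambda>k. (vf_apply (X k) q y)\<^sup>2"] by simp
  then have \<beta>y: "0 < \<beta> y" using nz by (smt (verit) zero_less_power2)
  define \<delta> where "\<delta> = \<beta> y / 2"
  have \<delta>: "0 < \<delta>" using \<beta>y by (simp add: \<delta>_def)
  obtain \<rho>1 where \<rho>1: "0 < \<rho>1" "\<rho>1 \<le> \<rho>0" "\<And>x. x \<in> cball y \<rho>1 \<Longrightarrow> \<delta> \<le> \<beta> x"
  proof -
    obtain d where d: "0 < d" "\<And>x. x \<in> \<Omega> \<Longrightarrow> dist x y < d \<Longrightarrow> dist (\<beta> x) (\<beta> y) < \<delta>"
      using \<beta>cont y(1) \<delta> unfolding continuous_on_iff by blast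
    have "\<delta> \<le> \<beta> x" if "x \<in> cball y (min \<rho>0 (d / 2))" for x
    proof -
      have "x \<in> \<Omega>" "dist x y < d" using that d(1) \<rho>0 by (auto simp: dist_commute)
      from d(2)[OF this] show ?thesis by (simp add: dist_real_def \<delta>_def abs_if split: if_splits)
    qed
    then show ?thesis using that[of "min \<rho>0 (d / 2)"] d \<rho>0 by auto
  qed
  let ?U = "cball y \<rho>1"
  have U: "?U \<subseteq> \<Omega>" using \<rho>1 \<rho>0 by (meson order_trans subset_cball)
  have "continuous_on \<Omega> (sos_op r X Y q)" unfolding sos_op_def[abs_def]
    by (intro continuous_on_add continuous_on_sum C_inf_on_continuous C_inf_on_vf_apply \<open>open \<Omega>\<close> q X Y)
  then have "bounded (sos_op r X Y q ` ?U)"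
    using U compact_cball compact_continuous_image compact_imp_bounded continuous_on_subset by metis
  then obtain B1 where B1: "0 < B1" "\<And>x. x \<in> ?U \<Longrightarrow> sos_op r X Y q x \<le> B1"
    unfolding bounded_pos by (auto simp: abs_le_iff)
  define B2 where "B2 = 2 * (\<rho>1 + R)"
  have B2: "0 \<le> B2" using \<rho>1 by (simp add: B2_def R_def)
  have nB2: "2 * norm (x - x0) \<le> B2" if "x \<in> ?U" for x
  proof -
    have "norm (y - x0) = R" by (simp add: R_def x0_def)
    then show ?thesis
      using that norm_triangle_ineq[of "x - y" "y - x0"] by (simp add: B2_def dist_norm norm_minus_commute)
  qed
  \<comment> \<open>\<open>B1\<close> bounds the operator on \<open>q\<close> from above and
    \<open>B2\<close> bounds the gradient of \<open>q\<close>. The choice makes the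
    \<open>\<alpha>^2\<close> term beat all others; \<open>1 \<le> \<alpha>\<close> allows
    \<open>C\<close> to be counted as \<open>\<alpha> * C\<close>.\<close>
  define \<alpha> where "\<alpha> = (B1 + K * B2 + C) / \<delta> + 1"
  have \<alpha>: "1 \<le> \<alpha>" "B1 + K * B2 + C < \<alpha> * \<delta>"
    using B1 B2 KC \<delta> by (auto simp: \<alpha>_def algebra_simps add_divide_distrib)
  have "0 < \<alpha> * (\<alpha> * \<delta> - B1 - K * B2 - C)" using \<alpha> by simp
  moreover have "C \<le> \<alpha> * C" using \<alpha> KC by (simp add: mult_le_cancel_right1)
  ultimately have neg: "- \<alpha>\<^sup>2 * \<delta> + \<alpha> * B1 + K * (\<alpha> * B2) + C < 0"
    by (simp add: power2_eq_square algebra_simps)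
  define ex where "ex x = exp (- \<alpha> * q x)" for x
  define w where "w x = ex x - ex y" for x
  have ex: "C_inf_on \<Omega> ex" unfolding ex_def using \<open>open \<Omega>\<close>
    by (intro C_inf_on_exp_comp C_inf_on_mult C_inf_on_const q)
  have w: "C_inf_on \<Omega> w" unfolding w_def using \<open>open \<Omega>\<close> by (intro C_inf_on_diff C_inf_on_const ex)
  have dex: "(ex has_derivative (\<lambda>h. - \<alpha> * ex x * (2 * ((x - x0) \<bullet> h)))) (at x)" for x
    unfolding ex_def by (rule has_derivative_eq_rhs, (rule derivative_eq_intros dq | simp)+) (simp add: fun_eq_iff)
  have dw: "(w has_derivative (\<lambda>h. - \<alpha> * ex x * (2 * ((x - x0) \<bullet> h)))) (at x)" for x
    unfolding w_def using has_derivative_diff[OF dex has_derivative_const] by simp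
  have Xw: "vf_apply Z w x = - \<alpha> * (ex x * vf_apply Z q x)" for Z x
    unfolding Xq by (subst vf_apply_eqI[OF dw]) simp
  have XXw: "vf_apply Z (vf_apply Z w) x = ex x * (\<alpha>\<^sup>2 * (vf_apply Z q x)\<^sup>2 - \<alpha> * vf_apply Z (vf_apply Z q) x)"
    if "C_inf_on \<Omega> Z" "x \<in> \<Omega>" for Z x
  proof -
    have D: "(vf_apply Z q has_derivative frechet_derivative (vf_apply Z q) (at x)) (at x)"
      using C_inf_on_has_derivative[OF C_inf_on_vf_apply[OF \<open>open \<Omega>\<close> q that(1)] that(2)] .
    have "vf_apply Z w = (\<lambda>x. - \<alpha> * (ex x * vf_apply Z q x))" using Xw by blast
    then show ?thesis
      using vf_apply_eqI[OF has_derivative_mult_right[OF has_derivative_mult[OF dex D], of "- \<alpha>"], of Z]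
      by (simp add: Xq vf_apply_def[of Z "vf_apply Z q"] power2_eq_square algebra_simps)
  qed
  have Pw: "sos_op r X Y w x = ex x * (\<alpha>\<^sup>2 * \<beta> x - \<alpha> * sos_op r X Y q x)" if "x \<in> \<Omega>" for x
  proof -
    have "(\<Sum>k=1..r. vf_apply (X k) (vf_apply (X k) w) x) =
       (\<Sum>k=1..r. ex x * (\<alpha>\<^sup>2 * (vf_apply (X k) q x)\<^sup>2 - \<alpha> * vf_apply (X k) (vf_apply (X k) q) x))"
      by (intro sum.cong refl XXw X that)
    also have "\<dots> = ex x * (\<alpha>\<^sup>2 * \<beta> x - \<alpha> * (\<Sum>k=1..r. vf_apply (X k) (vf_apply (X k) q) x))"
      by (simp add: \<beta>_def sum_distrib_left sum_subtractf right_diff_distrib)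
    finally show ?thesis unfolding sos_op_def Xw by (simp add: algebra_simps)
  qed
  \<comment> \<open>The closed half-size ball without \<open>y\<close> lies inside the open exterior
    ball, where \<open>v\<close> has no zeros.\<close>
  have contact: "v x < 0" if "x \<in> \<Omega>" "x \<noteq> y" "norm (x - x0) \<le> R" for x
  proof -
    define d where "d = x - y"
    have d: "0 < (norm d)\<^sup>2" using that by (simp add: d_def)
    have "x - x0 = d - (1 / 2) *\<^sub>R \<nu>" by (simp add: d_def x0_def)
    then have "(norm (d - (1 / 2) *\<^sub>R \<nu>))\<^sup>2 \<le> R\<^sup>2" using that(3) by (simp add: power_mono)
    then have "(norm d)\<^sup>2 \<le> d \<bullet> \<nu>"
      by (simp add: R_def power2_norm_eq_inner inner_diff_left inner_diff_right inner_commute power_divide)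
    moreover have "(norm (d - \<nu>))\<^sup>2 = (norm d)\<^sup>2 - 2 * (d \<bullet> \<nu>) + (norm \<nu>)\<^sup>2"
      by (simp add: power2_norm_eq_inner inner_diff_left inner_diff_right inner_commute)
    ultimately have "(norm (d - \<nu>))\<^sup>2 < (norm \<nu>)\<^sup>2" using d by linarith
    then have "norm (d - \<nu>) < norm \<nu>" by (simp add: power_less_imp_less_base)
    then have "x \<in> ball (y + \<nu>) (norm \<nu>)" by (simp add: d_def dist_norm norm_minus_commute algebra_simps)
    then have "v x \<noteq> 0" using \<nu> that(1) by (auto simp: exterior_normal_def)
    then show ?thesis using v0[OF that(1)] by simp
  qed
  obtain \<mu> where \<mu>: "0 < \<mu>" "\<And>x. x \<in> sphere y \<rho>1 \<inter> cball x0 R \<Longrightarrow> v x \<le> - \<mu>"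
  proof (cases "sphere y \<rho>1 \<inter> cball x0 R = {}")
    case True
    then show ?thesis using that[of 1] by auto
  next
    case False
    have sub: "sphere y \<rho>1 \<inter> cball x0 R \<subseteq> \<Omega>" using U by auto
    have "compact (sphere y \<rho>1 \<inter> cball x0 R)" by (simp add: compact_Int)
    then obtain p where p: "p \<in> sphere y \<rho>1 \<inter> cball x0 R" "\<And>x. x \<in> sphere y \<rho>1 \<inter> cball x0 R \<Longrightarrow> v x \<le> v p"
      using continuous_attains_sup[OF _ False continuous_on_subset[OF C_inf_on_continuous[OF v] sub]] by blast
    then have "p \<noteq> y" using \<rho>1 by auto
    then have "v p < 0" using p(1) sub by (intro contact) (auto simp: dist_norm norm_minus_commute)
    then show ?thesis using that[of "- v p"] p(2) by auto
  qed
  \<comment> \<open>Small against the gap \<open>\<mu>\<close>, so that \<open>g < 0\<close> on the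
    part of the sphere where the barrier may be positive; on the rest \<open>w < 0\<close> and
    \<open>v \<le> 0\<close>. Since \<open>g y = 0\<close>, the maximum of \<open>g\<close> is then
    interior.\<close>
  define \<epsilon> where "\<epsilon> = \<mu> / 2"
  have \<epsilon>: "0 < \<epsilon>" using \<mu> by (simp add: \<epsilon>_def)
  define g where "g x = v x + \<epsilon> * w x" for x
  have g: "C_inf_on \<Omega> g" unfolding g_def using \<open>open \<Omega>\<close> by (intro C_inf_on_add C_inf_on_mult C_inf_on_const v w)
  have ex1: "0 < ex x" "ex x \<le> 1" for x using \<alpha> by (auto simp: ex_def qn)
  have bdry: "g x < 0" if "x \<in> sphere y \<rho>1" for x
  proof (cases "x \<in> cball x0 R")
    case True
    have "w x < 1" using ex1[of x] ex1[of y] by (simp add: w_def)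
    then have "\<epsilon> * w x < \<epsilon>" using \<epsilon> by simp
    moreover have "v x \<le> - \<mu>" using \<mu>(2) that True by blast
    ultimately show ?thesis using \<mu>(1) unfolding g_def \<epsilon>_def by linarith
  next
    case False
    then have "R\<^sup>2 < (norm (x - x0))\<^sup>2" by (intro power_strict_mono) (auto simp: R_def dist_norm norm_minus_commute)
    then have "\<alpha> * q y < \<alpha> * q x" using \<alpha> by (simp add: qy qn[of x])
    then have "w x < 0" by (simp add: w_def ex_def)
    then have "\<epsilon> * w x < 0" using \<epsilon> by (simp add: mult_pos_neg)
    moreover have "v x \<le> 0" using v0 U that by auto
    ultimately show ?thesis by (simp add: g_def)
  qed
  obtain p where p: "p \<in> ?U" "\<And>x. x \<in> ?U \<Longrightarrow> g x \<le> g p"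
    using continuous_attains_sup[OF compact_cball _ continuous_on_subset[OF C_inf_on_continuous[OF g] U]] \<rho>1 by auto
  have "g y = 0" using y by (simp add: g_def w_def)
  then have gp: "0 \<le> g p" using p(2)[of y] \<rho>1 by simp
  then have pb: "p \<in> ball y \<rho>1" using bdry[of p] p(1) by (auto simp: less_le)
  have p\<Omega>: "p \<in> \<Omega>" using U p by blast
  have ballC: "C_inf_on (ball y \<rho>1) f" if "C_inf_on \<Omega> f" for f :: "'a \<Rightarrow> 'b::real_normed_vector"
    by (rule C_inf_on_subset[OF that]) (use U in auto)
  have gmax: "g x \<le> g p" if "x \<in> ball y \<rho>1" for x using p(2) that by simp
  note maxg = second_derivative_at_max_le(1)[OF open_ball ballC[OF g] ballC[OF Y] pb gmax]
    second_derivative_at_max_le(2)[OF open_ball ballC[OF g] ballC pb gmax]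
  \<comment> \<open>At the interior maximum the gradient of \<open>v\<close> is minus
    \<open>\<epsilon>\<close> times that of \<open>w\<close>, so the term with \<open>K\<close>
    grows only linearly in \<open>\<alpha>\<close>.\<close>
  have dgp: "frechet_derivative v (at p) h + \<epsilon> * (- \<alpha> * ex p * (2 * ((p - x0) \<bullet> h))) = 0" for h
    using frechet_derivative_eqI[OF has_derivative_add[OF C_inf_on_has_derivative[OF v p\<Omega>] has_derivative_mult_right[OF dw, of \<epsilon>]]] maxg(1)
    unfolding g_def by metis
  have "sos_op r X Y g p \<le> 0"
    unfolding sos_op_def using maxg(1) by (auto simp: vf_apply_def[of Y] intro!: sum_nonpos maxg(2) X)
  moreover have "sos_op r X Y g p = sos_op r X Y v p + \<epsilon> * sos_op r X Y w p"
  proof -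
    have "(\<Sum>k=1..r. vf_apply (X k) (vf_apply (X k) g) p) =
      (\<Sum>k=1..r. vf_apply (X k) (vf_apply (X k) v) p + \<epsilon> * vf_apply (X k) (vf_apply (X k) w) p)"
      unfolding g_def by (intro sum.cong refl vf_apply_vf_apply_add_mult[OF \<open>open \<Omega>\<close> v w _ p\<Omega>] X)
    moreover have "vf_apply Y g p = vf_apply Y v p + \<epsilon> * vf_apply Y w p"
      unfolding g_def by (rule vf_apply_add_mult[OF v w p\<Omega>])
    ultimately show ?thesis by (simp add: sos_op_def sum.distrib sum_distrib_left distrib_left)
  qed
  ultimately have "sos_op r X Y v p \<le> - (\<epsilon> * sos_op r X Y w p)" by simp
  also have "\<dots> = - (\<epsilon> * ex p) * (\<alpha>\<^sup>2 * \<beta> p - \<alpha> * sos_op r X Y q p)" by (simp add: Pw[OF p\<Omega>])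
  also have "\<dots> \<le> - (\<epsilon> * ex p) * (\<alpha>\<^sup>2 * \<delta> - \<alpha> * B1)"
  proof (rule mult_left_mono_neg)
    show "\<alpha>\<^sup>2 * \<delta> - \<alpha> * B1 \<le> \<alpha>\<^sup>2 * \<beta> p - \<alpha> * sos_op r X Y q p"
      using \<alpha> \<rho>1(3)[OF p(1)] B1(2)[OF p(1)] by (intro diff_mono mult_left_mono) auto
    show "- (\<epsilon> * ex p) \<le> 0" using \<epsilon> ex1[of p] by simp
  qed
  finally have 1: "sos_op r X Y v p \<le> (\<epsilon> * ex p) * (- \<alpha>\<^sup>2 * \<delta> + \<alpha> * B1)" by (simp add: algebra_simps)
  have "onorm (frechet_derivative v (at p)) \<le> \<epsilon> * ex p * (\<alpha> * B2)"
  proof (rule onorm_le)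
    fix h
    have "frechet_derivative v (at p) h = (\<epsilon> * ex p * \<alpha>) * (2 * ((p - x0) \<bullet> h))" using dgp[of h] by (simp add: algebra_simps)
    then have "norm (frechet_derivative v (at p) h) = (\<epsilon> * ex p * \<alpha>) * (2 * \<bar>(p - x0) \<bullet> h\<bar>)"
      using \<epsilon> ex1[of p] \<alpha> by (simp add: abs_mult)
    also have "\<dots> \<le> (\<epsilon> * ex p * \<alpha>) * (B2 * norm h)"
    proof (rule mult_left_mono)
      have "2 * \<bar>(p - x0) \<bullet> h\<bar> \<le> (2 * norm (p - x0)) * norm h" using Cauchy_Schwarz_ineq2[of "p - x0" h] by simp
      also have "\<dots> \<le> B2 * norm h" using nB2[OF p(1)] by (intro mult_right_mono) auto
      finally show "2 * \<bar>(p - x0) \<bullet> h\<bar> \<le> B2 * norm h" .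
    qed (use \<epsilon> ex1[of p] \<alpha> in simp)
    finally show "norm (frechet_derivative v (at p) h) \<le> \<epsilon> * ex p * (\<alpha> * B2) * norm h" by (simp add: algebra_simps)
  qed
  then have 2: "K * onorm (frechet_derivative v (at p)) \<le> (\<epsilon> * ex p) * (K * (\<alpha> * B2))"
    using mult_left_mono[OF _ KC(1)] by (fastforce simp: algebra_simps)
  \<comment> \<open>\<open>0 \<le> g p\<close> and \<open>v p \<le> 0\<close> bound
    \<open>|v p|\<close> by \<open>\<epsilon> * w p\<close>; with this all terms share the positive
    factor \<open>\<epsilon> * ex p\<close>.\<close>
  have "\<bar>v p\<bar> \<le> \<epsilon> * w p" using gp v0[OF p\<Omega>] by (simp add: g_def)
  also have "\<dots> \<le> \<epsilon> * ex p" using \<epsilon> ex1[of y] by (intro mult_left_mono) (auto simp: w_def)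
  finally have 3: "C * \<bar>v p\<bar> \<le> (\<epsilon> * ex p) * C" using KC(2) by (metis mult.commute mult_left_mono)
  have "0 \<le> sos_op r X Y v p + K * onorm (frechet_derivative v (at p)) + C * \<bar>v p\<bar>"
    using ineq[of p] p(1) \<rho>1(2) by auto
  also have "\<dots> \<le> (\<epsilon> * ex p) * (- \<alpha>\<^sup>2 * \<delta> + \<alpha> * B1) + (\<epsilon> * ex p) * (K * (\<alpha> * B2)) + (\<epsilon> * ex p) * C"
    using 1 2 3 by linarith
  also have "\<dots> = (\<epsilon> * ex p) * (- \<alpha>\<^sup>2 * \<delta> + \<alpha> * B1 + K * (\<alpha> * B2) + C)" by (simp only: distrib_left)
  also have "\<dots> < 0" using \<epsilon> ex1[of p] neg by (intro mult_pos_neg) auto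
  finally show False by simp
qed

text \<open>The constants in \<open>ineq\<close> may depend on the point, since tangency of the
  generators is checked at one zero of \<open>v\<close> at a time.\<close>

lemma max_propagation:
  fixes v :: "'a::euclidean_space \<Rightarrow> real"
  assumes "open \<Omega>" and X: "\<And>k. k \<in> {1..r} \<Longrightarrow> C_inf_on \<Omega> (X k)" and Y: "C_inf_on \<Omega> Y" and v: "C_inf_on \<Omega> v"
    and v0: "\<And>x. x \<in> \<Omega> \<Longrightarrow> v x \<le> 0"
    and ineq: "\<And>y. y \<in> \<Omega> \<Longrightarrow> \<exists>\<rho> K C. 0 < \<rho> \<and> 0 \<le> K \<and> 0 \<le> C \<and> cball y \<rho> \<subseteq> \<Omega> \<and> (\<forall>x\<in>cball y \<rho>.
        0 \<le> sos_op r X Y v x + K * onorm (frechet_derivative v (at x)) + C * \<bar>v x\<bar>)"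
    and Z: "Z \<in> lie_module \<Omega> r X" and \<gamma>: "integral_curve \<Omega> Z \<gamma> I"
    and t0: "t0 \<in> I" "v (\<gamma> t0) = 0" and t: "t \<in> I"
  shows "v (\<gamma> t) = 0"
proof -
  let ?F = "{x \<in> \<Omega>. v x = 0}"
  have F: "closedin (top_of_set \<Omega>) ?F"
    using continuous_closedin_preimage_constant[OF C_inf_on_continuous[OF v]] .
  have "C_inf_on \<Omega> (X k) \<and> tangent_to ?F (X k)" if k: "k \<in> {1..r}" for k
  proof (intro conjI X[OF k])
    have "X k y \<bullet> \<nu> = 0" if y: "y \<in> \<Omega>" "v y = 0" and \<nu>: "exterior_normal ?F y \<nu>" for y \<nu>
    proof -
      obtain \<rho> K C where *: "0 < \<rho>" "cball y \<rho> \<subseteq> \<Omega>" "0 \<le> K" "0 \<le> C"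
        "\<And>x. x \<in> cball y \<rho> \<Longrightarrow>
          0 \<le> sos_op r X Y v x + K * onorm (frechet_derivative v (at x)) + C * \<bar>v x\<bar>"
        using ineq[OF y(1)] by blast
      show ?thesis by (rule hopf_tangent[OF assms(1) X Y v v0 y \<nu> * k])
    qed
    then show "tangent_to ?F (X k)" by (simp add: tangent_to_def)
  qed
  then have "C_inf_on \<Omega> Z \<and> tangent_to ?F Z" by (rule lie_module_tangent[OF assms(1) F _ Z])
  moreover have "\<gamma> t0 \<in> ?F" using \<gamma> t0 by (auto simp: integral_curve_def)
  ultimately have "\<gamma> ` I \<subseteq> ?F" using integral_curve_invariance[OF assms(1) F _ _ \<gamma> t0(1)] by blast
  then show ?thesis using t by blast
qed

section \<open>Smooth factorisation of matrices of constant rank\<close>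

definition outer :: "real^'n \<Rightarrow> real^'n^'n" where
  "outer v = (\<chi> i j. v $ i * v $ j)"

lemma outer_mult: "outer v *v \<xi> = (v \<bullet> \<xi>) *\<^sub>R v"
  by (simp add: vec_eq_iff outer_def matrix_vector_mult_def inner_vec_def sum_distrib_left algebra_simps)

lemma scaleR_matrix_vector: "(c *\<^sub>R (M :: real^'n^'m)) *v \<xi> = c *\<^sub>R (M *v \<xi>)"
  by (simp add: vec_eq_iff matrix_vector_mult_def sum_distrib_left algebra_simps)

lemma sym_matrix_inner:
  fixes M :: "real^'n^'n"
  assumes "transpose M = M"
  shows "(M *v \<xi>) \<bullet> \<eta> = \<xi> \<bullet> (M *v \<eta>)"
  by (metis assms dot_lmul_matrix transpose_matrix_vector)

lemma symmetric_entry: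
  assumes "transpose M = M"
  shows "M $ j $ i = M $ i $ j"
proof -
  have "transpose M $ i $ j = M $ j $ i" by (simp add: transpose_def)
  then show ?thesis by (simp add: assms)
qed

text \<open>Otherwise a short step from \<open>\<xi>\<close> in the direction
  \<open>- M \<xi>\<close> would make the quadratic form negative: its first order change there is
  \<open>- 2 t |M \<xi>|^2\<close>.\<close>

lemma psd_null:
  fixes M :: "real^'n^'n"
  assumes sym: "transpose M = M" and psd: "\<And>\<xi>. 0 \<le> \<xi> \<bullet> (M *v \<xi>)" and "\<xi> \<bullet> (M *v \<xi>) = 0"
  shows "M *v \<xi> = 0"
proof (rule ccontr)
  let ?\<eta> = "M *v \<xi>"
  assume "?\<eta> \<noteq> 0"
  define s where "s = ?\<eta> \<bullet> ?\<eta>"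
  define c where "c = ?\<eta> \<bullet> (M *v ?\<eta>)"
  have s: "0 < s" using \<open>?\<eta> \<noteq> 0\<close> by (simp add: s_def)
  have c: "0 \<le> c" by (simp add: c_def psd)
  define t where "t = s / (c + 1)"
  have t: "0 < t" "t * c \<le> s" using c s by (auto simp: t_def pos_divide_le_eq algebra_simps)
  have "0 \<le> (\<xi> - t *\<^sub>R ?\<eta>) \<bullet> (M *v (\<xi> - t *\<^sub>R ?\<eta>))" by (rule psd)
  also have "\<dots> = t * (t * c) - 2 * t * s"
    using assms(3) sym_matrix_inner[OF sym, of \<xi> ?\<eta>]
    by (simp add: matrix_vector_mult_diff_distrib linear_cmul[OF matrix_vector_mul_linear]
        inner_diff_left inner_diff_right s_def c_def algebra_simps)
  also have "\<dots> = t * (t * c - 2 * s)" by (simp add: algebra_simps)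
  finally have "2 * s \<le> t * c" using t(1) by (simp add: zero_le_mult_iff)
  then show False using t(2) s by simp
qed

section \<open>Smooth orthogonal projector onto the range\<close>

definition range_projector :: "real^'n^'n \<Rightarrow> real^'n^'n \<Rightarrow> bool" where
  "range_projector A P \<longleftrightarrow> transpose P = P \<and> (\<forall>\<xi>. P *v (A *v \<xi>) = A *v \<xi>) \<and> (\<forall>\<xi>. P *v \<xi> \<in> range ((*v) A))"

text \<open>Each projector fixes the values of the other; taking adjoints of these relations
  identifies the two.\<close>

lemma range_projector_unique:
  assumes "range_projector A P" "range_projector A Q"
  shows "P = Q"
proof -
  have QP: "Q *v (P *v \<xi>) = P *v \<xi>" and PQ: "P *v (Q *v \<xi>) = Q *v \<xi>" for \<xi>
    using assms unfolding range_projector_def by (metis imageE)+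
  have P: "transpose P = P" and Q: "transpose Q = Q" using assms by (auto simp: range_projector_def)
  have "(P *v \<xi>) \<bullet> \<eta> = (Q *v \<xi>) \<bullet> \<eta>" for \<xi> \<eta>
  proof -
    have "(P *v \<xi>) \<bullet> \<eta> = (Q *v (P *v \<xi>)) \<bullet> \<eta>" by (simp only: QP)
    also have "\<dots> = \<xi> \<bullet> (P *v (Q *v \<eta>))" by (simp only: sym_matrix_inner[OF Q] sym_matrix_inner[OF P])
    also have "\<dots> = (Q *v \<xi>) \<bullet> \<eta>" by (simp only: PQ sym_matrix_inner[OF Q])
    finally show ?thesis .
  qed
  then have "P *v \<xi> = Q *v \<xi>" for \<xi> using vector_eq_rdot by blast
  then show ?thesis by (simp add: matrix_eq)
qed

lemma projector_fixes_span:
  fixes P :: "real^'n^'n"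
  assumes "\<And>v. v \<in> S \<Longrightarrow> P *v v = v" "\<xi> \<in> span S"
  shows "P *v \<xi> = \<xi>"
  using linear_eq_on_span[OF matrix_vector_mul_linear linear_id, of S P \<xi>] assms by (simp add: id_def)

text \<open>The dimension clause records that the vectors indexed by \<open>I\<close> stay
  independent on all of \<open>U\<close>. Under constant rank it identifies their span with the
  range.\<close>

definition local_projector ::
    "('i \<Rightarrow> 'a::real_normed_vector \<Rightarrow> real^'n) \<Rightarrow> 'i set \<Rightarrow> 'a set \<Rightarrow> ('a \<Rightarrow> real^'n^'n) \<Rightarrow> bool" where
  "local_projector c I U P \<longleftrightarrow> open U \<and> (\<forall>i j. C_inf_on U (\<lambda>x. P x $ i $ j)) \<and>
     (\<forall>x\<in>U. transpose (P x) = P x \<and> (\<forall>i\<in>I. P x *v c i x = c i x) \<and>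
        (\<forall>\<xi>. P x *v \<xi> \<in> span ((\<lambda>i. c i x) ` I)) \<and> dim (span ((\<lambda>i. c i x) ` I)) = card I)"

lemma local_projectorD:
  assumes "local_projector c I U P"
  shows "open U" "C_inf_on U (\<lambda>x. P x $ i $ j)"
    "x \<in> U \<Longrightarrow> transpose (P x) = P x" "x \<in> U \<Longrightarrow> l \<in> I \<Longrightarrow> P x *v c l x = c l x"
    "x \<in> U \<Longrightarrow> P x *v \<xi> \<in> span ((\<lambda>i. c i x) ` I)"
    "x \<in> U \<Longrightarrow> dim (span ((\<lambda>i. c i x) ` I)) = card I"
  using assms by (auto simp: local_projector_def)

text \<open>Gram-Schmidt, carried by the projector instead of an orthonormal basis: with
  \<open>w\<close> the part of \<open>c i\<close> orthogonal to the previous span, the orthogonal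
  projector onto the line of \<open>w\<close> is added. The neighbourhood shrinks to the open set
  where \<open>w\<close> does not vanish.\<close>

lemma local_smooth_projector:
  fixes c :: "'i \<Rightarrow> 'a::real_normed_vector \<Rightarrow> real^'n"
  assumes "open S" "x0 \<in> S" "\<And>i. C_inf_on S (c i)"
    and "finite I" "inj_on (\<lambda>i. c i x0) I" "independent ((\<lambda>i. c i x0) ` I)"
  shows "\<exists>U P. x0 \<in> U \<and> U \<subseteq> S \<and> local_projector c I U P"
  using assms(4-6)
proof (induction I rule: finite_induct)
  case empty
  have "local_projector c {} S (\<lambda>x. 0)"
    using assms by (simp add: local_projector_def C_inf_on_const transpose_def vec_eq_iff)
  then show ?case using assms by blast
next
  case (insert i I)
  have ind: "independent ((\<lambda>i. c i x0) ` I)" "c i x0 \<notin> span ((\<lambda>i. c i x0) ` I)"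
  proof -
    have "c i x0 \<notin> (\<lambda>i. c i x0) ` I" using insert.prems(1) insert.hyps by auto
    then show "independent ((\<lambda>i. c i x0) ` I)" "c i x0 \<notin> span ((\<lambda>i. c i x0) ` I)"
      using insert.prems(2) by (auto simp: independent_insert)
  qed
  have "inj_on (\<lambda>i. c i x0) I" using insert.prems(1) by (simp add: inj_on_insert)
  from insert.IH[OF this ind(1)] obtain U P where U0: "x0 \<in> U" "U \<subseteq> S" and UP: "local_projector c I U P"
    by blast
  note U = local_projectorD(1)[OF UP] U0
  note P = local_projectorD(2)[OF UP] and sym = local_projectorD(3)[OF UP] and fx = local_projectorD(4)[OF UP]
    and rg = local_projectorD(5)[OF UP] and dm = local_projectorD(6)[OF UP]
  define w where "w x = c i x - P x *v c i x" for x
  have ci: "C_inf_on U (c i)" using C_inf_on_subset[OF assms(3) U(3)] .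
  have w: "C_inf_on U w" unfolding w_def
    by (intro C_inf_on_diff C_inf_on_matrix_vector_mult U(1) P ci)
  define V where "V = {x \<in> U. w x \<noteq> 0}"
  have "V = U \<inter> w -` (- {0})" by (auto simp: V_def)
  then have V: "open V" using continuous_open_preimage[OF C_inf_on_continuous[OF w] U(1), of "- {0}"]
    by (simp add: open_Compl)
  have "w x0 \<noteq> 0" using ind(2) rg[OF U(2), of "c i x0"] by (auto simp: w_def)
  then have x0V: "x0 \<in> V" using U by (simp add: V_def)
  have VU: "V \<subseteq> U" by (auto simp: V_def)
  define Q where "Q x = P x + ((w x \<bullet> w x) powr (- 1)) *\<^sub>R outer (w x)" for x
  have Qm: "Q x *v \<xi> = P x *v \<xi> + ((w x \<bullet> w x) powr (- 1) * (w x \<bullet> \<xi>)) *\<^sub>R w x" for x \<xi>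
    by (simp add: Q_def matrix_vector_mult_add_rdistrib scaleR_matrix_vector outer_mult)
  have "C_inf_on V (\<lambda>x. Q x $ a $ b)" for a b
  proof -
    have wV: "C_inf_on V w" using C_inf_on_subset[OF w VU] .
    have PV: "C_inf_on V (\<lambda>x. P x $ a $ b)" using C_inf_on_subset[OF P VU] .
    have "C_inf_on V (\<lambda>x. P x $ a $ b + ((w x \<bullet> w x) powr (- 1)) * (w x $ a * w x $ b))"
      by (intro C_inf_on_add C_inf_on_mult C_inf_on_powr_comp C_inf_on_inner C_inf_on_vec_nth V wV PV)
        (simp add: V_def)
    then show ?thesis by (simp add: Q_def outer_def)
  qed
  moreover have "transpose (Q x) = Q x \<and> (\<forall>j\<in>insert i I. Q x *v c j x = c j x) \<and>
        (\<forall>\<xi>. Q x *v \<xi> \<in> span ((\<lambda>i. c i x) ` insert i I)) \<and>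
        dim (span ((\<lambda>i. c i x) ` insert i I)) = card (insert i I)" if x: "x \<in> V" for x
  proof (intro conjI ballI allI)
    have xU: "x \<in> U" and w0: "w x \<noteq> 0" using x by (auto simp: V_def)
    have fs: "P x *v \<xi> = \<xi>" if "\<xi> \<in> span ((\<lambda>i. c i x) ` I)" for \<xi>
      by (rule projector_fixes_span[OF _ that]) (use fx[OF xU] in auto)
    have wc: "w x \<bullet> c j x = 0" if "j \<in> I" for j
      using sym_matrix_inner[OF sym[OF xU], of "c i x" "c j x"] fx[OF xU that]
      by (simp add: w_def inner_diff_left)
    have "w x \<bullet> \<xi> = 0" if "\<xi> \<in> span ((\<lambda>i. c i x) ` I)" for \<xi>
      using orthogonal_to_span[OF that, of "w x"] wc by (auto simp: orthogonal_def)
    then have wP: "w x \<bullet> (P x *v \<xi>) = 0" for \<xi> using rg[OF xU] by blast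
    have "transpose (Q x) $ a $ b = Q x $ a $ b" for a b
    proof -
      have "P x $ b $ a = P x $ a $ b" by (rule symmetric_entry[OF sym[OF xU]])
      then show ?thesis by (simp add: Q_def outer_def transpose_def mult.commute)
    qed
    then show "transpose (Q x) = Q x" by (simp add: vec_eq_iff)
    show "Q x *v c j x = c j x" if "j \<in> insert i I" for j
    proof (cases "j = i")
      case True
      have "w x \<bullet> c i x = w x \<bullet> w x" using wP[of "c i x"] by (simp add: w_def inner_diff_right)
      then have "(w x \<bullet> w x) powr (- 1) * (w x \<bullet> c i x) = 1" using w0 by (simp add: powr_minus powr_one)
      then have "Q x *v c i x = P x *v c i x + 1 *\<^sub>R w x" by (simp only: Qm)
      then show ?thesis using True by (simp add: w_def)
    next
      case False
      then show ?thesis using that fx[OF xU] wc by (simp add: Qm)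
    qed
    have sub: "span ((\<lambda>i. c i x) ` I) \<subseteq> span ((\<lambda>i. c i x) ` insert i I)" by (intro span_mono) auto
    have "w x \<in> span ((\<lambda>i. c i x) ` insert i I)" unfolding w_def
    proof (rule span_diff)
      show "c i x \<in> span ((\<lambda>i. c i x) ` insert i I)" by (rule span_base) simp
      show "P x *v c i x \<in> span ((\<lambda>i. c i x) ` insert i I)" using rg[OF xU] sub by blast
    qed
    then show "Q x *v \<xi> \<in> span ((\<lambda>i. c i x) ` insert i I)" for \<xi>
      unfolding Qm
      using rg[OF xU, of \<xi>] sub by (intro span_add span_scale) blast+
    have "c i x \<notin> span ((\<lambda>i. c i x) ` I)" using fs w0 by (auto simp: w_def)
    then show "dim (span ((\<lambda>i. c i x) ` insert i I)) = card (insert i I)"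
      using dm[OF xU] insert.hyps by (simp add: dim_insert)
  qed
  ultimately have "local_projector c (insert i I) V Q" using V unfolding local_projector_def by blast
  then show ?case using x0V VU U(3) by blast
qed

lemma range_matrix_eq_span:
  fixes A :: "real^'n^'m"
  shows "range ((*v) A) = span ((\<lambda>i. A *v axis i 1) ` UNIV)"
proof -
  have "(Basis :: (real^'n) set) = range (\<lambda>i. axis i 1)" by (auto simp: Basis_vec_def)
  then have "(UNIV :: (real^'n) set) = span (range (\<lambda>i. axis i 1))" by (metis span_Basis)
  then have "range ((*v) A) = span ((*v) A ` range (\<lambda>i. axis i 1))"
    by (metis linear_span_image matrix_vector_mul_linear)
  then show ?thesis by (simp add: image_image)
qed

text \<open>Here the constant rank enters: columns that form a basis of the range at
  \<open>x0\<close> stay independent nearby, and by counting dimensions they still span the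
  range.\<close>

lemma smooth_range_projector:
  fixes A :: "'a::real_normed_vector \<Rightarrow> real^'n^'n"
  assumes "open S" and A: "C_inf_on S A" and rk: "\<And>x. x \<in> S \<Longrightarrow> rank (A x) = rt"
  obtains P where "\<And>i j. C_inf_on S (\<lambda>x. P x $ i $ j)" "\<And>x. x \<in> S \<Longrightarrow> range_projector (A x) (P x)"
proof -
  \<comment> \<open>The choice has no regularity built in; uniqueness forces it to agree near each
    point with the smooth local projector.\<close>
  define P where "P x = (SOME P. range_projector (A x) P)" for x
  define c where "c i x = A x *v axis i 1" for i x
  have c: "C_inf_on S (c i)" for i unfolding c_def
    by (intro C_inf_on_matrix_vector_mult C_inf_on_entry C_inf_on_const assms)
  have loc: "\<exists>U. open U \<and> x0 \<in> U \<and> U \<subseteq> S \<and> (\<forall>i j. C_inf_on U (\<lambda>x. P x $ i $ j)) \<and>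
      (\<forall>x\<in>U. range_projector (A x) (P x))" if x0: "x0 \<in> S" for x0
  proof -
    let ?R = "\<lambda>x. range ((*v) (A x))"
    obtain B where B: "B \<subseteq> (\<lambda>i. c i x0) ` UNIV" "independent B"
      "(\<lambda>i. c i x0) ` UNIV \<subseteq> span B" "card B = dim ((\<lambda>i. c i x0) ` UNIV)"
      using basis_exists by blast
    then obtain I where I: "inj_on (\<lambda>i. c i x0) I" "B = (\<lambda>i. c i x0) ` I"
      unfolding subset_image_inj by blast
    have "card I = dim (?R x0)"
      using B(4) I card_image[OF I(1)] by (simp add: range_matrix_eq_span c_def)
    then have cI: "card I = rt" using rk[OF x0] by (simp add: rank_dim_range)
    have "independent ((\<lambda>i. c i x0) ` I)" using B(2) I(2) by simp
    from local_smooth_projector[OF assms(1) x0 c finite I(1) this]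
    obtain U Q where U0: "x0 \<in> U" "U \<subseteq> S" and UQ: "local_projector c I U Q" by blast
    note U = local_projectorD(1)[OF UQ] U0
    note Q = local_projectorD(2)[OF UQ] and sym = local_projectorD(3)[OF UQ] and fx = local_projectorD(4)[OF UQ]
      and rg = local_projectorD(5)[OF UQ] and dm = local_projectorD(6)[OF UQ]
    have rp: "range_projector (A x) (Q x)" if x: "x \<in> U" for x
    proof -
      have sub: "span ((\<lambda>i. c i x) ` I) \<subseteq> ?R x"
        unfolding range_matrix_eq_span c_def by (intro span_mono) auto
      have "span ((\<lambda>i. c i x) ` I) = ?R x"
      proof (rule subspace_dim_equal[OF subspace_span _ sub])
        show "subspace (?R x)" by (simp add: range_matrix_eq_span)
        show "dim (?R x) \<le> dim (span ((\<lambda>i. c i x) ` I))"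
          using rk[of x] U(3) x cI dm[OF x] by (auto simp: rank_dim_range[symmetric])
      qed
      moreover have "Q x *v \<xi> = \<xi>" if "\<xi> \<in> span ((\<lambda>i. c i x) ` I)" for \<xi>
        by (rule projector_fixes_span[OF _ that]) (use fx[OF x] in auto)
      ultimately show ?thesis
        unfolding range_projector_def using sym[OF x] rg[OF x] by blast
    qed
    have PQ: "P x = Q x" if "x \<in> U" for x
      unfolding P_def using rp[OF that] range_projector_unique by (metis someI)
    have "C_inf_on U (\<lambda>x. P x $ i $ j)" for i j
      using Q[of i j] C_inf_on_cong[OF U(1), of "\<lambda>x. P x $ i $ j" "\<lambda>x. Q x $ i $ j"] PQ by simp
    moreover have "range_projector (A x) (P x)" if "x \<in> U" for x using rp[OF that] PQ[OF that] by simp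
    ultimately show ?thesis using U by blast
  qed
  have "C_inf_on S (\<lambda>x. P x $ i $ j)" for i j
  proof (rule C_inf_on_local)
    fix x assume "x \<in> S"
    from loc[OF this] obtain U where "open U" "x \<in> U" and U: "\<forall>i j. C_inf_on U (\<lambda>x. P x $ i $ j)"
      by (elim exE conjE)
    then show "\<exists>U. open U \<and> x \<in> U \<and> C_inf_on U (\<lambda>x. P x $ i $ j)"
      using U[rule_format, of i j] by (intro exI[of _ U] conjI)
  qed
  moreover have "range_projector (A x) (P x)" if "x \<in> S" for x
    using loc[OF that] by (elim exE conjE) (erule bspec)
  ultimately show ?thesis by (rule that)
qed

section \<open>Cholesky factorisation and the smooth square root\<close>

text \<open>This is \<open>A\<close> as the sum of the rank one matrices of the vectors
  \<open>h j\<close>, stated through the action on vectors. Their number is the dimension, whatever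
  the rank.\<close>

definition sum_of_outer :: "'a::real_normed_vector set \<Rightarrow> ('a \<Rightarrow> real^'n^'n) \<Rightarrow> ('n \<Rightarrow> 'a \<Rightarrow> real^'n) \<Rightarrow> bool" where
  "sum_of_outer S A h \<longleftrightarrow> (\<forall>j. C_inf_on S (h j)) \<and>
     (\<forall>x\<in>S. \<forall>\<xi>. A x *v \<xi> = (\<Sum>j\<in>UNIV. (h j x \<bullet> \<xi>) *\<^sub>R h j x))"

text \<open>The state of the elimination after the pivots in \<open>J\<close>; \<open>G\<close> is the Schur complement.\<close>

definition partial_cholesky ::
    "'a::real_normed_vector set \<Rightarrow> ('a \<Rightarrow> real^'n^'n) \<Rightarrow> 'n set \<Rightarrow> ('n \<Rightarrow> 'a \<Rightarrow> real^'n) \<Rightarrow> ('a \<Rightarrow> real^'n^'n) \<Rightarrow> bool" where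
  "partial_cholesky S H J h G \<longleftrightarrow> (\<forall>j. C_inf_on S (h j)) \<and> (\<forall>i j. C_inf_on S (\<lambda>x. G x $ i $ j)) \<and>
     (\<forall>x\<in>S. transpose (G x) = G x \<and> (\<forall>j\<in>J. G x *v axis j 1 = 0) \<and> (\<forall>\<xi>. 0 \<le> \<xi> \<bullet> (G x *v \<xi>)) \<and>
        (\<forall>\<xi>. \<xi> \<bullet> (G x *v \<xi>) = 0 \<longrightarrow> (\<forall>i. i \<notin> J \<longrightarrow> \<xi> $ i = 0)) \<and>
        (\<forall>\<xi>. H x *v \<xi> = G x *v \<xi> + (\<Sum>j\<in>J. (h j x \<bullet> \<xi>) *\<^sub>R h j x)))"

lemma partial_choleskyD:
  assumes "partial_cholesky S H J h G"
  shows "C_inf_on S (h j)" "C_inf_on S (\<lambda>x. G x $ i $ j)"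
    "x \<in> S \<Longrightarrow> transpose (G x) = G x" "x \<in> S \<Longrightarrow> j \<in> J \<Longrightarrow> G x *v axis j 1 = 0"
    "x \<in> S \<Longrightarrow> 0 \<le> \<xi> \<bullet> (G x *v \<xi>)"
    "x \<in> S \<Longrightarrow> \<xi> \<bullet> (G x *v \<xi>) = 0 \<Longrightarrow> i \<notin> J \<Longrightarrow> \<xi> $ i = 0"
    "x \<in> S \<Longrightarrow> H x *v \<xi> = G x *v \<xi> + (\<Sum>j\<in>J. (h j x \<bullet> \<xi>) *\<^sub>R h j x)"
  using assms by (auto simp: partial_cholesky_def)

text \<open>Positive definiteness makes every pivot positive on the whole of \<open>S\<close>, so
  the order of elimination is the same at all points and the formulas are smooth globally.\<close>

lemma smooth_cholesky:
  fixes H :: "'a::real_normed_vector \<Rightarrow> real^'n^'n"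
  assumes "open S" and H: "\<And>i j. C_inf_on S (\<lambda>x. H x $ i $ j)"
    and sym: "\<And>x. x \<in> S \<Longrightarrow> transpose (H x) = H x"
    and pd: "\<And>x \<xi>. x \<in> S \<Longrightarrow> \<xi> \<noteq> 0 \<Longrightarrow> 0 < \<xi> \<bullet> (H x *v \<xi>)"
  shows "\<exists>h. sum_of_outer S H h"
proof -
  have "\<exists>h G. partial_cholesky S H J h G" if "finite J" for J :: "'n set"
    using that
  proof (induction J rule: finite_induct)
    case empty
    have "0 \<le> \<xi> \<bullet> (H x *v \<xi>)" "\<xi> \<bullet> (H x *v \<xi>) = 0 \<Longrightarrow> \<xi> $ i = 0" if "x \<in> S" for x \<xi> i
      using pd[OF that, of \<xi>] by (cases "\<xi> = 0"; simp)+
    then have "partial_cholesky S H {} (\<lambda>j x. 0) H"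
      using H sym by (simp add: partial_cholesky_def C_inf_on_const)
    then show ?case by blast
  next
    case (insert i J)
    then obtain h G where hG: "partial_cholesky S H J h G" by blast
    note h = partial_choleskyD(1)[OF hG] and G = partial_choleskyD(2)[OF hG] and Gs = partial_choleskyD(3)[OF hG]
      and Gn = partial_choleskyD(4)[OF hG] and Gp = partial_choleskyD(5)[OF hG] and Gd = partial_choleskyD(6)[OF hG]
      and Gh = partial_choleskyD(7)[OF hG]
    let ?e = "axis i 1 :: real^'n"
    \<comment> \<open>The pivot. Null vectors of \<open>G x\<close> vanish outside \<open>J\<close>,
      and the unit vector at \<open>i\<close> does not, so the pivot is positive.\<close>
    define \<alpha> where "\<alpha> x = ?e \<bullet> (G x *v ?e)" for x
    have \<alpha>: "0 < \<alpha> x" if "x \<in> S" for x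
      using Gp[OF that, of ?e] Gd[OF that _ insert.hyps(2), of ?e] by (auto simp: \<alpha>_def less_le)
    define k where "k x = (\<alpha> x powr (- 1 / 2)) *\<^sub>R (G x *v ?e)" for x
    have Ge: "C_inf_on S (\<lambda>x. G x *v ?e)"
      by (intro C_inf_on_matrix_vector_mult C_inf_on_const G assms(1))
    have k: "C_inf_on S k" unfolding k_def
      by (intro C_inf_on_scaleR C_inf_on_powr_comp assms(1) Ge \<alpha>)
        (simp add: \<alpha>_def C_inf_on_inner[OF assms(1) C_inf_on_const Ge])
    define G' where "G' x = G x - outer (k x)" for x
    have G'm: "G' x *v \<xi> = G x *v \<xi> - (k x \<bullet> \<xi>) *\<^sub>R k x" for x \<xi>
      by (simp add: G'_def matrix_vector_mult_diff_rdistrib outer_mult)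
    have sm: "C_inf_on S (\<lambda>x. G' x $ a $ b)" for a b
    proof -
      have "C_inf_on S (\<lambda>x. G x $ a $ b - k x $ a * k x $ b)"
        by (intro C_inf_on_diff C_inf_on_mult C_inf_on_vec_nth assms(1) G k)
      then show ?thesis by (simp add: G'_def outer_def)
    qed
    have pt: "transpose (G' x) = G' x \<and> (\<forall>j\<in>insert i J. G' x *v axis j 1 = 0) \<and> (\<forall>\<xi>. 0 \<le> \<xi> \<bullet> (G' x *v \<xi>)) \<and>
        (\<forall>\<xi>. \<xi> \<bullet> (G' x *v \<xi>) = 0 \<longrightarrow> (\<forall>l. l \<notin> insert i J \<longrightarrow> \<xi> $ l = 0)) \<and>
        (\<forall>\<xi>. H x *v \<xi> = G' x *v \<xi> + (\<Sum>j\<in>insert i J. ((h(i := k)) j x \<bullet> \<xi>) *\<^sub>R (h(i := k)) j x))"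
      if x: "x \<in> S" for x
    proof (intro conjI ballI allI impI)
      note symG = sym_matrix_inner[OF Gs[OF x]]
      have sq: "\<alpha> x powr (- 1 / 2) * (\<alpha> x powr (- 1 / 2)) = inverse (\<alpha> x)"
      proof -
        have "\<alpha> x powr (- 1 / 2) * (\<alpha> x powr (- 1 / 2)) = \<alpha> x powr (- 1 / 2 + (- 1 / 2))" by (simp only: powr_add)
        then show ?thesis using \<alpha>[OF x] by (simp add: powr_minus)
      qed
      have kk: "(k x \<bullet> \<xi>) *\<^sub>R k x = (inverse (\<alpha> x) * ((G x *v ?e) \<bullet> \<xi>)) *\<^sub>R (G x *v ?e)" for \<xi>
        unfolding k_def sq[symmetric] by (simp add: algebra_simps)
      have "transpose (G' x) $ a $ b = G' x $ a $ b" for a b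
      proof -
        have "G x $ b $ a = G x $ a $ b" by (rule symmetric_entry[OF Gs[OF x]])
        then show ?thesis by (simp add: G'_def outer_def transpose_def mult.commute)
      qed
      then show "transpose (G' x) = G' x" by (simp add: vec_eq_iff)
      show "G' x *v axis j 1 = 0" if "j \<in> insert i J" for j
      proof (cases "j = i")
        case True
        have "inverse (\<alpha> x) * ((G x *v ?e) \<bullet> ?e) = 1" using \<alpha>[OF x] by (simp add: \<alpha>_def inner_commute)
        then show ?thesis by (simp add: True G'm kk)
      next
        case False
        then show ?thesis using that Gn[OF x] by (simp add: G'm kk symG)
      qed
      \<comment> \<open>Completing the square: the form of \<open>G'\<close> at \<open>\<xi>\<close>
        is the form of \<open>G\<close> at \<open>\<eta> \<xi>\<close>. Only coordinate
        \<open>i\<close> changes, so nonnegativity and the description of null vectors pass from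
        \<open>G\<close> to \<open>G'\<close>.\<close>
      define \<eta> where "\<eta> \<xi> = \<xi> - (inverse (\<alpha> x) * ((G x *v ?e) \<bullet> \<xi>)) *\<^sub>R ?e" for \<xi>
      have q: "\<xi> \<bullet> (G' x *v \<xi>) = \<eta> \<xi> \<bullet> (G x *v \<eta> \<xi>)" for \<xi>
      proof -
        define t where "t = (G x *v ?e) \<bullet> \<xi>"
        have t: "\<xi> \<bullet> (G x *v ?e) = t" "?e \<bullet> (G x *v \<xi>) = t"
          using symG[of ?e \<xi>] by (auto simp: t_def inner_commute)
        have "\<eta> \<xi> \<bullet> (G x *v \<eta> \<xi>) = \<xi> \<bullet> (G x *v \<xi>) - 2 * (inverse (\<alpha> x) * t * t) + inverse (\<alpha> x) * t * (inverse (\<alpha> x) * t * \<alpha> x)"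
          unfolding \<eta>_def t_def[symmetric]
          by (simp add: matrix_vector_mult_diff_distrib linear_cmul[OF matrix_vector_mul_linear] inner_diff_left inner_diff_right t \<alpha>_def[symmetric] algebra_simps)
        also have "inverse (\<alpha> x) * t * (inverse (\<alpha> x) * t * \<alpha> x) = inverse (\<alpha> x) * t * t"
          using \<alpha>[OF x] by simp
        finally show ?thesis by (simp add: G'm kk inner_diff_right t t_def[symmetric] algebra_simps)
      qed
      show "0 \<le> \<xi> \<bullet> (G' x *v \<xi>)" for \<xi> unfolding q by (rule Gp[OF x])
      show "\<xi> $ l = 0" if "\<xi> \<bullet> (G' x *v \<xi>) = 0" "l \<notin> insert i J" for \<xi> l
        using Gd[OF x, of "\<eta> \<xi>" l] that by (simp add: q \<eta>_def axis_def)
      have "(\<Sum>j\<in>J. ((h(i := k)) j x \<bullet> \<xi>) *\<^sub>R (h(i := k)) j x) = (\<Sum>j\<in>J. (h j x \<bullet> \<xi>) *\<^sub>R h j x)" for \<xi>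
        using insert.hyps(2) by (intro sum.cong) auto
      then show "H x *v \<xi> = G' x *v \<xi> + (\<Sum>j\<in>insert i J. ((h(i := k)) j x \<bullet> \<xi>) *\<^sub>R (h(i := k)) j x)" for \<xi>
        using insert.hyps Gh[OF x] by (simp add: G'm)
    qed
    have "\<forall>j. C_inf_on S ((h(i := k)) j)" using h k by simp
    moreover have "\<forall>i j. C_inf_on S (\<lambda>x. G' x $ i $ j)" using sm by blast
    ultimately have "partial_cholesky S H (insert i J) (h(i := k)) G'"
      unfolding partial_cholesky_def using ballI[of S, OF pt] by (intro conjI)
    then show ?case by blast
  qed
  from this[of UNIV, OF finite] obtain h G where hG: "partial_cholesky S H UNIV h G" by blast
  note h = partial_choleskyD(1)[OF hG] and Gn = partial_choleskyD(4)[OF hG, OF _ UNIV_I]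
    and Gh = partial_choleskyD(7)[OF hG]
  have "G x *v \<xi> = 0" if "x \<in> S" for x \<xi>
  proof -
    have "G x *v \<xi> \<in> range ((*v) (G x))" by blast
    then show ?thesis unfolding range_matrix_eq_span using Gn[OF that] by simp
  qed
  then have "sum_of_outer S H h" using h Gh by (simp add: sum_of_outer_def)
  then show ?thesis by blast
qed

lemma smooth_square_root:
  fixes A :: "'a::real_normed_vector \<Rightarrow> real^'n^'n"
  assumes "open S" and A: "C_inf_on S A" and rk: "\<And>x. x \<in> S \<Longrightarrow> rank (A x) = rt"
    and sym: "\<And>x. x \<in> S \<Longrightarrow> transpose (A x) = A x"
    and psd: "\<And>x \<xi>. x \<in> S \<Longrightarrow> 0 \<le> \<xi> \<bullet> (A x *v \<xi>)"
  shows "\<exists>g. sum_of_outer S A g"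
proof -
  obtain P where P: "\<And>i j. C_inf_on S (\<lambda>x. P x $ i $ j)" and rp: "\<And>x. x \<in> S \<Longrightarrow> range_projector (A x) (P x)"
    using smooth_range_projector[OF assms(1) A rk] by blast
  have Ps: "transpose (P x) = P x" and PA: "P x *v (A x *v \<xi>) = A x *v \<xi>"
    and rg: "P x *v \<xi> \<in> range ((*v) (A x))" if "x \<in> S" for x \<xi>
    using rp[OF that] by (auto simp: range_projector_def)
  have PP: "P x *v (P x *v \<xi>) = P x *v \<xi>" if "x \<in> S" for x \<xi>
    using rg[OF that, of \<xi>] PA[OF that] by auto
  define H where "H x = A x + mat 1 - P x" for x
  have Hm: "H x *v \<xi> = A x *v \<xi> + (\<xi> - P x *v \<xi>)" for x \<xi>
    by (simp add: H_def matrix_vector_mult_diff_rdistrib matrix_vector_mult_add_rdistrib)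
  have Hs: "C_inf_on S (\<lambda>x. H x $ i $ j)" for i j
  proof -
    have "C_inf_on S (\<lambda>x. A x $ i $ j + mat 1 $ i $ j - P x $ i $ j)"
      by (intro C_inf_on_diff C_inf_on_add C_inf_on_const C_inf_on_entry assms(1) A P)
    then show ?thesis by (simp add: H_def)
  qed
  have Hsym: "transpose (H x) = H x" if "x \<in> S" for x
  proof -
    have "transpose (H x) = transpose (A x) + mat 1 - transpose (P x)"
      by (simp add: H_def transpose_def mat_def vec_eq_iff)
    then show ?thesis using sym[OF that] Ps[OF that] by (simp add: H_def)
  qed
  have Hpd: "0 < \<xi> \<bullet> (H x *v \<xi>)" if x: "x \<in> S" and \<xi>: "\<xi> \<noteq> 0" for x \<xi>
  proof -
    have "\<xi> \<bullet> (\<xi> - P x *v \<xi>) = (\<xi> - P x *v \<xi>) \<bullet> (\<xi> - P x *v \<xi>)"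
      using sym_matrix_inner[OF Ps[OF x], of \<xi> "P x *v \<xi>"] PP[OF x, of \<xi>]
      by (simp add: inner_diff_left inner_diff_right inner_commute)
    then have e: "\<xi> \<bullet> (H x *v \<xi>) = \<xi> \<bullet> (A x *v \<xi>) + (\<xi> - P x *v \<xi>) \<bullet> (\<xi> - P x *v \<xi>)"
      by (simp add: Hm inner_add_right)
    \<comment> \<open>A null vector would lie in the range of \<open>A x\<close>, by the second
      summand, and in its kernel, by the first; for a symmetric matrix these are orthogonal.\<close>
    have "\<xi> \<bullet> (H x *v \<xi>) \<noteq> 0"
    proof
      assume "\<xi> \<bullet> (H x *v \<xi>) = 0"
      then have 1: "\<xi> \<bullet> (A x *v \<xi>) = 0" "(\<xi> - P x *v \<xi>) \<bullet> (\<xi> - P x *v \<xi>) = 0"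
        unfolding e using psd[OF x, of \<xi>] inner_ge_zero[of "\<xi> - P x *v \<xi>"] by linarith+
      then have "P x *v \<xi> = \<xi>" by simp
      then obtain \<eta> where \<eta>: "\<xi> = A x *v \<eta>" using rg[OF x, of \<xi>] by auto
      have "A x *v \<xi> = 0" by (rule psd_null[OF sym[OF x] psd[OF x] 1(1)])
      then have "\<xi> \<bullet> \<xi> = 0" using sym_matrix_inner[OF sym[OF x], of \<xi> \<eta>] \<eta> by simp
      then show False using \<xi> by simp
    qed
    moreover have "0 \<le> \<xi> \<bullet> (H x *v \<xi>)" unfolding e using psd[OF x, of \<xi>] by simp
    ultimately show ?thesis by simp
  qed
  have "\<exists>h. sum_of_outer S H h"
    by (rule smooth_cholesky[OF assms(1) Hs]) (rule Hsym Hpd, assumption+)+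
  then obtain h where hH: "sum_of_outer S H h" by blast
  have h: "C_inf_on S (h j)" for j using hH by (simp add: sum_of_outer_def)
  have Hh: "H x *v \<xi> = (\<Sum>j\<in>UNIV. (h j x \<bullet> \<xi>) *\<^sub>R h j x)" if "x \<in> S" for x \<xi>
    using hH that by (simp add: sum_of_outer_def)
  define g where "g j x = P x *v h j x" for j x
  have "C_inf_on S (g j)" for j unfolding g_def
    by (intro C_inf_on_matrix_vector_mult assms(1) P h)
  moreover have "A x *v \<xi> = (\<Sum>j\<in>UNIV. (g j x \<bullet> \<xi>) *\<^sub>R g j x)" if x: "x \<in> S" for x \<xi>
  proof -
    \<comment> \<open>\<open>A P = A\<close> is the transpose of \<open>P A = A\<close>. With
      \<open>P (1 - P) = 0\<close> it makes the compression of \<open>H\<close> by \<open>P\<close>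
      equal to \<open>A\<close>.\<close>
    have "(A x *v (P x *v \<xi>)) \<bullet> \<eta> = (A x *v \<xi>) \<bullet> \<eta>" for \<eta>
      by (simp only: sym_matrix_inner[OF sym[OF x]] sym_matrix_inner[OF Ps[OF x]] PA[OF x])
    then have "A x *v (P x *v \<xi>) = A x *v \<xi>" using vector_eq_rdot by blast
    then have "A x *v \<xi> = P x *v (H x *v (P x *v \<xi>))" using PP[OF x] PA[OF x] by (simp add: Hm)
    also have "\<dots> = (\<Sum>j\<in>UNIV. (g j x \<bullet> \<xi>) *\<^sub>R g j x)"
      by (simp add: Hh[OF x] g_def linear_sum[OF matrix_vector_mul_linear] linear_cmul[OF matrix_vector_mul_linear]
          sym_matrix_inner[OF Ps[OF x]])
    finally show ?thesis .
  qed
  ultimately have "sum_of_outer S A g" by (simp add: sum_of_outer_def)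
  then show ?thesis by blast
qed

lemma sum_of_outer_entry:
  assumes "sum_of_outer S A g" "x \<in> S"
  shows "A x $ i $ l = (\<Sum>j\<in>UNIV. g j x $ i * g j x $ l)"
proof -
  have "(A x *v axis l 1) $ i = (\<Sum>j\<in>UNIV. (g j x \<bullet> axis l 1) *\<^sub>R g j x) $ i"
    using assms by (simp add: sum_of_outer_def)
  then show ?thesis by (simp add: matrix_vector_mult_basis column_def inner_axis mult.commute)
qed

section \<open>Quasilinear operators in a frame\<close>

lemma vf_apply_sum_scaleR:
  assumes "C_inf_on S f" "x \<in> S"
  shows "vf_apply (\<lambda>x. \<Sum>i\<in>I. c i x *\<^sub>R e i x) f x = (\<Sum>i\<in>I. c i x * vf_apply (e i) f x)"
  using has_derivative_linear[OF C_inf_on_has_derivative[OF assms]]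
  by (simp add: vf_apply_def linear_sum linear_cmul)

text \<open>With \<open>T j\<close> the combination of the frame with coefficients
  \<open>g j\<close>, the squares of the \<open>T j\<close> reproduce the second order part, the
  order of the frame derivatives being kept. What remains are derivatives of the coefficients along
  \<open>T j\<close>, first order terms that \<open>Y\<close> cancels. \<open>\<beta>\<close> only
  numbers the index type.\<close>

lemma frame_sum_of_squares:
  fixes e :: "'n \<Rightarrow> real^'n \<Rightarrow> real^'n"
  assumes "open \<Omega>" and e: "\<And>i. C_inf_on \<Omega> (e i)" and A: "C_inf_on \<Omega> A"
    and rk: "\<And>x. x \<in> \<Omega> \<Longrightarrow> rank (A x) = rt"
    and sym: "\<And>x. x \<in> \<Omega> \<Longrightarrow> transpose (A x) = A x"
    and psd: "\<And>x \<xi>. x \<in> \<Omega> \<Longrightarrow> 0 \<le> \<xi> \<bullet> (A x *v \<xi>)"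
  shows "\<exists>r X Y. sum_of_squares_decomp \<Omega> (frame_second_order e A) r X Y"
proof -
  obtain g where gA: "sum_of_outer \<Omega> A g" using smooth_square_root[OF assms(1) A rk sym psd] by blast
  have g: "C_inf_on \<Omega> (g j)" for j using gA by (simp add: sum_of_outer_def)
  have gi: "C_inf_on \<Omega> (\<lambda>x. g j x $ i)" for i j by (intro C_inf_on_vec_nth assms(1) g)
  obtain \<beta> where \<beta>: "bij_betw \<beta> {1..CARD('n)} (UNIV :: 'n set)"
    using ex_bij_betw_nat_finite_1[OF finite] by blast
  define T where "T j x = (\<Sum>i\<in>UNIV. g j x $ i *\<^sub>R e i x)" for j x
  have T: "C_inf_on \<Omega> (T j)" for j unfolding T_def
    by (intro C_inf_on_sum C_inf_on_scaleR assms(1) gi e)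
  have Tf: "vf_apply (T j) f x = (\<Sum>i\<in>UNIV. g j x $ i * vf_apply (e i) f x)"
    if "C_inf_on \<Omega> f" "x \<in> \<Omega>" for j f x
    unfolding T_def by (rule vf_apply_sum_scaleR[OF that])
  define y where "y i x = - (\<Sum>j\<in>UNIV. vf_apply (T j) (\<lambda>x. g j x $ i) x)" for i x
  define Y where "Y x = (\<Sum>i\<in>UNIV. y i x *\<^sub>R e i x)" for x
  have y: "C_inf_on \<Omega> (y i)" for i unfolding y_def
    by (intro C_inf_on_minus C_inf_on_sum C_inf_on_vf_apply assms(1) T gi)
  have Y: "C_inf_on \<Omega> Y" unfolding Y_def
    by (intro C_inf_on_sum C_inf_on_scaleR assms(1) y e)
  have "frame_second_order e A f x =
      (\<Sum>k=1..CARD('n). vf_apply (T (\<beta> k)) (vf_apply (T (\<beta> k)) f) x) + vf_apply Y f x"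
    if f: "C_inf_on \<Omega> f" and x: "x \<in> \<Omega>" for f x
  proof -
    have ef: "C_inf_on \<Omega> (vf_apply (e i) f)" for i using assms(1) f e by (rule C_inf_on_vf_apply)
    let ?E = "\<lambda>l i. vf_apply (e l) (vf_apply (e i) f) x"
    have TT: "vf_apply (T j) (vf_apply (T j) f) x =
        (\<Sum>i\<in>UNIV. \<Sum>l\<in>UNIV. g j x $ l * g j x $ i * ?E l i)
        + (\<Sum>i\<in>UNIV. vf_apply (T j) (\<lambda>x. g j x $ i) x * vf_apply (e i) f x)" for j
    proof -
      have "vf_apply (T j) (vf_apply (T j) f) x = vf_apply (T j) (\<lambda>x. \<Sum>i\<in>UNIV. g j x $ i * vf_apply (e i) f x) x"
        by (rule vf_apply_cong_open[OF assms(1) x]) (rule Tf[OF f])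
      also have "\<dots> = (\<Sum>i\<in>UNIV. g j x $ i * vf_apply (T j) (vf_apply (e i) f) x
          + vf_apply (T j) (\<lambda>x. g j x $ i) x * vf_apply (e i) f x)"
        by (subst vf_apply_eqI[OF has_derivative_sum[OF has_derivative_mult[OF
              C_inf_on_has_derivative[OF gi x] C_inf_on_has_derivative[OF ef x]]]])
          (simp add: vf_apply_def)
      also have "\<dots> = (\<Sum>i\<in>UNIV. (\<Sum>l\<in>UNIV. g j x $ l * g j x $ i * ?E l i)
          + vf_apply (T j) (\<lambda>x. g j x $ i) x * vf_apply (e i) f x)"
        by (simp add: Tf[OF ef x] sum_distrib_left algebra_simps)
      finally show ?thesis by (simp add: sum.distrib)
    qed
    have "(\<Sum>k=1..CARD('n). vf_apply (T (\<beta> k)) (vf_apply (T (\<beta> k)) f) x)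
        = (\<Sum>j\<in>UNIV. vf_apply (T j) (vf_apply (T j) f) x)"
      by (rule sum.reindex_bij_betw[OF \<beta>])
    also have "\<dots> = (\<Sum>j\<in>UNIV. \<Sum>i\<in>UNIV. \<Sum>l\<in>UNIV. g j x $ l * g j x $ i * ?E l i)
        + (\<Sum>j\<in>UNIV. \<Sum>i\<in>UNIV. vf_apply (T j) (\<lambda>x. g j x $ i) x * vf_apply (e i) f x)"
      by (simp add: TT sum.distrib)
    also have "(\<Sum>j\<in>UNIV. \<Sum>i\<in>UNIV. \<Sum>l\<in>UNIV. g j x $ l * g j x $ i * ?E l i)
        = (\<Sum>i\<in>UNIV. \<Sum>l\<in>UNIV. \<Sum>j\<in>UNIV. g j x $ l * g j x $ i * ?E l i)"
      by (subst sum.swap, rule sum.cong[OF refl], subst sum.swap) (rule refl)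
    also have "\<dots> = (\<Sum>i\<in>UNIV. \<Sum>l\<in>UNIV. A x $ l $ i * ?E l i)"
      by (simp add: sum_of_outer_entry[OF gA x] sum_distrib_right)
    also have "\<dots> = frame_second_order e A f x" unfolding frame_second_order_def by (rule sum.swap)
    also have "(\<Sum>j\<in>UNIV. \<Sum>i\<in>UNIV. vf_apply (T j) (\<lambda>x. g j x $ i) x * vf_apply (e i) f x)
        = - vf_apply Y f x"
      unfolding Y_def vf_apply_sum_scaleR[OF f x]
      by (subst sum.swap) (simp add: y_def sum_distrib_right sum_negf)
    finally show ?thesis by simp
  qed
  then have "sum_of_squares_decomp \<Omega> (frame_second_order e A) (CARD('n)) (\<lambda>k. T (\<beta> k)) Y"
    using T Y by (simp add: sum_of_squares_decomp_def)
  then show ?thesis by blast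
qed

section \<open>Linearisation of the quasilinear inequality\<close>

lemma C_inf_on_frame_grad:
  assumes "open \<Omega>" "\<And>i. C_inf_on \<Omega> (e i)" "C_inf_on \<Omega> f"
  shows "C_inf_on \<Omega> (frame_grad e f)"
proof (rule C_inf_on_vecI[OF assms(1)])
  show "C_inf_on \<Omega> (\<lambda>x. frame_grad e f x $ i)" for i
    using C_inf_on_vf_apply[OF assms(1,3,2)] by (simp add: frame_grad_def)
qed

lemma C_inf_on_coefficient:
  fixes a :: "real^'n \<Rightarrow> real^'n \<Rightarrow> real^'n^'n"
  assumes "open \<Omega>" "C_inf_on (\<Omega> \<times> UNIV) (\<lambda>(x, p). a x p)" "C_inf_on \<Omega> p"
  shows "C_inf_on \<Omega> (\<lambda>x. a x (p x))"
proof -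
  have "C_inf_on \<Omega> (\<lambda>x. (\<lambda>(x, p). a x p) (x, p x))"
    by (rule C_inf_on_compose[where g = "\<lambda>x. (x, p x)", OF assms(1) open_Times[OF assms(1) open_UNIV] assms(2)
          C_inf_on_Pair[OF assms(1) C_inf_on_ident[OF assms(1)] assms(3)]]) auto
  then show ?thesis by simp
qed

lemma vf_apply_diff_const:
  assumes "C_inf_on S f" "C_inf_on S g" "x \<in> S"
  shows "vf_apply X (\<lambda>x. f x - g x - M) x = vf_apply X f x - vf_apply X g x"
  using vf_apply_eqI[OF has_derivative_diff[OF has_derivative_diff[OF C_inf_on_has_derivative[OF assms(1,3)]
        C_inf_on_has_derivative[OF assms(2,3)]] has_derivative_const], of X]
  by (simp add: vf_apply_def)

lemma frame_second_order_diff_const: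
  assumes "open S" "\<And>i. C_inf_on S (e i)" "C_inf_on S f" "C_inf_on S g" "x \<in> S"
  shows "frame_second_order e A (\<lambda>x. f x - g x - M) x = frame_second_order e A f x - frame_second_order e A g x"
proof -
  have "vf_apply (e i) (vf_apply (e j) (\<lambda>x. f x - g x - M)) x =
      vf_apply (e i) (vf_apply (e j) f) x - vf_apply (e i) (vf_apply (e j) g) x" for i j
  proof -
    have "vf_apply (e i) (vf_apply (e j) (\<lambda>x. f x - g x - M)) x
        = vf_apply (e i) (\<lambda>x. vf_apply (e j) f x - vf_apply (e j) g x - 0) x"
      by (rule vf_apply_cong_open[OF assms(1,5)]) (simp add: vf_apply_diff_const[OF assms(3,4)])
    also have "\<dots> = vf_apply (e i) (vf_apply (e j) f) x - vf_apply (e i) (vf_apply (e j) g) x"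
      by (rule vf_apply_diff_const[OF C_inf_on_vf_apply[OF assms(1,3,2)] C_inf_on_vf_apply[OF assms(1,4,2)] assms(5)])
    finally show ?thesis .
  qed
  then show ?thesis by (simp add: frame_second_order_def right_diff_distrib sum_subtractf)
qed

text \<open>The total function \<open>deriv\<close> carries information only where a derivative
  exists; smoothness of \<open>b\<close>, restricted to a line in the \<open>z\<close> direction,
  provides it.\<close>

lemma antitone_zeroth_order:
  fixes b :: "real^'n \<Rightarrow> real \<Rightarrow> real^'n \<Rightarrow> real"
  assumes "C_inf_on (\<Omega> \<times> UNIV \<times> UNIV) (\<lambda>(x, z, p). b x z p)" "x \<in> \<Omega>"
    and "\<And>z. deriv (\<lambda>s. b x s p) z \<le> 0" and "z \<le> z'"
  shows "b x z' p \<le> b x z p"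
proof (rule DERIV_nonpos_imp_nonincreasing[OF assms(4), of "\<lambda>s. b x s p"])
  fix s
  have "((\<lambda>(x, z, p). b x z p) has_derivative frechet_derivative (\<lambda>(x, z, p). b x z p) (at (x, s, p))) (at (x, s, p))"
    using C_inf_on_has_derivative[OF assms(1)] assms(2) by auto
  moreover have "((\<lambda>s. (x, s, p)) has_derivative (\<lambda>h. (0, h, 0))) (at s)"
    by (auto intro!: derivative_eq_intros)
  ultimately have "(\<lambda>s. b x s p) differentiable (at s)"
    using diff_chain_at[of "\<lambda>s. (x, s, p)" _ s "\<lambda>(x, z, p). b x z p"] unfolding differentiable_def
    by (fastforce simp: o_def)
  then obtain D where D: "((\<lambda>s. b x s p) has_real_derivative D) (at s)"
    unfolding real_differentiable_def by blast
  then show "\<exists>y. ((\<lambda>s. b x s p) has_real_derivative y) (at s) \<and> y \<le> 0"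
    using assms(3)[of s] DERIV_imp_deriv by metis
qed

lemma norm_frame_grad_le:
  assumes "C_inf_on S v" "x \<in> S"
  shows "norm (frame_grad e v x) \<le> (\<Sum>i\<in>UNIV. norm (e i x)) * onorm (frechet_derivative v (at x))"
proof -
  have bl: "bounded_linear (frechet_derivative v (at x))"
    using has_derivative_bounded_linear[OF C_inf_on_has_derivative[OF assms]] .
  have "norm (frame_grad e v x) \<le> (\<Sum>i\<in>UNIV. \<bar>frame_grad e v x $ i\<bar>)" by (rule norm_le_l1_cart)
  also have "\<dots> \<le> (\<Sum>i\<in>UNIV. norm (e i x) * onorm (frechet_derivative v (at x)))"
    by (intro sum_mono) (use onorm[OF bl] in \<open>simp add: frame_grad_def vf_apply_def mult.commute\<close>)
  finally show ?thesis by (simp add: sum_distrib_right)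
qed

text \<open>The zeroth order coefficient of the linearisation is only bounded and nonpositive; since
  \<open>0 \<le> M\<close> this suffices to absorb it into \<open>C |v|\<close>, also when \<open>M = 0\<close>.\<close>

lemma linearised_inequality:
  fixes e :: "'n \<Rightarrow> real^'n \<Rightarrow> real^'n"
  assumes "open \<Omega>" and e: "\<And>i. C_inf_on \<Omega> (e i)"
    and a: "C_inf_on (\<Omega> \<times> UNIV) (\<lambda>(x, p). a x p)"
    and b: "C_inf_on (\<Omega> \<times> UNIV \<times> UNIV) (\<lambda>(x, z, p). b x z p)"
    and bz: "\<And>x z p. x \<in> \<Omega> \<Longrightarrow> deriv (\<lambda>s. b x s p) z \<le> 0"
    and \<phi>: "C_inf_on \<Omega> \<phi>" and \<psi>: "C_inf_on \<Omega> \<psi>"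
    and Q: "\<And>x. x \<in> \<Omega> \<Longrightarrow> frame_quasilinear_op e a b \<psi> x \<le> frame_quasilinear_op e a b \<phi> x"
    and M: "0 \<le> M" and v0: "\<And>x. x \<in> \<Omega> \<Longrightarrow> \<phi> x - \<psi> x - M \<le> 0" and y: "y \<in> \<Omega>"
  shows "\<exists>\<rho> K C. 0 < \<rho> \<and> 0 \<le> K \<and> 0 \<le> C \<and> cball y \<rho> \<subseteq> \<Omega> \<and> (\<forall>x\<in>cball y \<rho>.
      0 \<le> frame_second_order e (\<lambda>x. a x (frame_grad e \<phi> x)) (\<lambda>x. \<phi> x - \<psi> x - M) x
        + K * onorm (frechet_derivative (\<lambda>x. \<phi> x - \<psi> x - M) (at x)) + C * \<bar>\<phi> x - \<psi> x - M\<bar>)"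
proof -
  let ?p = "frame_grad e \<phi>" and ?q = "frame_grad e \<psi>" and ?v = "\<lambda>x. \<phi> x - \<psi> x - M"
  obtain \<rho> where \<rho>: "0 < \<rho>" "cball y \<rho> \<subseteq> \<Omega>" using assms(1) y open_contains_cball by blast
  let ?D = "cball y \<rho>"
  have bdd: "\<exists>R>0. \<forall>x\<in>?D. norm (f x) \<le> R" if "continuous_on \<Omega> f" for f :: "real^'n \<Rightarrow> 'b::real_normed_vector"
  proof -
    have "bounded (f ` ?D)"
      using that \<rho>(2) compact_cball compact_continuous_image compact_imp_bounded continuous_on_subset by metis
    then show ?thesis unfolding bounded_pos by auto
  qed
  have p: "C_inf_on \<Omega> ?p" and q: "C_inf_on \<Omega> ?q" using C_inf_on_frame_grad[OF assms(1) e] \<phi> \<psi> by auto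
  have v: "C_inf_on \<Omega> ?v" by (intro C_inf_on_diff C_inf_on_const assms(1) \<phi> \<psi>)
  obtain R1 R2 R3 R4 where Rs: "0 < R1" "\<And>x. x \<in> ?D \<Longrightarrow> norm (?p x) \<le> R1" "0 < R2" "\<And>x. x \<in> ?D \<Longrightarrow> norm (?q x) \<le> R2"
    "0 < R3" "\<And>x. x \<in> ?D \<Longrightarrow> norm (\<phi> x) \<le> R3" "0 < R4" "\<And>x. x \<in> ?D \<Longrightarrow> norm (\<psi> x) \<le> R4"
    using bdd[OF C_inf_on_continuous[OF p]] bdd[OF C_inf_on_continuous[OF q]]
      bdd[OF C_inf_on_continuous[OF \<phi>]] bdd[OF C_inf_on_continuous[OF \<psi>]] by metis
  \<comment> \<open>One radius for both functions and both gradients, so that all arguments lie in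
    convex compact products on which \<open>a\<close> and \<open>b\<close> are Lipschitz.\<close>
  define R where "R = R1 + R2 + R3 + R4"
  have pR: "?p x \<in> cball 0 R" "?q x \<in> cball 0 R" "\<phi> x \<in> cball 0 R" "\<psi> x \<in> cball 0 R" if "x \<in> ?D" for x
    using Rs(1,3,5,7) Rs(2,4,6,8)[OF that] by (auto simp: R_def dist_norm)
  obtain La where La: "0 \<le> La" "\<And>x y. x \<in> ?D \<times> cball 0 R \<Longrightarrow> y \<in> ?D \<times> cball 0 R \<Longrightarrow>
      norm ((\<lambda>(x, p). a x p) x - (\<lambda>(x, p). a x p) y) \<le> La * norm (x - y)"
  proof (rule C_inf_on_locally_lipschitz[OF a, of "?D \<times> cball 0 R"])
    show "?D \<times> cball 0 R \<subseteq> \<Omega> \<times> UNIV" using \<rho>(2) by auto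
  qed (simp_all add: compact_Times convex_Times)
  obtain Lb where Lb: "0 \<le> Lb" "\<And>x y. x \<in> ?D \<times> cball 0 R \<times> cball 0 R \<Longrightarrow> y \<in> ?D \<times> cball 0 R \<times> cball 0 R \<Longrightarrow>
      norm ((\<lambda>(x, z, p). b x z p) x - (\<lambda>(x, z, p). b x z p) y) \<le> Lb * norm (x - y)"
  proof (rule C_inf_on_locally_lipschitz[OF b, of "?D \<times> cball 0 R \<times> cball 0 R"])
    show "?D \<times> cball 0 R \<times> cball 0 R \<subseteq> \<Omega> \<times> UNIV \<times> UNIV" using \<rho>(2) by auto
  qed (simp_all add: compact_Times convex_Times)
  let ?S = "\<lambda>x. \<Sum>i\<in>UNIV. \<Sum>j\<in>UNIV. norm (vf_apply (e i) (vf_apply (e j) \<psi>) x)"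
  have "continuous_on \<Omega> ?S"
    by (intro continuous_on_sum continuous_on_norm C_inf_on_continuous C_inf_on_vf_apply assms(1) e \<psi>)
  from bdd[OF this] obtain N where N: "0 < N" "\<And>x. x \<in> ?D \<Longrightarrow> ?S x \<le> N" by (auto simp: abs_le_iff)
  have "continuous_on \<Omega> (\<lambda>x. \<Sum>i\<in>UNIV. norm (e i x))"
    by (intro continuous_on_sum continuous_on_norm C_inf_on_continuous e)
  from bdd[OF this] obtain E where E: "0 < E" "\<And>x. x \<in> ?D \<Longrightarrow> (\<Sum>i\<in>UNIV. norm (e i x)) \<le> E" by (auto simp: abs_le_iff)
  define K where "K = (La * N + Lb) * E"
  have "0 \<le> frame_second_order e (\<lambda>x. a x (?p x)) ?v x + K * onorm (frechet_derivative ?v (at x)) + Lb * \<bar>?v x\<bar>"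
    if x: "x \<in> ?D" for x
  proof -
    have x\<Omega>: "x \<in> \<Omega>" using x \<rho> by blast
    define \<delta> where "\<delta> = norm (?p x - ?q x)"
    have "?p x - ?q x = frame_grad e ?v x"
      by (simp add: frame_grad_def vec_eq_iff vf_apply_diff_const[OF \<phi> \<psi> x\<Omega>])
    then have "\<delta> \<le> (\<Sum>i\<in>UNIV. norm (e i x)) * onorm (frechet_derivative ?v (at x))"
      using norm_frame_grad_le[OF v x\<Omega>, of e] by (simp add: \<delta>_def)
    also have "\<dots> \<le> E * onorm (frechet_derivative ?v (at x))"
      by (intro mult_right_mono E(2) x onorm_pos_le has_derivative_bounded_linear[OF C_inf_on_has_derivative[OF v x\<Omega>]])
    finally have \<delta>E: "\<delta> \<le> E * onorm (frechet_derivative ?v (at x))" .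
    have \<delta>0: "0 \<le> \<delta>" by (simp add: \<delta>_def)
    have aL: "norm (a x (?p x) - a x (?q x)) \<le> La * \<delta>"
      using La(2)[of "(x, ?p x)" "(x, ?q x)"] x pR[OF x] by (simp add: \<delta>_def norm_Pair)
    have ent: "\<bar>(a x (?p x) - a x (?q x)) $ i $ j\<bar> \<le> La * \<delta>" for i j
      using order_trans[OF component_le_norm_cart order_trans[OF Finite_Cartesian_Product.norm_nth_le aL]] .
    \<comment> \<open>The change of coefficients is applied to \<open>\<psi>\<close>, whose second
      derivatives along the frame are bounded by \<open>N\<close> on the ball; it is therefore
      controlled by the difference of the gradients.\<close>
    have "frame_second_order e (\<lambda>x. a x (?p x)) \<psi> x - frame_second_order e (\<lambda>x. a x (?q x)) \<psi> x
        = (\<Sum>i\<in>UNIV. \<Sum>j\<in>UNIV. (a x (?p x) - a x (?q x)) $ i $ j * vf_apply (e i) (vf_apply (e j) \<psi>) x)"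
      by (simp add: frame_second_order_def left_diff_distrib sum_subtractf)
    also have "\<dots> \<le> (\<Sum>i\<in>UNIV. \<Sum>j\<in>UNIV. La * \<delta> * norm (vf_apply (e i) (vf_apply (e j) \<psi>) x))"
    proof (intro sum_mono)
      fix i j
      let ?w = "vf_apply (e i) (vf_apply (e j) \<psi>) x"
      have "(a x (?p x) - a x (?q x)) $ i $ j * ?w \<le> \<bar>(a x (?p x) - a x (?q x)) $ i $ j * ?w\<bar>"
        by (rule abs_ge_self)
      also have "\<dots> = \<bar>(a x (?p x) - a x (?q x)) $ i $ j\<bar> * \<bar>?w\<bar>" by (rule abs_mult)
      also have "\<dots> \<le> La * \<delta> * \<bar>?w\<bar>" by (rule mult_right_mono[OF ent abs_ge_zero])
      finally show "(a x (?p x) - a x (?q x)) $ i $ j * ?w \<le> La * \<delta> * norm ?w" by (simp only: real_norm_def)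
    qed
    also have "\<dots> = La * \<delta> * ?S x" by (simp add: sum_distrib_left)
    also have "\<dots> \<le> La * \<delta> * N" using La(1) \<delta>0 N(2)[OF x] by (intro mult_left_mono) auto
    finally have 1: "frame_second_order e (\<lambda>x. a x (?p x)) \<psi> x - frame_second_order e (\<lambda>x. a x (?q x)) \<psi> x \<le> La * \<delta> * N" .
    have 2: "b x (\<phi> x) (?p x) - b x (\<phi> x) (?q x) \<le> Lb * \<delta>"
      using Lb(2)[of "(x, \<phi> x, ?p x)" "(x, \<phi> x, ?q x)"] x pR[OF x] by (simp add: \<delta>_def norm_Pair abs_le_iff)
    \<comment> \<open>If \<open>\<psi> x \<le> \<phi> x\<close>, monotonicity makes the left side
      nonpositive. Otherwise \<open>\<phi> x - \<psi> x\<close> is negative, and subtracting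
      \<open>M\<close> only enlarges its absolute value.\<close>
    have 3: "b x (\<phi> x) (?q x) - b x (\<psi> x) (?q x) \<le> Lb * \<bar>?v x\<bar>"
    proof (cases "\<psi> x \<le> \<phi> x")
      case True
      then have "b x (\<phi> x) (?q x) \<le> b x (\<psi> x) (?q x)" by (rule antitone_zeroth_order[OF b x\<Omega> bz[OF x\<Omega>]])
      moreover have "0 \<le> Lb * \<bar>?v x\<bar>" using Lb(1) by simp
      ultimately show ?thesis by linarith
    next
      case False
      have "b x (\<phi> x) (?q x) - b x (\<psi> x) (?q x) \<le> Lb * \<bar>\<phi> x - \<psi> x\<bar>"
        using Lb(2)[of "(x, \<phi> x, ?q x)" "(x, \<psi> x, ?q x)"] x pR[OF x] by (simp add: norm_Pair abs_le_iff)
      also have "\<dots> \<le> Lb * \<bar>?v x\<bar>" using False M v0[OF x\<Omega>] Lb(1) by (intro mult_left_mono) auto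
      finally show ?thesis .
    qed
    have "frame_second_order e (\<lambda>x. a x (?q x)) \<psi> x + b x (\<psi> x) (?q x)
        \<le> frame_second_order e (\<lambda>x. a x (?p x)) \<phi> x + b x (\<phi> x) (?p x)"
      using Q[OF x\<Omega>] by (simp add: frame_quasilinear_op_def)
    moreover have "frame_second_order e (\<lambda>x. a x (?p x)) ?v x
        = frame_second_order e (\<lambda>x. a x (?p x)) \<phi> x - frame_second_order e (\<lambda>x. a x (?p x)) \<psi> x"
      by (rule frame_second_order_diff_const[OF assms(1) e \<phi> \<psi> x\<Omega>])
    ultimately have "0 \<le> frame_second_order e (\<lambda>x. a x (?p x)) ?v x + (La * N + Lb) * \<delta> + Lb * \<bar>?v x\<bar>"
      using 1 2 3 by (simp add: algebra_simps)
    moreover have "(La * N + Lb) * \<delta> \<le> K * onorm (frechet_derivative ?v (at x))"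
      using mult_left_mono[OF \<delta>E, of "La * N + Lb"] La(1) Lb(1) N(1) by (simp add: K_def mult.assoc)
    ultimately show ?thesis by linarith
  qed
  moreover have "0 \<le> K" using La(1) Lb(1) N(1) E(1) by (simp add: K_def)
  ultimately show ?thesis using \<rho> Lb(1) by blast
qed

text \<open>Any given decomposition will do: it is applied to the single function
  \<open>\<phi> - \<psi> - M\<close>, which turns the linearised inequality into one for squares of
  fields.\<close>

lemma frame_max_propagates:
  fixes e :: "'n \<Rightarrow> real^'n \<Rightarrow> real^'n"
  assumes "open \<Omega>" and e: "\<And>i. C_inf_on \<Omega> (e i)"
    and a: "C_inf_on (\<Omega> \<times> UNIV) (\<lambda>(x, p). a x p)"
    and b: "C_inf_on (\<Omega> \<times> UNIV \<times> UNIV) (\<lambda>(x, z, p). b x z p)"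
    and bz: "\<And>x z p. x \<in> \<Omega> \<Longrightarrow> deriv (\<lambda>s. b x s p) z \<le> 0"
    and \<phi>: "C_inf_on \<Omega> \<phi>" and \<psi>: "C_inf_on \<Omega> \<psi>"
    and Q: "\<And>x. x \<in> \<Omega> \<Longrightarrow> frame_quasilinear_op e a b \<psi> x \<le> frame_quasilinear_op e a b \<phi> x"
    and sos: "sum_of_squares_decomp \<Omega> (frame_second_order e (\<lambda>x. a x (frame_grad e \<phi> x))) r X Y"
    and Z: "Z \<in> lie_module \<Omega> r X" and \<gamma>: "integral_curve \<Omega> Z \<gamma> I"
  shows "max_propagates_along \<Omega> (\<lambda>x. \<phi> x - \<psi> x) (\<gamma> ` I)"
  unfolding max_propagates_along_def
proof (intro impI ballI)
  let ?u = "\<lambda>x. \<phi> x - \<psi> x"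
  assume "\<exists>q\<in>\<gamma> ` I. is_arg_max ?u (\<lambda>x. x \<in> \<Omega>) q \<and> 0 \<le> ?u q"
  then obtain t0 where t0: "t0 \<in> I" and max: "is_arg_max ?u (\<lambda>x. x \<in> \<Omega>) (\<gamma> t0)" and M: "0 \<le> ?u (\<gamma> t0)"
    by blast
  define M where "M = ?u (\<gamma> t0)"
  have v0: "?u x - M \<le> 0" if "x \<in> \<Omega>" for x
    using max that by (auto simp: is_arg_max_def M_def not_less)
  have v: "C_inf_on \<Omega> (\<lambda>x. \<phi> x - \<psi> x - M)" by (intro C_inf_on_diff C_inf_on_const assms(1) \<phi> \<psi>)
  have X: "\<And>k. k \<in> {1..r} \<Longrightarrow> C_inf_on \<Omega> (X k)" and Y: "C_inf_on \<Omega> Y"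
    and eq: "\<And>x. x \<in> \<Omega> \<Longrightarrow> sos_op r X Y (\<lambda>x. \<phi> x - \<psi> x - M) x
      = frame_second_order e (\<lambda>x. a x (frame_grad e \<phi> x)) (\<lambda>x. \<phi> x - \<psi> x - M) x"
    using sos v by (auto simp: sum_of_squares_decomp_def sos_op_def)
  have ineq: "\<exists>\<rho> K C. 0 < \<rho> \<and> 0 \<le> K \<and> 0 \<le> C \<and> cball y \<rho> \<subseteq> \<Omega> \<and> (\<forall>x\<in>cball y \<rho>.
      0 \<le> sos_op r X Y (\<lambda>x. \<phi> x - \<psi> x - M) x
        + K * onorm (frechet_derivative (\<lambda>x. \<phi> x - \<psi> x - M) (at x)) + C * \<bar>\<phi> x - \<psi> x - M\<bar>)"
    if y: "y \<in> \<Omega>" for y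
  proof -
    have "\<exists>\<rho> K C. 0 < \<rho> \<and> 0 \<le> K \<and> 0 \<le> C \<and> cball y \<rho> \<subseteq> \<Omega> \<and> (\<forall>x\<in>cball y \<rho>.
      0 \<le> frame_second_order e (\<lambda>x. a x (frame_grad e \<phi> x)) (\<lambda>x. \<phi> x - \<psi> x - M) x
        + K * onorm (frechet_derivative (\<lambda>x. \<phi> x - \<psi> x - M) (at x)) + C * \<bar>\<phi> x - \<psi> x - M\<bar>)"
      by (rule linearised_inequality[OF assms(1) e a b bz \<phi> \<psi> Q M[folded M_def] v0 y])
    then obtain \<rho> K C where *: "0 < \<rho>" "0 \<le> K" "0 \<le> C" "cball y \<rho> \<subseteq> \<Omega>" "\<forall>x\<in>cball y \<rho>.
      0 \<le> frame_second_order e (\<lambda>x. a x (frame_grad e \<phi> x)) (\<lambda>x. \<phi> x - \<psi> x - M) x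
        + K * onorm (frechet_derivative (\<lambda>x. \<phi> x - \<psi> x - M) (at x)) + C * \<bar>\<phi> x - \<psi> x - M\<bar>"
      by (elim exE conjE)
    show ?thesis
      by (rule exI[of _ \<rho>], rule exI[of _ K], rule exI[of _ C]) (use * eq in auto)
  qed
  have vt0: "\<phi> (\<gamma> t0) - \<psi> (\<gamma> t0) - M = 0" by (simp add: M_def)
  fix y assume "y \<in> \<gamma> ` I"
  then obtain t where t: "t \<in> I" "y = \<gamma> t" by blast
  have "\<phi> (\<gamma> t) - \<psi> (\<gamma> t) - M = 0"
    using max_propagation[OF assms(1) X Y v v0 ineq Z \<gamma> t0 vt0 t(1)] by simp
  moreover have "y \<in> \<Omega>" using \<gamma> t by (auto simp: integral_curve_def)
  ultimately show "is_arg_max ?u (\<lambda>x. x \<in> \<Omega>) y"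
    using v0 t by (auto simp: is_arg_max_def not_less)
qed

section \<open>The comparison principle in a frame and its Euclidean case\<close>

lemma frame_comparison:
  fixes e :: "'n \<Rightarrow> real^'n \<Rightarrow> real^'n"
  assumes "open \<Omega>"
    and a: "C_inf_on (\<Omega> \<times> UNIV) (\<lambda>(x, p). a x p)"
    and b: "C_inf_on (\<Omega> \<times> UNIV \<times> UNIV) (\<lambda>(x, z, p). b x z p)"
    and psd: "\<And>x p \<xi>. x \<in> \<Omega> \<Longrightarrow> 0 \<le> \<xi> \<bullet> (a x p *v \<xi>)"
    and sym: "\<And>x p i j. x \<in> \<Omega> \<Longrightarrow> a x p $ i $ j = a x p $ j $ i"
    and bz: "\<And>x z p. x \<in> \<Omega> \<Longrightarrow> deriv (\<lambda>s. b x s p) z \<le> 0"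
    and e: "\<And>i. C_inf_on \<Omega> (e i)" and \<phi>: "C_inf_on \<Omega> \<phi>" and \<psi>: "C_inf_on \<Omega> \<psi>"
    and Q: "\<forall>x\<in>\<Omega>. frame_quasilinear_op e a b \<phi> x \<ge> frame_quasilinear_op e a b \<psi> x"
    and rk: "\<forall>x\<in>\<Omega>. rank (a x (frame_grad e \<phi> x)) = rt"
  shows "(\<exists>r X Y. sum_of_squares_decomp \<Omega> (frame_second_order e (\<lambda>x. a x (frame_grad e \<phi> x))) r X Y) \<and>
    (\<forall>r X Y Z \<gamma> I.
       sum_of_squares_decomp \<Omega> (frame_second_order e (\<lambda>x. a x (frame_grad e \<phi> x))) r X Y \<and>
       Z \<in> lie_module \<Omega> r X \<and> integral_curve \<Omega> Z \<gamma> I \<longrightarrow>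
       max_propagates_along \<Omega> (\<lambda>x. \<phi> x - \<psi> x) (\<gamma> ` I))"
proof (intro conjI allI impI)
  have "transpose (a x p) = a x p" if "x \<in> \<Omega>" for x p
    using sym[OF that] by (simp add: transpose_def vec_eq_iff)
  then show "\<exists>r X Y. sum_of_squares_decomp \<Omega> (frame_second_order e (\<lambda>x. a x (frame_grad e \<phi> x))) r X Y"
    using rk psd
    by (intro frame_sum_of_squares[where rt = rt] C_inf_on_coefficient C_inf_on_frame_grad assms(1) a e \<phi>) auto
  fix r X Y Z \<gamma> I
  assume "sum_of_squares_decomp \<Omega> (frame_second_order e (\<lambda>x. a x (frame_grad e \<phi> x))) r X Y \<and>
       Z \<in> lie_module \<Omega> r X \<and> integral_curve \<Omega> Z \<gamma> I"
  then have sos: "sum_of_squares_decomp \<Omega> (frame_second_order e (\<lambda>x. a x (frame_grad e \<phi> x))) r X Y"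
    and Z: "Z \<in> lie_module \<Omega> r X" and \<gamma>: "integral_curve \<Omega> Z \<gamma> I" by simp_all
  have Q': "\<And>x. x \<in> \<Omega> \<Longrightarrow> frame_quasilinear_op e a b \<psi> x \<le> frame_quasilinear_op e a b \<phi> x" using Q by simp
  show "max_propagates_along \<Omega> (\<lambda>x. \<phi> x - \<psi> x) (\<gamma> ` I)"
    by (rule frame_max_propagates[OF assms(1) e a b bz \<phi> \<psi> Q' sos Z \<gamma>])
qed

text \<open>A partial derivative is the action of a constant field, so iterated derivatives agree
  literally and no commutator terms arise.\<close>

lemma standard_frame:
  "grad = frame_grad (\<lambda>i _. axis i 1)" "second_order = frame_second_order (\<lambda>i _. axis i 1)"
  "quasilinear_op = frame_quasilinear_op (\<lambda>i _. axis i 1)"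
proof -
  have p: "partial = (\<lambda>i. vf_apply (\<lambda>_. axis i 1))"
    by (intro ext) (simp add: partial_def vf_apply_def)
  show g: "grad = frame_grad (\<lambda>i _. axis i 1)"
    by (intro ext) (simp add: grad_def frame_grad_def p)
  show s: "second_order = frame_second_order (\<lambda>i _. axis i 1)"
    by (intro ext) (simp add: second_order_def frame_second_order_def p)
  show "quasilinear_op = frame_quasilinear_op (\<lambda>i _. axis i 1)"
    by (intro ext) (simp add: quasilinear_op_def frame_quasilinear_op_def g s)
qed
text \<open>The rank condition takes the place of an assumed decomposition. The conclusion therefore
  asserts that decompositions exist and that maxima propagate for each of them; without the first
  half the second could be vacuous.\<close>

theorem mainTheorem3:
  fixes m :: nat
    and \<Omega> :: "(real^'n) set"
    and a :: "real^'n \<Rightarrow> real^'n \<Rightarrow> real^'n^'n"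
    and b :: "real^'n \<Rightarrow> real \<Rightarrow> real^'n \<Rightarrow> real"
  assumes "1 \<le> m" and "CARD('n) = m + 1"
    and "open \<Omega>" and "connected \<Omega>" and "\<Omega> \<noteq> {}"
    and "C_inf_on (\<Omega> \<times> UNIV) (\<lambda>(x, p). a x p)"
    and "C_inf_on (\<Omega> \<times> UNIV \<times> UNIV) (\<lambda>(x, z, p). b x z p)"
    and "\<And>x p \<xi>. x \<in> \<Omega> \<Longrightarrow> 0 \<le> \<xi> \<bullet> (a x p *v \<xi>)"
    and "\<And>x p i j. x \<in> \<Omega> \<Longrightarrow> a x p $ i $ j = a x p $ j $ i"
    and "\<And>x z p. x \<in> \<Omega> \<Longrightarrow> deriv (\<lambda>s. b x s p) z \<le> 0"
  shows
    "(\<forall>\<phi> \<psi> rt.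
        C_inf_on \<Omega> \<phi> \<and> C_inf_on \<Omega> \<psi> \<and>
        (\<forall>x\<in>\<Omega>. quasilinear_op a b \<phi> x \<ge> quasilinear_op a b \<psi> x) \<and>
        (\<forall>x\<in>\<Omega>. rank (a x (grad \<phi> x)) = rt) \<longrightarrow>
        (\<exists>r X Y. sum_of_squares_decomp \<Omega> (second_order (\<lambda>x. a x (grad \<phi> x))) r X Y) \<and>
        (\<forall>r X Y Z \<gamma> I.
           sum_of_squares_decomp \<Omega> (second_order (\<lambda>x. a x (grad \<phi> x))) r X Y \<and>
           Z \<in> lie_module \<Omega> r X \<and> integral_curve \<Omega> Z \<gamma> I \<longrightarrow>
           max_propagates_along \<Omega> (\<lambda>x. \<phi> x - \<psi> x) (\<gamma> ` I)))
     \<and>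
     (\<forall>e \<phi> \<psi> rt.
        independent_fields \<Omega> e \<and> C_inf_on \<Omega> \<phi> \<and> C_inf_on \<Omega> \<psi> \<and>
        (\<forall>x\<in>\<Omega>. frame_quasilinear_op e a b \<phi> x \<ge> frame_quasilinear_op e a b \<psi> x) \<and>
        (\<forall>x\<in>\<Omega>. rank (a x (frame_grad e \<phi> x)) = rt) \<longrightarrow>
        (\<exists>r X Y. sum_of_squares_decomp \<Omega>
           (frame_second_order e (\<lambda>x. a x (frame_grad e \<phi> x))) r X Y) \<and>
        (\<forall>r X Y Z \<gamma> I.
           sum_of_squares_decomp \<Omega>
             (frame_second_order e (\<lambda>x. a x (frame_grad e \<phi> x))) r X Y \<and>
           Z \<in> lie_module \<Omega> r X \<and> integral_curve \<Omega> Z \<gamma> I \<longrightarrow>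
           max_propagates_along \<Omega> (\<lambda>x. \<phi> x - \<psi> x) (\<gamma> ` I)))"
\<comment> \<open>The instance of \<open>conjI\<close> separates the two principles and leaves
  intact the conjunction of existence and propagation inside each.\<close>
proof (intro conjI[of "\<forall>\<phi> \<psi> rt. _ \<phi> \<psi> rt"] allI impI)
  fix \<phi> \<psi> rt
  assume "C_inf_on \<Omega> \<phi> \<and> C_inf_on \<Omega> \<psi> \<and>
    (\<forall>x\<in>\<Omega>. quasilinear_op a b \<phi> x \<ge> quasilinear_op a b \<psi> x) \<and>
    (\<forall>x\<in>\<Omega>. rank (a x (grad \<phi> x)) = rt)"
  then show "(\<exists>r X Y. sum_of_squares_decomp \<Omega> (second_order (\<lambda>x. a x (grad \<phi> x))) r X Y) \<and>
    (\<forall>r X Y Z \<gamma> I.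
       sum_of_squares_decomp \<Omega> (second_order (\<lambda>x. a x (grad \<phi> x))) r X Y \<and>
       Z \<in> lie_module \<Omega> r X \<and> integral_curve \<Omega> Z \<gamma> I \<longrightarrow>
       max_propagates_along \<Omega> (\<lambda>x. \<phi> x - \<psi> x) (\<gamma> ` I))"
    unfolding standard_frame
    by (elim conjE) (rule frame_comparison[OF assms(3,6-10) C_inf_on_const])
next
  fix e \<phi> \<psi> rt
  assume "independent_fields \<Omega> e \<and> C_inf_on \<Omega> \<phi> \<and> C_inf_on \<Omega> \<psi> \<and>
    (\<forall>x\<in>\<Omega>. frame_quasilinear_op e a b \<phi> x \<ge> frame_quasilinear_op e a b \<psi> x) \<and>
    (\<forall>x\<in>\<Omega>. rank (a x (frame_grad e \<phi> x)) = rt)"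
  moreover from this have "C_inf_on \<Omega> (e i)" for i by (simp add: independent_fields_def)
  ultimately show "(\<exists>r X Y. sum_of_squares_decomp \<Omega> (frame_second_order e (\<lambda>x. a x (frame_grad e \<phi> x))) r X Y) \<and>
    (\<forall>r X Y Z \<gamma> I.
       sum_of_squares_decomp \<Omega> (frame_second_order e (\<lambda>x. a x (frame_grad e \<phi> x))) r X Y \<and>
       Z \<in> lie_module \<Omega> r X \<and> integral_curve \<Omega> Z \<gamma> I \<longrightarrow>
       max_propagates_along \<Omega> (\<lambda>x. \<phi> x - \<psi> x) (\<gamma> ` I))"
    by (elim conjE) (rule frame_comparison[OF assms(3,6-10)])
qed

end
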